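(* (Cut-upper set correspondence) Let $u\in\operatorname{Int}(P)\cap N$ be an interior lattice point of $P$. Then there is a surjective map \[C'(-)\colon\{\text{non-trivial upper sets in }q_u^{-1}(J)\}\longrightarrow\{\text{cuts of }Q(C)\text{ of type }u\},\qquad I'\longmapsto C'\big(I'\cap(I'^c+\vec p_u)\big),\] where $I'^c$ is the complement of $I'$ in $q_u^{-1}(J)$. For non-trivial upper sets $I'_1,I'_2$ in $q_u^{-1}(J)$, $C'(I'_1)=C'(I'_2)$ holds if and only if $I'_2=I'_1+n\vec p_u$ for some $n\in\mathbb Z$.
   Context: Polytope and group $H$. Let $N\cong\mathbb Z^d$, $M=\operatorname{Hom}_{\mathbb Z}(N,\mathbb Z)$, and let $P\subset N_{\mathbb R}$ be a $d$-dimensional simplicial lattice polytope with exactly $d+2$ vertices. Let $F$ be the free abelian group on the vertices, $\mathbf p\in F$ the sum of all basis elements, $F_{\ge0}$ the set of elements with nonnegative coordinates, $A_P\colon M\to F$ the map sending $m$ to the vector whose coordinate at a vertex $v$ is $\langle m,v\rangle$, and $H=F/(A_P(M)+\mathbb Z\mathbf p)$, a group of rank one, with projection $\deg_H\colon F\to H$ and $\pi\colon H\to H/H_{\rm tors}\cong\mathbb Z$. The vertices can be labelled $v_0,\dots,v_l,v'_0,\dots,v'_{l'}$ with $l,l'\ge1$, $l+l'=d$, with basis elements $e_i,e'_{i'}$ of $F$ and images $\bar x_i=\deg_H(e_i)$, $\bar x'_{i'}=\deg_H(e'_{i'})$, such that $\pi(\bar x_i)>0$ and $\pi(\bar x'_{i'})<0$.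 Order $H$ by $h_1\ge h_2$ iff $h_1-h_2\in\sum_i\mathbb Z_{\ge0}\bar x_i+\sum_{i'}\mathbb Z_{\ge0}(-\bar x'_{i'})$, and put $s=\sum_i\bar x_i=-\sum_{i'}\bar x'_{i'}$. An upper set of a poset is a subset closed under going up; it is non-trivial if it is neither empty nor everything. Fix a non-trivial upper set $I\subset H$ and put $J=J(I)=I\cap(I^c+s)$; it is a complete set of representatives of $H/\mathbb Zs$. Quiver $Q(C)$. Let $L=\{v\in\mathbb Z^{l+1}\mid\sum v_i=0\}$ with elements $\alpha_i=f_i-f_{i-1}$ ($1\le i\le l$), $\alpha_0=f_0-f_l$ ($f_i$ unit vectors), and define $L'\subset\mathbb Z^{l'+1}$ and $\alpha'_{i'}$ similarly. Let $\Psi\colon L\oplus L'\to H/\mathbb Zs$ be the surjection $\alpha_i\mapsto\bar x_i$, $\alpha'_{i'}\mapsto\bar x'_{i'}$ and $B=\ker\Psi$. Let $\widehat Q$ be the quiver with vertex set $L\oplus L'$ and arrows $x\to x+\alpha_i$, $x\to x+\alpha'_{i'}$ for all $x,i,i'$. For $x\in L\oplus L'$ let $h_x\in J$ be the representative of $\Psi(x)$. Let $\widehat C$ be the set of arrows $x\to x+\alpha_i$ with $h_x+\bar x_i\notin J$ and arrows $x\to x+\alpha'_{i'}$ with $h_x+\bar x'_{i'}\notin J$. The quiver $\widehat Q(\widehat C)$ has vertex set $L\oplus L'$ and arrows $\widehat Q_1\setminus\widehat C$ together with one new arrow $x\to x+\alpha_i+\alpha'_{i'}$ for every $x,i,i'$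 such that both $x\to x+\alpha_i$ and $x\to x+\alpha'_{i'}$ lie in $\widehat C$. $B$ acts by translation; put $Q(C)=\widehat Q(\widehat C)/B$ and $C=C(I)=\widehat C/B$. Vertices of $Q(C)$ are identified with $(L\oplus L')/B\cong H/\mathbb Zs\cong J$. Cuts of $Q(C)$. Arrows of $Q(C)$ have labels in $F$: $\lambda(x\to x+\alpha_i)=e_i$, $\lambda(x\to x+\alpha'_{i'})=e'_{i'}$, $\lambda(x\to x+\alpha_i+\alpha'_{i'})=e_i+e'_{i'}$; $\lambda(\gamma)$ of a path $\gamma$ is the sum of labels of its arrows. An elementary cycle is a cycle $c$ with $\lambda(c)=\mathbf p$. For $C'\subset Q(C)_1$ let $\varepsilon_{C'}(\gamma)$ be the number of arrows of $\gamma$ (with multiplicity) lying in $C'$. $C'$ is a cut of $Q(C)$ if (i) every elementary cycle has exactly one arrow in $C'$, and (ii) $\varepsilon_{C'}(\gamma)=\varepsilon_{C'}(\gamma')$ for paths $\gamma,\gamma'$ with the same source, the same target and $\lambda(\gamma)=\lambda(\gamma')$. Type: for a cut $C'$ and $b\in B$ choose $x\in L\oplus L'$ and a path $\gamma\colon x\to x+b$ in $\widehat Q(\widehat C)$ and put $\kappa_{C'}(b)=\lambda(\gamma)-\varepsilon_{C'}(\gamma)\mathbf p\in F$ (computed on the image of $\gamma$ in $Q(C)$); this is well defined, gives a homomorphism $\kappa_{C'}\colon B\to F$, and there is a unique $u(C')\in N$ with $\operatorname{Im}\kappa_{C'}=\{A_P(m)-\langle m,u(C')\rangle\mathbf p\mid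 m\in M\}$. One has $u(C')\in P\cap N$; $u(C')$ is the type of $C'$. Lifts. For $u\in N$ put $A_u(m)=A_P(m)-\langle m,u\rangle\mathbf p$, $G_u=F/A_u(M)$, let $\vec p_u\in G_u$ be the image of $\mathbf p$ and $q_u\colon G_u\to H$ the induced surjection (kernel $\mathbb Z\vec p_u$). For $u\in\operatorname{Int}(P)\cap N$, $G_u$ is partially ordered by $\vec g_1\ge\vec g_2$ iff $\vec g_1-\vec g_2$ lies in the image of $F_{\ge0}$, and $q_u^{-1}(J)$ has the induced order. For a non-trivial upper set $I'\subset q_u^{-1}(J)$ and $J'=I'\cap(I'^c+\vec p_u)$, $q_u$ restricts to a bijection $J'\to J$, and $C'(J')\subset Q(C)_1$ is the set of arrows $a\colon h\to h'$ such that $\tilde h+\vec\lambda(a)=\tilde h'+\vec p_u$, where $\tilde h,\tilde h'\in J'$ are the lifts of $h,h'\in J$ and $\vec\lambda(a)\in G_u$ is the image of $\lambda(a)$. One abbreviates $C'(I')=C'(J')$. *)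

theory Defs
  imports
    "HOL-Analysis.Polytope"
    "HOL-Algebra.Free_Abelian_Groups"
    "HOL-Library.Product_Plus"
    "Graph_Theory.Arc_Walk"
begin

section \<open>Generalities\<close>

definition real_vec :: "int ^ 'n \<Rightarrow> real ^ 'n" where
  "real_vec w = (\<chi> i. real_of_int (w $ i))"

text \<open>
  The lattice \<open>N\<close> is the type \<^typ>\<open>int ^ 'n\<close>, so that \<open>d = CARD('n)\<close>, and the
  pairing of \<open>M = Hom(N, \<int>)\<close> with \<open>N\<close> is function application.
\<close>
definition dual_lattice :: "(int ^ 'n \<Rightarrow> int) set" where
  "dual_lattice = {m. Modules.additive m}"

definition torsion_subgroup :: "('a, 'b) monoid_scheme \<Rightarrow> 'a set" where
  "torsion_subgroup G = {g \<in> carrier G. \<exists>n::nat. n > 0 \<and> g [^]\<^bsub>G\<^esub> n = \<one>\<^bsub>G\<^esub>}"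

text \<open>
  Here \<open>ge a b\<close> stands for \<open>a \<ge> b\<close> in a poset with underlying set \<open>A\<close>.
\<close>
definition nontrivial_upper_set :: "'a set \<Rightarrow> ('a \<Rightarrow> 'a \<Rightarrow> bool) \<Rightarrow> 'a set \<Rightarrow> bool" where
  "nontrivial_upper_set A ge U \<longleftrightarrow>
     U \<subseteq> A \<and> (\<forall>a\<in>U. \<forall>b\<in>A. ge b a \<longrightarrow> b \<in> U) \<and> U \<noteq> {} \<and> U \<noteq> A"

definition root_lattice :: "nat \<Rightarrow> (nat \<Rightarrow>\<^sub>0 int) monoid" where
  "root_lattice n = (free_Abelian_group {..n})
     \<lparr>carrier := {w \<in> carrier (free_Abelian_group {..n}). (\<Sum>i\<le>n. Poly_Mapping.lookup w i) = 0}\<rparr>"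

definition root_vec :: "nat \<Rightarrow> nat \<Rightarrow> (nat \<Rightarrow>\<^sub>0 int)" where
  "root_vec n i = (if i = 0 then frag_of 0 - frag_of n else frag_of i - frag_of (i - 1))"

text \<open>
  An arrow of one of the infinite quivers on \<open>L \<oplus> L'\<close> is a pair of its source and its kind:
  \<open>Plain i\<close>, \<open>Primed i'\<close>, \<open>Composite i i'\<close> mean displacement by
  \<open>\<alpha>\<^sub>i\<close>, \<open>\<alpha>'\<^sub>i\<^sub>'\<close>, \<open>\<alpha>\<^sub>i + \<alpha>'\<^sub>i\<^sub>'\<close> respectively.
\<close>
datatype arrow_kind = Plain nat | Primed nat | Composite nat nat

type_synonym latt_vertex = "(nat \<Rightarrow>\<^sub>0 int) \<times> (nat \<Rightarrow>\<^sub>0 int)"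
type_synonym latt_arrow = "latt_vertex \<times> arrow_kind"
type_synonym quot_vertex = "latt_vertex set"
type_synonym quot_arrow = "quot_vertex \<times> arrow_kind"


section \<open>The polytope and the group H\<close>

locale polytope_data =
  fixes P :: "(real ^ 'n) set"
    and l l' :: nat
    and v v' :: "nat \<Rightarrow> int ^ 'n"
begin

definition vertices :: "(int ^ 'n) set" where
  "vertices = {w. real_vec w extreme_point_of P}"

definition F :: "((int ^ 'n) \<Rightarrow>\<^sub>0 int) monoid" where
  "F = free_Abelian_group vertices"

definition bold_p :: "(int ^ 'n) \<Rightarrow>\<^sub>0 int" where
  "bold_p = (\<Sum>w\<in>vertices. frag_of w)"

definition F_nonneg :: "((int ^ 'n) \<Rightarrow>\<^sub>0 int) set" where
  "F_nonneg = {a \<in> carrier F. \<forall>w. Poly_Mapping.lookup a w \<ge> 0}"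

definition A_P :: "(int ^ 'n \<Rightarrow> int) \<Rightarrow> ((int ^ 'n) \<Rightarrow>\<^sub>0 int)" where
  "A_P m = (\<Sum>w\<in>vertices. frag_cmul (m w) (frag_of w))"

definition ker_H :: "((int ^ 'n) \<Rightarrow>\<^sub>0 int) set" where
  "ker_H = {A_P m + frag_cmul k bold_p | m k. m \<in> dual_lattice}"

definition H :: "((int ^ 'n) \<Rightarrow>\<^sub>0 int) set monoid" where
  "H = F Mod ker_H"

definition deg_H :: "((int ^ 'n) \<Rightarrow>\<^sub>0 int) \<Rightarrow> ((int ^ 'n) \<Rightarrow>\<^sub>0 int) set" where
  "deg_H a = ker_H #>\<^bsub>F\<^esub> a"

definition e :: "nat \<Rightarrow> ((int ^ 'n) \<Rightarrow>\<^sub>0 int)" where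
  "e i = frag_of (v i)"

definition e' :: "nat \<Rightarrow> ((int ^ 'n) \<Rightarrow>\<^sub>0 int)" where
  "e' i = frag_of (v' i)"

definition xbar :: "nat \<Rightarrow> ((int ^ 'n) \<Rightarrow>\<^sub>0 int) set" where
  "xbar i = deg_H (e i)"

definition xbar' :: "nat \<Rightarrow> ((int ^ 'n) \<Rightarrow>\<^sub>0 int) set" where
  "xbar' i = deg_H (e' i)"

definition ge_H :: "((int ^ 'n) \<Rightarrow>\<^sub>0 int) set \<Rightarrow> ((int ^ 'n) \<Rightarrow>\<^sub>0 int) set \<Rightarrow> bool" where
  "ge_H h1 h2 \<longleftrightarrow> (\<exists>(a :: nat \<Rightarrow> nat) (b :: nat \<Rightarrow> nat).
     h1 \<otimes>\<^bsub>H\<^esub> inv\<^bsub>H\<^esub> h2 =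
       finprod H (\<lambda>i. xbar i [^]\<^bsub>H\<^esub> a i) {..l} \<otimes>\<^bsub>H\<^esub>
       finprod H (\<lambda>i. (inv\<^bsub>H\<^esub> xbar' i) [^]\<^bsub>H\<^esub> b i) {..l'})"

definition s :: "((int ^ 'n) \<Rightarrow>\<^sub>0 int) set" where
  "s = finprod H xbar {..l}"

definition Zs :: "((int ^ 'n) \<Rightarrow>\<^sub>0 int) set set" where
  "Zs = generate H {s}"

definition H_mod_s :: "((int ^ 'n) \<Rightarrow>\<^sub>0 int) set set monoid" where
  "H_mod_s = H Mod Zs"


section \<open>The lattice of periods\<close>

definition LL :: "latt_vertex monoid" where
  "LL = root_lattice l \<times>\<times> root_lattice l'"

fun step :: "arrow_kind \<Rightarrow> latt_vertex" where
  "step (Plain i) = (root_vec l i, 0)"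
| "step (Primed j) = (0, root_vec l' j)"
| "step (Composite i j) = (root_vec l i, root_vec l' j)"

fun label :: "arrow_kind \<Rightarrow> ((int ^ 'n) \<Rightarrow>\<^sub>0 int)" where
  "label (Plain i) = e i"
| "label (Primed j) = e' j"
| "label (Composite i j) = e i + e' j"

text \<open>
  The conditions below determine the homomorphism uniquely on the carrier of \<^term>\<open>LL\<close>;
  its values elsewhere are irrelevant.
\<close>
definition Psi :: "latt_vertex \<Rightarrow> ((int ^ 'n) \<Rightarrow>\<^sub>0 int) set set" where
  "Psi = (SOME f. f \<in> hom LL H_mod_s \<and>
     (\<forall>i\<le>l. f (step (Plain i)) = Zs #>\<^bsub>H\<^esub> xbar i) \<and>
     (\<forall>j\<le>l'. f (step (Primed j)) = Zs #>\<^bsub>H\<^esub> xbar' j))"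

definition B :: "latt_vertex set" where
  "B = kernel LL H_mod_s Psi"

text \<open>
  Translation by \<^term>\<open>B\<close> does not change the kind of an arrow, so an orbit of arrows is
  recorded as the orbit of the sources together with the common kind.
\<close>
definition orbit :: "latt_vertex \<Rightarrow> quot_vertex" where
  "orbit x = {x + b | b. b \<in> B}"

definition orbit_arrow :: "latt_arrow \<Rightarrow> quot_arrow" where
  "orbit_arrow a = (orbit (fst a), snd a)"

definition path_label :: "('a \<times> arrow_kind) list \<Rightarrow> ((int ^ 'n) \<Rightarrow>\<^sub>0 int)" where
  "path_label \<gamma> = sum_list (map (\<lambda>a. label (snd a)) \<gamma>)"

definition eps :: "quot_arrow set \<Rightarrow> quot_arrow list \<Rightarrow> nat" where
  "eps C' \<gamma> = length (filter (\<lambda>a. a \<in> C') \<gamma>)"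


section \<open>The groups lifting H\<close>

definition A_u :: "int ^ 'n \<Rightarrow> (int ^ 'n \<Rightarrow> int) \<Rightarrow> ((int ^ 'n) \<Rightarrow>\<^sub>0 int)" where
  "A_u u m = A_P m - frag_cmul (m u) bold_p"

definition G :: "int ^ 'n \<Rightarrow> ((int ^ 'n) \<Rightarrow>\<^sub>0 int) set monoid" where
  "G u = F Mod (A_u u ` dual_lattice)"

definition deg_G :: "int ^ 'n \<Rightarrow> ((int ^ 'n) \<Rightarrow>\<^sub>0 int) \<Rightarrow> ((int ^ 'n) \<Rightarrow>\<^sub>0 int) set" where
  "deg_G u a = (A_u u ` dual_lattice) #>\<^bsub>F\<^esub> a"

definition p_vec :: "int ^ 'n \<Rightarrow> ((int ^ 'n) \<Rightarrow>\<^sub>0 int) set" where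
  "p_vec u = deg_G u bold_p"

text \<open>The homomorphism induced by \<^term>\<open>deg_H\<close>, which is constant on each coset \<open>g\<close>.\<close>
definition q :: "((int ^ 'n) \<Rightarrow>\<^sub>0 int) set \<Rightarrow> ((int ^ 'n) \<Rightarrow>\<^sub>0 int) set" where
  "q g = the_elem (deg_H ` g)"

definition ge_G ::
  "int ^ 'n \<Rightarrow> ((int ^ 'n) \<Rightarrow>\<^sub>0 int) set \<Rightarrow> ((int ^ 'n) \<Rightarrow>\<^sub>0 int) set \<Rightarrow> bool" where
  "ge_G u g1 g2 \<longleftrightarrow> g1 \<otimes>\<^bsub>G u\<^esub> inv\<^bsub>G u\<^esub> g2 \<in> deg_G u ` F_nonneg"

end


section \<open>The quiver of a non-trivial upper set and its cuts\<close>

locale quiver_data = polytope_data P l l' v v'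
  for P :: "(real ^ 'n) set"
    and l l' :: nat
    and v v' :: "nat \<Rightarrow> int ^ 'n" +
  fixes I :: "((int ^ 'n) \<Rightarrow>\<^sub>0 int) set set"
begin

definition J :: "((int ^ 'n) \<Rightarrow>\<^sub>0 int) set set" where
  "J = I \<inter> ((carrier H - I) #>\<^bsub>H\<^esub> s)"

definition rep :: "latt_vertex \<Rightarrow> ((int ^ 'n) \<Rightarrow>\<^sub>0 int) set" where
  "rep x = (THE h. h \<in> J \<and> h \<in> Psi x)"

definition C_hat :: "latt_arrow set" where
  "C_hat =
     {(x, Plain i) | x i. x \<in> carrier LL \<and> i \<le> l \<and> rep x \<otimes>\<^bsub>H\<^esub> xbar i \<notin> J} \<union>
     {(x, Primed j) | x j. x \<in> carrier LL \<and> j \<le> l' \<and> rep x \<otimes>\<^bsub>H\<^esub> xbar' j \<notin> J}"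

definition Q_hat :: "(latt_vertex, latt_arrow) pre_digraph" where
  "Q_hat = \<lparr>verts = carrier LL,
     arcs = {(x, Plain i) | x i. x \<in> carrier LL \<and> i \<le> l} \<union>
            {(x, Primed j) | x j. x \<in> carrier LL \<and> j \<le> l'},
     tail = fst, head = (\<lambda>(x, k). x + step k)\<rparr>"

definition Q_hat_C :: "(latt_vertex, latt_arrow) pre_digraph" where
  "Q_hat_C = \<lparr>verts = carrier LL,
     arcs = (arcs Q_hat - C_hat) \<union>
            {(x, Composite i j) | x i j. (x, Plain i) \<in> C_hat \<and> (x, Primed j) \<in> C_hat},
     tail = fst, head = (\<lambda>(x, k). x + step k)\<rparr>"

definition Q_C :: "(quot_vertex, quot_arrow) pre_digraph" where
  "Q_C = \<lparr>verts = orbit ` verts Q_hat_C,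
     arcs = orbit_arrow ` arcs Q_hat_C,
     tail = fst, head = (\<lambda>(X, k). (\<lambda>x. x + step k) ` X)\<rparr>"

text \<open>The identification of the vertices of the quotient quiver with \<^term>\<open>J\<close>.\<close>
definition vertex_J :: "quot_vertex \<Rightarrow> ((int ^ 'n) \<Rightarrow>\<^sub>0 int) set" where
  "vertex_J X = the_elem (rep ` X)"

text \<open>
  A cycle is a closed path; it may visit a vertex more than once, so this is not
  the notion of a cycle from the graph library.
\<close>
definition elementary_cycle :: "quot_arrow list \<Rightarrow> bool" where
  "elementary_cycle \<gamma> \<longleftrightarrow> (\<exists>X. pre_digraph.awalk Q_C X \<gamma> X) \<and> path_label \<gamma> = bold_p"

definition cut :: "quot_arrow set \<Rightarrow> bool" where
  "cut C' \<longleftrightarrow> C' \<subseteq> arcs Q_C \<and>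
     (\<forall>\<gamma>. elementary_cycle \<gamma> \<longrightarrow> eps C' \<gamma> = 1) \<and>
     (\<forall>X Y \<gamma> \<gamma>'. pre_digraph.awalk Q_C X \<gamma> Y \<and> pre_digraph.awalk Q_C X \<gamma>' Y \<and>
        path_label \<gamma> = path_label \<gamma>' \<longrightarrow> eps C' \<gamma> = eps C' \<gamma>')"

text \<open>For a cut, the value does not depend on the chosen path.\<close>
definition kappa :: "quot_arrow set \<Rightarrow> latt_vertex \<Rightarrow> ((int ^ 'n) \<Rightarrow>\<^sub>0 int)" where
  "kappa C' b = (SOME a. \<exists>x \<gamma>. x \<in> carrier LL \<and> pre_digraph.awalk Q_hat_C x \<gamma> (x + b) \<and>
     a = path_label \<gamma> - frag_cmul (int (eps C' (map orbit_arrow \<gamma>))) bold_p)"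

definition has_type :: "quot_arrow set \<Rightarrow> int ^ 'n \<Rightarrow> bool" where
  "has_type C' u \<longleftrightarrow>
     kappa C' ` B = {A_P m - frag_cmul (m u) bold_p | m. m \<in> dual_lattice}"

definition q_inv_J :: "int ^ 'n \<Rightarrow> ((int ^ 'n) \<Rightarrow>\<^sub>0 int) set set" where
  "q_inv_J u = {g \<in> carrier (G u). q g \<in> J}"

definition J_of :: "int ^ 'n \<Rightarrow> ((int ^ 'n) \<Rightarrow>\<^sub>0 int) set set \<Rightarrow> ((int ^ 'n) \<Rightarrow>\<^sub>0 int) set set" where
  "J_of u I' = I' \<inter> ((q_inv_J u - I') #>\<^bsub>G u\<^esub> p_vec u)"

definition lift :: "((int ^ 'n) \<Rightarrow>\<^sub>0 int) set set \<Rightarrow>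
    ((int ^ 'n) \<Rightarrow>\<^sub>0 int) set \<Rightarrow> ((int ^ 'n) \<Rightarrow>\<^sub>0 int) set" where
  "lift J' h = inv_into J' q h"

definition C_of :: "int ^ 'n \<Rightarrow> ((int ^ 'n) \<Rightarrow>\<^sub>0 int) set set \<Rightarrow> quot_arrow set" where
  "C_of u J' = {a \<in> arcs Q_C.
     lift J' (vertex_J (tail Q_C a)) \<otimes>\<^bsub>G u\<^esub> deg_G u (label (snd a)) =
     lift J' (vertex_J (head Q_C a)) \<otimes>\<^bsub>G u\<^esub> p_vec u}"

definition upper_sets :: "int ^ 'n \<Rightarrow> ((int ^ 'n) \<Rightarrow>\<^sub>0 int) set set set" where
  "upper_sets u = {I'. nontrivial_upper_set (q_inv_J u) (ge_G u) I'}"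

definition cuts_of_type :: "int ^ 'n \<Rightarrow> quot_arrow set set" where
  "cuts_of_type u = {C'. cut C' \<and> has_type C' u}"

end


section \<open>The standing assumptions\<close>

locale simplicial_setting = quiver_data P l l' v v' I
  for P :: "(real ^ 'n) set"
    and l l' :: nat
    and v v' :: "nat \<Rightarrow> int ^ 'n"
    and I :: "((int ^ 'n) \<Rightarrow>\<^sub>0 int) set set" +
  assumes polytope_P: "polytope P"
    and full_dim: "aff_dim P = int CARD('n)"
    and simplicial: "\<And>S. S facet_of P \<Longrightarrow> \<exists>n. n simplex S"
    and lattice_P: "{x. x extreme_point_of P} \<subseteq> range real_vec"
    and card_vertices: "card {x. x extreme_point_of P} = CARD('n) + 2"
    and l_pos: "l \<ge> 1" "l' \<ge> 1"
    and l_sum: "l + l' = CARD('n)"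
    and labelling: "inj_on v {..l}" "inj_on v' {..l'}" "v ` {..l} \<inter> v' ` {..l'} = {}"
      "v ` {..l} \<union> v' ` {..l'} = vertices"
    and signs: "\<exists>\<phi> \<in> iso (H Mod torsion_subgroup H) integer_group.
      (\<forall>i\<le>l. \<phi> (torsion_subgroup H #>\<^bsub>H\<^esub> xbar i) > 0) \<and>
      (\<forall>j\<le>l'. \<phi> (torsion_subgroup H #>\<^bsub>H\<^esub> xbar' j) < 0)"
    and upper_I: "nontrivial_upper_set (carrier H) ge_H I"

end

theory Submission
  imports Defs
begin

text \<open>
  Every arrow \<open>h \<rightarrow> h'\<close> of the quiver with label \<open>\<lambda>\<close> satisfies \<open>h' = h + \<lambda>\<close> in \<open>H\<close>, and
  \<open>0 \<le> \<lambda> \<le> p\<close>. Hence, for an upper set with threshold set \<open>J'\<close>, the lift of \<open>h\<close> plus \<open>\<lambda>\<close> is either the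
  lift of \<open>h'\<close> or that lift plus \<open>p\<close>, and \<open>C'\<close> collects the arrows of the second kind. Along a walk
  \<open>\<gamma>\<close> from \<open>h\<close> to \<open>h'\<close> the lifts therefore differ by \<open>\<lambda>(\<gamma>) - \<epsilon>(\<gamma>) p\<close>, which gives the
  cut axioms, the type \<open>u\<close>, and the fact that \<open>C'\<close> determines the lifts up to a common multiple of
  \<open>p\<close>. Conversely, for a cut of type \<open>u\<close> the elements \<open>\<lambda>(\<gamma>) - \<epsilon>(\<gamma>) p\<close> of closed walks vanish in the
  group lifting \<open>H\<close>, so \<open>\<lambda>(\<gamma>) - \<epsilon>(\<gamma>) p\<close>, taken over walks from a base vertex, is a consistent
  system of lifts; the set of all its translates by nonnegative multiples of \<open>p\<close> is an upper set because
  whenever two elements of \<open>J\<close> differ by a nonnegative element \<open>c\<close> of \<open>F\<close>, some walk has label \<open>c\<close>.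
\<close>

section \<open>Quotients of free abelian groups\<close>

text \<open>Three quotients interact: vertices of the quiver are orbits in
  \<open>L \<oplus> L'\<close>, the set \<open>J\<close> lives in \<open>H\<close>, and lifts live
  in \<open>G u\<close>. Cosets are therefore avoided, and everything is computed with
  representatives in \<open>F\<close>. Every vertex of the covering quiver is \<open>tau a\<close>
  for some \<open>a\<close> in \<open>FJ\<close>, the preimage of \<open>J\<close> in
  \<open>F\<close>. On \<open>F\<close> the maps \<open>tau\<close> and \<open>deg_H\<close> have
  common kernel \<open>\<int> p\<close>, so \<open>a\<close> is a vertex of the covering quiver
  together with exactly the multiple of \<open>p\<close> that a lift has to choose. Adding a label
  to \<open>a\<close> follows an arrow in all three quotients at once.

  The two orders disagree on the primed vertices: the elements \<open>xbar' j\<close> count as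
  negative in \<open>H\<close>, whereas all labels are nonnegative in \<open>G u\<close>. Composite
  arrows keep walks inside \<open>J\<close> when the step up and the step down both leave it.

  Reading off multiples of \<open>s\<close> and of \<open>p\<close> requires both to have infinite
  order. For \<open>s\<close> in \<open>H\<close> this follows from the existence of a non-trivial
  upper set; for the image of \<open>p\<close> in \<open>G u\<close> it follows from
  \<open>u\<close> lying in \<open>P\<close>.\<close>

locale free_quotient =
  fixes F :: "('a \<Rightarrow>\<^sub>0 int) monoid" and S :: "'a set" and K :: "('a \<Rightarrow>\<^sub>0 int) set"
  assumes F_eq: "F = free_Abelian_group S"
    and subgroup_K: "subgroup K F"
begin

lemma comm_group_F: "comm_group F"
  by (simp add: F_eq abelian_free_Abelian_group)

lemma normal_K: "K \<lhd> F"
  using comm_group.subgroup_imp_normal[OF comm_group_F subgroup_K] .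

lemma comm_group_quotient: "comm_group (F Mod K)"
  using comm_group.abelian_FactGroup[OF comm_group_F subgroup_K] .

lemma K_zero: "0 \<in> K"
  using subgroup.one_closed[OF subgroup_K] by (simp add: F_eq)

lemma K_add: "a \<in> K \<Longrightarrow> b \<in> K \<Longrightarrow> a + b \<in> K"
  using subgroup.m_closed[OF subgroup_K, of a b] by (simp add: F_eq)

lemma K_minus: "a \<in> K \<Longrightarrow> - a \<in> K"
  using subgroup.m_inv_closed[OF subgroup_K, of a] subgroup.mem_carrier[OF subgroup_K, of a]
  by (simp add: F_eq)

lemma K_diff: "a \<in> K \<Longrightarrow> b \<in> K \<Longrightarrow> a - b \<in> K"
  using K_add[OF _ K_minus, of a b] by simp

lemma mem_coset_iff: "x \<in> K #>\<^bsub>F\<^esub> a \<longleftrightarrow> x - a \<in> K"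
  by (auto simp: r_coset_def F_eq intro: rev_bexI)

lemma coset_eq_iff: "K #>\<^bsub>F\<^esub> a = K #>\<^bsub>F\<^esub> b \<longleftrightarrow> a - b \<in> K"
proof
  assume "K #>\<^bsub>F\<^esub> a = K #>\<^bsub>F\<^esub> b"
  then show "a - b \<in> K"
    using mem_coset_iff[of a a] mem_coset_iff[of a b] K_zero by simp
next
  assume ab: "a - b \<in> K"
  have "x - a \<in> K \<longleftrightarrow> x - b \<in> K" for x
    using K_add[OF _ ab, of "x - a"] K_diff[OF _ ab, of "x - b"] by (auto simp: algebra_simps)
  then show "K #>\<^bsub>F\<^esub> a = K #>\<^bsub>F\<^esub> b"
    by (auto simp: mem_coset_iff)
qed

lemma coset_mult:
  "a \<in> carrier F \<Longrightarrow> b \<in> carrier F \<Longrightarrow>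
    (K #>\<^bsub>F\<^esub> a) \<otimes>\<^bsub>F Mod K\<^esub> (K #>\<^bsub>F\<^esub> b) = K #>\<^bsub>F\<^esub> (a + b)"
  using normal.rcos_sum[OF normal_K] by (simp add: F_eq)

lemma coset_one: "\<one>\<^bsub>F Mod K\<^esub> = K #>\<^bsub>F\<^esub> 0"
  using mem_coset_iff[of _ 0] by (simp add: set_eq_iff)

lemma coset_carrier: "carrier (F Mod K) = (\<lambda>a. K #>\<^bsub>F\<^esub> a) ` carrier F"
  by (simp add: carrier_FactGroup)

lemma coset_inv:
  assumes "a \<in> carrier F"
  shows "inv\<^bsub>F Mod K\<^esub> (K #>\<^bsub>F\<^esub> a) = K #>\<^bsub>F\<^esub> (- a)"
proof (rule group.inv_equality[OF comm_group.axioms(2)[OF comm_group_quotient]])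
  have m: "- a \<in> carrier F" using assms by (simp add: F_eq)
  show "(K #>\<^bsub>F\<^esub> - a) \<otimes>\<^bsub>F Mod K\<^esub> (K #>\<^bsub>F\<^esub> a) = \<one>\<^bsub>F Mod K\<^esub>"
    by (subst coset_mult[OF m assms]) (simp add: coset_one del: one_FactGroup)
  show "K #>\<^bsub>F\<^esub> a \<in> carrier (F Mod K)" "K #>\<^bsub>F\<^esub> - a \<in> carrier (F Mod K)"
    unfolding coset_carrier using assms m by blast+
qed

lemma coset_nat_pow:
  "a \<in> carrier F \<Longrightarrow> (K #>\<^bsub>F\<^esub> a) [^]\<^bsub>F Mod K\<^esub> (n::nat) = K #>\<^bsub>F\<^esub> frag_cmul (int n) a"
  using normal.FactGroup_pow[OF normal_K] by (simp add: F_eq)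

lemma coset_int_pow:
  "a \<in> carrier F \<Longrightarrow> (K #>\<^bsub>F\<^esub> a) [^]\<^bsub>F Mod K\<^esub> (n::int) = K #>\<^bsub>F\<^esub> frag_cmul n a"
  using normal.FactGroup_int_pow[OF normal_K] by (simp add: F_eq)

lemma coset_finprod:
  assumes "finite A" and "\<And>i. i \<in> A \<Longrightarrow> f i \<in> carrier F"
  shows "finprod (F Mod K) (\<lambda>i. K #>\<^bsub>F\<^esub> f i) A = K #>\<^bsub>F\<^esub> (\<Sum>i\<in>A. f i)"
  using assms
proof (induction A rule: finite_induct)
  case empty
  show ?case
    unfolding comm_monoid.finprod_empty[OF comm_group.axioms(1)[OF comm_group_quotient]] coset_one
    by simp
next
  case (insert i A)
  have "sum f A \<in> carrier F"
    unfolding F_eq using insert.prems by (intro sum_closed_free_Abelian_group) (auto simp: F_eq)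
  moreover have "finprod (F Mod K) (\<lambda>i. K #>\<^bsub>F\<^esub> f i) (insert i A) =
      (K #>\<^bsub>F\<^esub> f i) \<otimes>\<^bsub>F Mod K\<^esub> finprod (F Mod K) (\<lambda>i. K #>\<^bsub>F\<^esub> f i) A"
    using insert
    by (intro comm_monoid.finprod_insert[OF comm_group.axioms(1)[OF comm_group_quotient]])
       (auto simp: coset_carrier)
  ultimately show ?case
    using insert coset_mult[of "f i" "sum f A"] by simp
qed

end

section \<open>The groups \<open>F\<close>, \<open>H\<close> and \<open>G u\<close> in terms of
  representatives\<close>

context polytope_data
begin

lemma F_zero [simp]: "0 \<in> carrier F"
  and F_add [simp]: "a \<in> carrier F \<Longrightarrow> b \<in> carrier F \<Longrightarrow> a + b \<in> carrier F"
  and F_minus [simp]: "a \<in> carrier F \<Longrightarrow> - a \<in> carrier F"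
  and F_diff [simp]: "a \<in> carrier F \<Longrightarrow> b \<in> carrier F \<Longrightarrow> a - b \<in> carrier F"
  and F_cmul [simp]: "a \<in> carrier F \<Longrightarrow> frag_cmul n a \<in> carrier F"
  and F_frag_of [simp]: "frag_of w \<in> carrier F \<longleftrightarrow> w \<in> vertices"
  by (auto simp: F_def dest: subsetD[OF keys_add] subsetD[OF keys_diff] subsetD[OF keys_cmul])

lemma F_sum: "(\<And>i. i \<in> A \<Longrightarrow> f i \<in> carrier F) \<Longrightarrow> sum f A \<in> carrier F"
  unfolding F_def by (rule sum_closed_free_Abelian_group)

lemma bold_p_in_F [simp]: "bold_p \<in> carrier F"
  unfolding bold_p_def by (intro F_sum) simp

lemma A_P_in_F [simp]: "A_P m \<in> carrier F"
  unfolding A_P_def by (intro F_sum) simp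

lemma A_P_add: "A_P (\<lambda>w. m w + m' w) = A_P m + A_P m'"
  by (simp add: A_P_def frag_cmul_distrib sum.distrib)

lemma A_P_minus: "A_P (\<lambda>w. - m w) = - A_P m"
  by (simp add: A_P_def flip: sum_negf)

lemma A_u_in_F [simp]: "A_u u m \<in> carrier F"
  by (simp add: A_u_def)

lemma subgroup_A_u: "subgroup (A_u u ` dual_lattice) F"
proof (rule group.subgroupI)
  show "group F" by (simp add: F_def)
  show "A_u u ` dual_lattice \<subseteq> carrier F" by auto
  have "(\<lambda>_. 0) \<in> dual_lattice" by (simp add: dual_lattice_def additive_def)
  then show "A_u u ` dual_lattice \<noteq> {}" by blast
next
  fix a assume "a \<in> A_u u ` dual_lattice"
  then obtain m where m: "m \<in> dual_lattice" "a = A_u u m" by blast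
  have "(\<lambda>w. - m w) \<in> dual_lattice"
    using m(1) by (simp add: dual_lattice_def additive_def)
  moreover have "- a = A_u u (\<lambda>w. - m w)"
    by (simp add: A_u_def A_P_minus m)
  ultimately have "- a \<in> A_u u ` dual_lattice" by blast
  moreover have "inv\<^bsub>F\<^esub> a = - a"
    unfolding F_def using A_u_in_F[of u m] unfolding m(2) F_def
    by (intro inv_free_Abelian_group) simp
  ultimately show "inv\<^bsub>F\<^esub> a \<in> A_u u ` dual_lattice" by simp
next
  fix a b assume "a \<in> A_u u ` dual_lattice" "b \<in> A_u u ` dual_lattice"
  then obtain m m' where m: "m \<in> dual_lattice" "a = A_u u m" "m' \<in> dual_lattice" "b = A_u u m'"
    by blast
  have "(\<lambda>w. m w + m' w) \<in> dual_lattice"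
    using m by (simp add: dual_lattice_def additive_def)
  moreover have "a + b = A_u u (\<lambda>w. m w + m' w)"
    by (simp add: A_u_def A_P_add m frag_cmul_distrib)
  ultimately show "a \<otimes>\<^bsub>F\<^esub> b \<in> A_u u ` dual_lattice" by (auto simp: F_def)
qed

lemma free_quotient_G: "free_quotient F vertices (A_u u ` dual_lattice)"
  by (rule free_quotient.intro[OF F_def subgroup_A_u])

text \<open>The term \<open>m u\<close> is absorbed into the multiple of \<open>p\<close>, so
  \<open>u\<close> is arbitrary: this exhibits \<open>H\<close> as the quotient of each
  \<open>G u\<close> by \<open>p_vec u\<close>. With \<open>u = 0\<close> it also reduces the
  subgroup property of \<open>ker_H\<close> to that of the image of \<open>A_u\<close>.\<close>

lemma ker_H_iff: "a \<in> ker_H \<longleftrightarrow> (\<exists>n. a - frag_cmul n bold_p \<in> A_u u ` dual_lattice)"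
proof
  assume "a \<in> ker_H"
  then obtain m k where m: "m \<in> dual_lattice" "a = A_P m + frag_cmul k bold_p"
    by (auto simp: ker_H_def)
  have "a - frag_cmul (k + m u) bold_p = A_u u m"
    by (simp add: m A_u_def frag_cmul_distrib)
  then show "\<exists>n. a - frag_cmul n bold_p \<in> A_u u ` dual_lattice"
    using m(1) by blast
next
  assume "\<exists>n. a - frag_cmul n bold_p \<in> A_u u ` dual_lattice"
  then obtain n m where m: "m \<in> dual_lattice" "a - frag_cmul n bold_p = A_u u m" by blast
  then have "a = A_u u m + frag_cmul n bold_p"
    by (metis diff_add_cancel)
  then have "a = A_P m + frag_cmul (n - m u) bold_p"
    by (simp add: A_u_def frag_cmul_diff_distrib)
  then show "a \<in> ker_H" unfolding ker_H_def using m(1) by blast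
qed

lemma ker_H_in_F: "a \<in> ker_H \<Longrightarrow> a \<in> carrier F"
  by (auto simp: ker_H_def)

lemma subgroup_ker_H: "subgroup ker_H F"
proof -
  note K_zero = free_quotient.K_zero[OF free_quotient_G, of 0]
    and K_minus = free_quotient.K_minus[OF free_quotient_G, of _ 0]
    and K_add = free_quotient.K_add[OF free_quotient_G, of _ 0]
  show ?thesis
  proof (rule group.subgroupI)
    show "group F" by (simp add: F_def)
    show "ker_H \<subseteq> carrier F" by (auto simp: ker_H_def)
    have "0 \<in> ker_H" unfolding ker_H_iff[of _ 0] using K_zero by (auto intro!: exI[of _ 0])
    then show "ker_H \<noteq> {}" by blast
  next
    fix a assume a: "a \<in> ker_H"
    then obtain n where "a - frag_cmul n bold_p \<in> A_u 0 ` dual_lattice"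
      unfolding ker_H_iff[of _ 0] by blast
    moreover have "- a - frag_cmul (- n) bold_p = - (a - frag_cmul n bold_p)"
      by (intro poly_mapping_eqI) (simp add: lookup_minus)
    ultimately have "- a - frag_cmul (- n) bold_p \<in> A_u 0 ` dual_lattice"
      using K_minus by metis
    then have "- a \<in> ker_H" unfolding ker_H_iff[of _ 0] by blast
    moreover have "inv\<^bsub>F\<^esub> a = - a"
      using ker_H_in_F[OF a] unfolding F_def by (intro inv_free_Abelian_group) simp
    ultimately show "inv\<^bsub>F\<^esub> a \<in> ker_H" by simp
  next
    fix a b assume "a \<in> ker_H" "b \<in> ker_H"
    then obtain n k where "a - frag_cmul n bold_p \<in> A_u 0 ` dual_lattice"
        "b - frag_cmul k bold_p \<in> A_u 0 ` dual_lattice"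
      unfolding ker_H_iff[of _ 0] by blast
    moreover have "(a + b) - frag_cmul (n + k) bold_p =
        (a - frag_cmul n bold_p) + (b - frag_cmul k bold_p)"
      by (intro poly_mapping_eqI) (simp add: lookup_minus lookup_add distrib_right)
    ultimately have "(a + b) - frag_cmul (n + k) bold_p \<in> A_u 0 ` dual_lattice"
      using K_add by metis
    then show "a \<otimes>\<^bsub>F\<^esub> b \<in> ker_H" unfolding ker_H_iff[of _ 0] by (auto simp: F_def)
  qed
qed

lemma free_quotient_H: "free_quotient F vertices ker_H"
  by (rule free_quotient.intro[OF F_def subgroup_ker_H])

lemma deg_H_eq_iff: "deg_H a = deg_H b \<longleftrightarrow> a - b \<in> ker_H"
  unfolding deg_H_def by (rule free_quotient.coset_eq_iff[OF free_quotient_H])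

lemma deg_G_eq_iff: "deg_G u a = deg_G u b \<longleftrightarrow> a - b \<in> A_u u ` dual_lattice"
  unfolding deg_G_def by (rule free_quotient.coset_eq_iff[OF free_quotient_G])

lemma deg_H_mult: "a \<in> carrier F \<Longrightarrow> b \<in> carrier F \<Longrightarrow> deg_H a \<otimes>\<^bsub>H\<^esub> deg_H b = deg_H (a + b)"
  unfolding deg_H_def H_def by (rule free_quotient.coset_mult[OF free_quotient_H])

lemma deg_G_mult:
  "a \<in> carrier F \<Longrightarrow> b \<in> carrier F \<Longrightarrow> deg_G u a \<otimes>\<^bsub>G u\<^esub> deg_G u b = deg_G u (a + b)"
  unfolding deg_G_def G_def by (rule free_quotient.coset_mult[OF free_quotient_G])

lemma deg_H_inv: "a \<in> carrier F \<Longrightarrow> inv\<^bsub>H\<^esub> deg_H a = deg_H (- a)"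
  unfolding deg_H_def H_def by (rule free_quotient.coset_inv[OF free_quotient_H])

lemma deg_G_inv: "a \<in> carrier F \<Longrightarrow> inv\<^bsub>G u\<^esub> deg_G u a = deg_G u (- a)"
  unfolding deg_G_def G_def by (rule free_quotient.coset_inv[OF free_quotient_G])

lemma deg_H_nat_pow: "a \<in> carrier F \<Longrightarrow> deg_H a [^]\<^bsub>H\<^esub> (n::nat) = deg_H (frag_cmul (int n) a)"
  unfolding deg_H_def H_def by (rule free_quotient.coset_nat_pow[OF free_quotient_H])

lemma deg_H_int_pow: "a \<in> carrier F \<Longrightarrow> deg_H a [^]\<^bsub>H\<^esub> (n::int) = deg_H (frag_cmul n a)"
  unfolding deg_H_def H_def by (rule free_quotient.coset_int_pow[OF free_quotient_H])

lemma deg_G_int_pow: "a \<in> carrier F \<Longrightarrow> deg_G u a [^]\<^bsub>G u\<^esub> (n::int) = deg_G u (frag_cmul n a)"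
  unfolding deg_G_def G_def by (rule free_quotient.coset_int_pow[OF free_quotient_G])

lemma carrier_H: "carrier H = deg_H ` carrier F"
  unfolding deg_H_def H_def by (simp add: free_quotient.coset_carrier[OF free_quotient_H])

lemma carrier_G: "carrier (G u) = deg_G u ` carrier F"
  unfolding deg_G_def G_def by (simp add: free_quotient.coset_carrier[OF free_quotient_G])

lemma deg_H_finprod:
  assumes "finite A" and "\<And>i. i \<in> A \<Longrightarrow> f i \<in> carrier F"
  shows "finprod H (\<lambda>i. deg_H (f i)) A = deg_H (\<Sum>i\<in>A. f i)"
  unfolding deg_H_def H_def by (rule free_quotient.coset_finprod[OF free_quotient_H assms])

lemma comm_group_H: "comm_group H"
  unfolding H_def by (rule free_quotient.comm_group_quotient[OF free_quotient_H])

lemma deg_G_imp_deg_H: "deg_G u a = deg_G u b \<Longrightarrow> deg_H a = deg_H b"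
  unfolding deg_G_eq_iff deg_H_eq_iff ker_H_iff[of _ u] by (rule exI[of _ 0]) simp

text \<open>The kernel of \<open>q\<close> on \<open>G u\<close> is generated by
  \<open>p_vec u\<close>; a lift of an element of \<open>H\<close> is thus a choice of one
  integer.\<close>

lemma deg_H_eq_deg_G: "deg_H a = deg_H b \<Longrightarrow> \<exists>n. deg_G u a = deg_G u (b + frag_cmul n bold_p)"
  unfolding deg_G_eq_iff deg_H_eq_iff ker_H_iff[of _ u] by (simp add: diff_diff_eq)

lemma deg_H_bold_p: "deg_H (a + frag_cmul n bold_p) = deg_H a"
  unfolding deg_H_eq_iff ker_H_iff[of _ 0]
  using free_quotient.K_zero[OF free_quotient_G] by (intro exI[of _ n]) simp

lemma deg_H_add_cong: "deg_H a = deg_H b \<Longrightarrow> deg_H (a + c) = deg_H (b + c)"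
  by (simp add: deg_H_eq_iff)

lemma deg_G_add_cong: "deg_G u a = deg_G u b \<Longrightarrow> deg_G u (a + c) = deg_G u (b + c)"
  by (simp add: deg_G_eq_iff)

lemma q_deg_G: "q (deg_G u a) = deg_H a"
proof -
  have a: "a \<in> deg_G u a" 
    using free_quotient.K_zero[OF free_quotient_G]
    by (simp add: deg_G_def free_quotient.mem_coset_iff[OF free_quotient_G])
  have "deg_H b = deg_H a" if "b \<in> deg_G u a" for b
    using that deg_G_imp_deg_H[of u b a] deg_G_eq_iff[of u b a]
    by (simp add: deg_G_def free_quotient.mem_coset_iff[OF free_quotient_G])
  then have "deg_H ` deg_G u a = {deg_H a}" using a by blast
  then show ?thesis by (simp add: q_def)
qed

end

section \<open>The lattice of periods\<close>

text \<open>A cyclic difference: the unit vector at \<open>k\<close> occurs positively in the root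
  of index \<open>k\<close> and negatively in its cyclic successor.\<close>

lemma lookup_root_sum:
  "Poly_Mapping.lookup (\<Sum>i\<le>n. frag_cmul (c i) (root_vec n i)) k =
    (if k < n then c k - c (Suc k) else if k = n then c n - c 0 else 0)"
proof -
  have root: "Poly_Mapping.lookup (root_vec n i) k =
      (if k = i then 1 else 0) - (if i = (if k = n then 0 else Suc k) then 1 else 0)"
    if "i \<le> n" for i
    using that by (auto simp: root_vec_def lookup_minus lookup_one when_def)
  have "Poly_Mapping.lookup (\<Sum>i\<le>n. frag_cmul (c i) (root_vec n i)) k =
      (\<Sum>i\<le>n. (if k = i then c i else 0) - (if i = (if k = n then 0 else Suc k) then c i else 0))"
    unfolding lookup_sum lookup_frag_cmul by (intro sum.cong refl) (auto simp: root)
  also have "\<dots> = (if k < n then c k - c (Suc k) else if k = n then c n - c 0 else 0)"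
    by (auto simp: sum_subtractf)
  finally show ?thesis .
qed

lemma root_sum_in_root_lattice:
  "(\<Sum>i\<le>n. frag_cmul (c i) (root_vec n i)) \<in> carrier (root_lattice n)"
proof -
  let ?w = "\<Sum>i\<le>n. frag_cmul (c i) (root_vec n i)"
  have "Poly_Mapping.keys ?w \<subseteq> {..n}"
    by (intro subsetI) (auto simp: in_keys_iff lookup_root_sum split: if_splits)
  moreover have "(\<Sum>k\<le>n. Poly_Mapping.lookup ?w k) = 0"
  proof -
    have "(\<Sum>k\<le>n. Poly_Mapping.lookup ?w k) =
        (\<Sum>k\<le>n. if k < n then c k - c (Suc k) else c n - c 0)"
      by (intro sum.cong) (auto simp: lookup_root_sum)
    also have "\<dots> = (\<Sum>k<n. c k - c (Suc k)) + (c n - c 0)"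
      by (simp flip: lessThan_Suc_atMost)
    also have "(\<Sum>k<n. c k - c (Suc k)) = c 0 - c n"
      by (rule sum_lessThan_telescope')
    finally show ?thesis by simp
  qed
  ultimately show ?thesis by (simp add: root_lattice_def)
qed

text \<open>The differences of consecutive tail sums return the coordinates. The wrap-around
  coordinate at \<open>n\<close> comes out as its true value minus the total sum, which is why the
  total must vanish.\<close>

lemma root_sum_tails:
  assumes "w \<in> carrier (root_lattice n)"
  shows "(\<Sum>i\<le>n. frag_cmul (\<Sum>k=i..n. Poly_Mapping.lookup w k) (root_vec n i)) = w"
proof (rule poly_mapping_eqI)
  fix k
  have "Poly_Mapping.keys w \<subseteq> {..n}" and sum0: "(\<Sum>k=0..n. Poly_Mapping.lookup w k) = 0"
    using assms by (auto simp: root_lattice_def atMost_atLeast0)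
  then have "k > n \<Longrightarrow> Poly_Mapping.lookup w k = 0"
    by (metis atMost_iff in_keys_iff linorder_not_less subsetD)
  then show "Poly_Mapping.lookup
      (\<Sum>i\<le>n. frag_cmul (\<Sum>k=i..n. Poly_Mapping.lookup w k) (root_vec n i)) k =
      Poly_Mapping.lookup w k"
    unfolding lookup_root_sum sum0 by (auto simp: sum.atLeast_Suc_atMost)
qed

text \<open>Cyclic differences vanish only for constant families, so the roots satisfy a single
  relation up to multiples: their sum is zero.\<close>

lemma root_sum_eq_0_iff:
  "(\<Sum>i\<le>n. frag_cmul (c i) (root_vec n i)) = 0 \<longleftrightarrow> (\<forall>i\<le>n. c i = c 0)"
proof
  assume "(\<Sum>i\<le>n. frag_cmul (c i) (root_vec n i)) = 0"
  then have eq: "k < n \<Longrightarrow> c (Suc k) = c k" for k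
    using lookup_root_sum[of c n k] by (simp split: if_splits)
  show "\<forall>i\<le>n. c i = c 0"
  proof (intro allI impI)
    fix i assume "i \<le> n"
    then show "c i = c 0" by (induction i) (auto simp: eq)
  qed
next
  assume c: "\<forall>i\<le>n. c i = c 0"
  have "k < n \<Longrightarrow> c k - c (Suc k) = 0" "c n - c 0 = 0" for k
    using c[rule_format, of k] c[rule_format, of "Suc k"] c[rule_format, of n] by auto
  then show "(\<Sum>i\<le>n. frag_cmul (c i) (root_vec n i)) = 0"
    by (intro poly_mapping_eqI) (simp add: lookup_root_sum del: right_minus_eq)
qed

context polytope_data
begin

text \<open>Together with \<open>neg_p\<close> this splits \<open>p\<close>: the two halves have
  degrees \<open>s\<close> and \<open>-s\<close> in \<open>H\<close> and span the kernel of
  \<open>tau\<close> on \<open>F\<close>.\<close>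

definition pos_p :: "(int ^ 'n) \<Rightarrow>\<^sub>0 int" where
  "pos_p = (\<Sum>i\<le>l. e i)"

definition neg_p :: "(int ^ 'n) \<Rightarrow>\<^sub>0 int" where
  "neg_p = (\<Sum>j\<le>l'. e' j)"

text \<open>The displacement of a path with label \<open>a\<close>. It is defined linearly on all of
  \<open>F\<close>, not only on labels, so that vertices too can be written as
  \<open>tau a\<close>.\<close>

definition tau :: "((int ^ 'n) \<Rightarrow>\<^sub>0 int) \<Rightarrow> latt_vertex" where
  "tau a = (\<Sum>i\<le>l. frag_cmul (Poly_Mapping.lookup a (v i)) (root_vec l i),
            \<Sum>j\<le>l'. frag_cmul (Poly_Mapping.lookup a (v' j)) (root_vec l' j))"

text \<open>
  The coordinates of \<open>\<Sum>\<^sub>i c\<^sub>i \<alpha>\<^sub>i\<close> are the differences \<open>c\<^sub>k - c\<^sub>k\<^sub>+\<^sub>1\<close>, so tail sums invert \<open>tau\<close> up to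
  the relations \<open>\<Sum>\<^sub>i \<alpha>\<^sub>i = 0\<close> and \<open>\<Sum>\<^sub>j \<alpha>'\<^sub>j = 0\<close>.
\<close>
definition sigma :: "latt_vertex \<Rightarrow> ((int ^ 'n) \<Rightarrow>\<^sub>0 int)" where
  "sigma x = (\<Sum>i\<le>l. frag_cmul (\<Sum>k=i..l. Poly_Mapping.lookup (fst x) k) (e i)) +
             (\<Sum>j\<le>l'. frag_cmul (\<Sum>k=j..l'. Poly_Mapping.lookup (snd x) k) (e' j))"

lemma tau_add: "tau (a + b) = tau a + tau b"
  by (simp add: tau_def lookup_add frag_cmul_distrib sum.distrib)

lemma tau_diff: "tau (a - b) = tau a - tau b"
  by (simp add: tau_def lookup_minus frag_cmul_diff_distrib sum_subtractf)

lemma tau_zero: "tau 0 = 0"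
  by (simp add: tau_def zero_prod_def)

lemma sigma_add: "sigma (x + y) = sigma x + sigma y"
  by (simp add: sigma_def lookup_add sum.distrib frag_cmul_distrib)

lemma carrier_LL: "carrier LL = carrier (root_lattice l) \<times> carrier (root_lattice l')"
  by (simp add: LL_def)

lemma mult_LL: "x \<otimes>\<^bsub>LL\<^esub> y = x + y"
  by (simp add: LL_def mult_DirProd' root_lattice_def free_Abelian_group_def plus_prod_def)

lemma tau_in_LL [simp]: "tau a \<in> carrier LL"
  by (simp add: carrier_LL tau_def root_sum_in_root_lattice)

fun kind_ok :: "arrow_kind \<Rightarrow> bool" where
  "kind_ok (Plain i) \<longleftrightarrow> i \<le> l"
| "kind_ok (Primed j) \<longleftrightarrow> j \<le> l'"
| "kind_ok (Composite i j) \<longleftrightarrow> i \<le> l \<and> j \<le> l'"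

end

section \<open>Coordinates with respect to the labelled vertices\<close>

context simplicial_setting
begin

lemma finite_vertices: "finite vertices"
  by (simp flip: labelling(4))

lemma v_in_vertices [simp]: "i \<le> l \<Longrightarrow> v i \<in> vertices" "j \<le> l' \<Longrightarrow> v' j \<in> vertices"
  by (auto simp flip: labelling(4))

lemma e_in_F [simp]: "i \<le> l \<Longrightarrow> e i \<in> carrier F" "j \<le> l' \<Longrightarrow> e' j \<in> carrier F"
  by (simp_all add: e_def e'_def)

lemma v_eq_iff [simp]:
  "i \<le> l \<Longrightarrow> k \<le> l \<Longrightarrow> v i = v k \<longleftrightarrow> i = k"
  "j \<le> l' \<Longrightarrow> m \<le> l' \<Longrightarrow> v' j = v' m \<longleftrightarrow> j = m"
  "i \<le> l \<Longrightarrow> j \<le> l' \<Longrightarrow> v i \<noteq> v' j"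
  "i \<le> l \<Longrightarrow> j \<le> l' \<Longrightarrow> v' j \<noteq> v i"
  using labelling(1-3) by (auto simp: inj_on_eq_iff)

lemma lookup_e [simp]:
  "i \<le> l \<Longrightarrow> k \<le> l \<Longrightarrow> Poly_Mapping.lookup (e i) (v k) = (if k = i then 1 else 0)"
  "i \<le> l \<Longrightarrow> j \<le> l' \<Longrightarrow> Poly_Mapping.lookup (e i) (v' j) = 0"
  "j \<le> l' \<Longrightarrow> m \<le> l' \<Longrightarrow> Poly_Mapping.lookup (e' j) (v' m) = (if m = j then 1 else 0)"
  "j \<le> l' \<Longrightarrow> k \<le> l \<Longrightarrow> Poly_Mapping.lookup (e' j) (v k) = 0"
  by (auto simp: e_def e'_def)

lemma pos_p_in_F [simp]: "pos_p \<in> carrier F" and neg_p_in_F [simp]: "neg_p \<in> carrier F"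
  unfolding pos_p_def neg_p_def by (auto intro: F_sum)

lemma lookup_pos_p [simp]:
  "k \<le> l \<Longrightarrow> Poly_Mapping.lookup pos_p (v k) = 1"
  "j \<le> l' \<Longrightarrow> Poly_Mapping.lookup pos_p (v' j) = 0"
  "j \<le> l' \<Longrightarrow> Poly_Mapping.lookup neg_p (v' j) = 1"
  "k \<le> l \<Longrightarrow> Poly_Mapping.lookup neg_p (v k) = 0"
  by (auto simp: pos_p_def neg_p_def lookup_sum)

lemma F_eqI:
  assumes "a \<in> carrier F" "b \<in> carrier F"
    and "\<And>i. i \<le> l \<Longrightarrow> Poly_Mapping.lookup a (v i) = Poly_Mapping.lookup b (v i)"
    and "\<And>j. j \<le> l' \<Longrightarrow> Poly_Mapping.lookup a (v' j) = Poly_Mapping.lookup b (v' j)"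
  shows "a = b"
proof (rule poly_mapping_eqI)
  fix w
  show "Poly_Mapping.lookup a w = Poly_Mapping.lookup b w"
  proof (cases "w \<in> vertices")
    case True
    then show ?thesis using assms(3,4) by (auto simp flip: labelling(4))
  next
    case False
    then have "w \<notin> Poly_Mapping.keys a" "w \<notin> Poly_Mapping.keys b"
      using assms(1,2) by (auto simp: F_def)
    then show ?thesis by (simp add: in_keys_iff)
  qed
qed

lemma bold_p_eq: "bold_p = pos_p + neg_p"
proof (rule F_eqI)
  have l: "Poly_Mapping.lookup bold_p w = 1" if "w \<in> vertices" for w
    using that finite_vertices by (simp add: bold_p_def lookup_sum)
  show "i \<le> l \<Longrightarrow> Poly_Mapping.lookup bold_p (v i) = Poly_Mapping.lookup (pos_p + neg_p) (v i)" for i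
    by (simp add: l lookup_add)
  show "j \<le> l' \<Longrightarrow> Poly_Mapping.lookup bold_p (v' j) = Poly_Mapping.lookup (pos_p + neg_p) (v' j)" for j
    by (simp add: l lookup_add)
qed auto

lemma tau_label: "kind_ok k \<Longrightarrow> tau (label k) = step k"
proof -
  have one: "tau (e i) = (root_vec l i, 0)" if "i \<le> l" for i
  proof -
    have "(\<Sum>k\<le>l. frag_cmul (Poly_Mapping.lookup (e i) (v k)) (root_vec l k)) =
        (\<Sum>k\<le>l. if k = i then root_vec l k else 0)"
      using that by (intro sum.cong) auto
    then show ?thesis using that by (simp add: tau_def)
  qed
  have two: "tau (e' j) = (0, root_vec l' j)" if "j \<le> l'" for j
  proof -
    have "(\<Sum>k\<le>l'. frag_cmul (Poly_Mapping.lookup (e' j) (v' k)) (root_vec l' k)) =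
        (\<Sum>k\<le>l'. if k = j then root_vec l' k else 0)"
      using that by (intro sum.cong) auto
    then show ?thesis using that by (simp add: tau_def)
  qed
  show "kind_ok k \<Longrightarrow> tau (label k) = step k"
    by (cases k) (simp_all add: tau_add one two)
qed

lemma label_in_F [simp]: "kind_ok k \<Longrightarrow> label k \<in> carrier F"
  by (cases k) auto

lemma sigma_in_F [simp]: "sigma x \<in> carrier F"
  unfolding sigma_def by (intro F_add F_sum F_cmul) auto

lemma tau_sigma: "x \<in> carrier LL \<Longrightarrow> tau (sigma x) = x"
proof -
  assume x: "x \<in> carrier LL"
  have 1: "Poly_Mapping.lookup (sigma x) (v i) = (\<Sum>k=i..l. Poly_Mapping.lookup (fst x) k)"
    if "i \<le> l" for i
  proof -
    let ?c = "\<lambda>i. \<Sum>k=i..l. Poly_Mapping.lookup (fst x) k"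
    have "Poly_Mapping.lookup (sigma x) (v i) = (\<Sum>k\<le>l. if k = i then ?c k else 0) + (\<Sum>k\<le>l'. 0)"
      using that unfolding sigma_def lookup_add lookup_sum lookup_frag_cmul
      by (intro arg_cong2[of _ _ _ _ "(+)"] sum.cong) auto
    then show ?thesis using that by simp
  qed
  have 2: "Poly_Mapping.lookup (sigma x) (v' j) = (\<Sum>k=j..l'. Poly_Mapping.lookup (snd x) k)"
    if "j \<le> l'" for j
  proof -
    let ?c = "\<lambda>j. \<Sum>k=j..l'. Poly_Mapping.lookup (snd x) k"
    have "Poly_Mapping.lookup (sigma x) (v' j) = (\<Sum>k\<le>l. 0) + (\<Sum>k\<le>l'. if k = j then ?c k else 0)"
      using that unfolding sigma_def lookup_add lookup_sum lookup_frag_cmul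
      by (intro arg_cong2[of _ _ _ _ "(+)"] sum.cong) auto
    then show ?thesis using that by simp
  qed
  show ?thesis
    using x root_sum_tails[of "fst x" l] root_sum_tails[of "snd x" l']
    by (simp add: tau_def 1 2 carrier_LL mem_Times_iff)
qed

text \<open>The single relation in each of the two root lattices forces the coordinates to be
  constant on each of the two families of vertices.\<close>

lemma tau_eq_0_iff:
  assumes "a \<in> carrier F"
  shows "tau a = 0 \<longleftrightarrow> (\<exists>c d. a = frag_cmul c pos_p + frag_cmul d neg_p)"
proof
  assume "tau a = 0"
  then have "(\<Sum>i\<le>l. frag_cmul (Poly_Mapping.lookup a (v i)) (root_vec l i)) = 0"
    "(\<Sum>j\<le>l'. frag_cmul (Poly_Mapping.lookup a (v' j)) (root_vec l' j)) = 0"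
    by (simp_all add: tau_def zero_prod_def)
  note const = this[THEN root_sum_eq_0_iff[THEN iffD1], rule_format]
  let ?b = "frag_cmul (Poly_Mapping.lookup a (v 0)) pos_p +
      frag_cmul (Poly_Mapping.lookup a (v' 0)) neg_p"
  have "a = ?b"
  proof (rule F_eqI)
    fix i assume i: "i \<le> l"
    then have "Poly_Mapping.lookup ?b (v i) = Poly_Mapping.lookup a (v 0)"
      by (simp add: lookup_add)
    then show "Poly_Mapping.lookup a (v i) = Poly_Mapping.lookup ?b (v i)"
      using const(1)[OF i] by simp
  next
    fix j assume j: "j \<le> l'"
    then have "Poly_Mapping.lookup ?b (v' j) = Poly_Mapping.lookup a (v' 0)"
      by (simp add: lookup_add)
    then show "Poly_Mapping.lookup a (v' j) = Poly_Mapping.lookup ?b (v' j)"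
      using const(2)[OF j] by simp
  qed (use assms in auto)
  then show "\<exists>c d. a = frag_cmul c pos_p + frag_cmul d neg_p" by blast
next
  assume "\<exists>c d. a = frag_cmul c pos_p + frag_cmul d neg_p"
  then obtain c d where a: "a = frag_cmul c pos_p + frag_cmul d neg_p" by blast
  have "(\<Sum>i\<le>l. frag_cmul (Poly_Mapping.lookup a (v i)) (root_vec l i)) = 0"
    by (subst root_sum_eq_0_iff) (simp add: a lookup_add)
  moreover have "(\<Sum>j\<le>l'. frag_cmul (Poly_Mapping.lookup a (v' j)) (root_vec l' j)) = 0"
    by (subst root_sum_eq_0_iff) (simp add: a lookup_add)
  ultimately show "tau a = 0" by (simp add: tau_def zero_prod_def)
qed

text \<open>Since \<open>p\<close> dies in \<open>H\<close>, its two halves are inverse to each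
  other there.\<close>

lemma deg_H_neg_p: "deg_H (a + frag_cmul n neg_p) = deg_H (a + frag_cmul (- n) pos_p)"
proof -
  have eq: "a + frag_cmul n neg_p = (a + frag_cmul (- n) pos_p) + frag_cmul n bold_p"
    by (intro poly_mapping_eqI) (simp add: bold_p_eq lookup_add distrib_left)
  show ?thesis unfolding eq by (rule deg_H_bold_p)
qed

section \<open>The quotient of \<open>H\<close> by multiples of \<open>s\<close> and the map
  \<open>Psi\<close>\<close>

lemma s_eq: "s = deg_H pos_p"
  unfolding s_def xbar_def pos_p_def by (rule deg_H_finprod) auto

lemma Zs_eq: "Zs = range (\<lambda>n. deg_H (frag_cmul n pos_p))"
proof -
  have "s \<in> carrier H" by (simp add: s_eq carrier_H)
  then show ?thesis
    unfolding Zs_def using group.generate_pow[OF comm_group.axioms(2)[OF comm_group_H], of s]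
    by (auto simp: s_eq deg_H_int_pow)
qed

definition deg_Hs :: "((int ^ 'n) \<Rightarrow>\<^sub>0 int) \<Rightarrow> ((int ^ 'n) \<Rightarrow>\<^sub>0 int) set set" where
  "deg_Hs a = Zs #>\<^bsub>H\<^esub> deg_H a"

lemma mem_deg_Hs_iff:
  assumes "a \<in> carrier F"
  shows "h \<in> deg_Hs a \<longleftrightarrow> (\<exists>n. h = deg_H (a + frag_cmul n pos_p))"
  using assms by (auto simp: deg_Hs_def r_coset_def Zs_eq deg_H_mult add.commute)

lemma deg_Hs_eq_iff:
  assumes "a \<in> carrier F" "b \<in> carrier F"
  shows "deg_Hs a = deg_Hs b \<longleftrightarrow> (\<exists>n. deg_H a = deg_H (b + frag_cmul n pos_p))"
proof
  assume "deg_Hs a = deg_Hs b"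
  moreover have "deg_H a \<in> deg_Hs a"
    using mem_deg_Hs_iff[OF assms(1)] by (auto intro!: exI[of _ 0])
  ultimately show "\<exists>n. deg_H a = deg_H (b + frag_cmul n pos_p)"
    using mem_deg_Hs_iff[OF assms(2)] by simp
next
  assume "\<exists>n. deg_H a = deg_H (b + frag_cmul n pos_p)"
  then obtain n where n: "deg_H a = deg_H (b + frag_cmul n pos_p)" by blast
  have shift: "deg_H (a + frag_cmul k pos_p) = deg_H (b + frag_cmul (n + k) pos_p)" for k
    using deg_H_add_cong[OF n, of "frag_cmul k pos_p"] by (simp add: frag_cmul_distrib add.assoc)
  have "h \<in> deg_Hs a \<longleftrightarrow> h \<in> deg_Hs b" for h
    unfolding mem_deg_Hs_iff[OF assms(1)] mem_deg_Hs_iff[OF assms(2)] shift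
    by (metis add.commute diff_add_cancel)
  then show "deg_Hs a = deg_Hs b" by blast
qed

lemma Zs_normal: "Zs \<lhd> H"
proof -
  have "s \<in> carrier H" by (simp add: s_eq carrier_H)
  then show ?thesis
    unfolding Zs_def
    by (intro comm_group.subgroup_imp_normal[OF comm_group_H]
        group.generate_is_subgroup[OF comm_group.axioms(2)[OF comm_group_H]]) simp
qed

lemma deg_Hs_mult:
  "a \<in> carrier F \<Longrightarrow> b \<in> carrier F \<Longrightarrow> deg_Hs a \<otimes>\<^bsub>H_mod_s\<^esub> deg_Hs b = deg_Hs (a + b)"
  unfolding deg_Hs_def H_mod_s_def
  using normal.rcos_sum[OF Zs_normal, of "deg_H a" "deg_H b"]
  by (simp add: carrier_H deg_H_mult)

lemma one_H_mod_s: "\<one>\<^bsub>H_mod_s\<^esub> = deg_Hs 0"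
  unfolding H_mod_s_def one_FactGroup by (auto simp: Zs_eq mem_deg_Hs_iff)

lemma carrier_H_mod_s: "carrier H_mod_s = deg_Hs ` carrier F"
  by (simp add: H_mod_s_def carrier_FactGroup carrier_H image_image deg_Hs_def)

text \<open>The kernel of \<open>tau\<close> is spanned by elements of degree \<open>s\<close> and
  \<open>-s\<close>, so the projection of \<open>F\<close> to the quotient by \<open>Zs\<close>
  factors through \<open>tau\<close>. The factor is \<open>Psi\<close>.\<close>

lemma deg_Hs_tau_cong:
  assumes "a \<in> carrier F" "b \<in> carrier F" "tau a = tau b"
  shows "deg_Hs a = deg_Hs b"
proof -
  have "tau (a - b) = 0" using assms(3) by (simp add: tau_diff)
  then obtain c d where "a - b = frag_cmul c pos_p + frag_cmul d neg_p"
    using assms by (subst (asm) tau_eq_0_iff) auto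
  then have "a = (b + frag_cmul c pos_p) + frag_cmul d neg_p"
    by (simp add: diff_eq_eq add_ac)
  then have "deg_H a = deg_H (b + frag_cmul (c - d) pos_p)"
    by (simp add: deg_H_neg_p frag_cmul_diff_distrib add_diff_eq flip: minus_frag_cmul)
  then show ?thesis using deg_Hs_eq_iff assms by blast
qed

text \<open>\<open>Psi\<close> is a choice, so its specification must first be shown satisfiable:
  \<open>sigma\<close> is an additive section of \<open>tau\<close>, hence \<open>deg_Hs\<close>
  after \<open>sigma\<close> is a witness. The values on the roots then propagate to all of
  \<open>F\<close> because the vertices generate it.\<close>

lemma Psi_tau:
  assumes "a \<in> carrier F"
  shows "Psi (tau a) = deg_Hs a"
proof -
  let ?spec = "\<lambda>f. f \<in> hom LL H_mod_s \<and>
     (\<forall>i\<le>l. f (step (Plain i)) = Zs #>\<^bsub>H\<^esub> xbar i) \<and>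
     (\<forall>j\<le>l'. f (step (Primed j)) = Zs #>\<^bsub>H\<^esub> xbar' j)"
  have grp: "group H_mod_s"
    unfolding H_mod_s_def by (rule normal.factorgroup_is_group[OF Zs_normal])
  have "?spec (\<lambda>x. deg_Hs (sigma x))"
  proof (intro conjI allI impI)
    show "(\<lambda>x. deg_Hs (sigma x)) \<in> hom LL H_mod_s"
      by (rule homI) (auto simp: carrier_H_mod_s mult_LL sigma_add deg_Hs_mult)
    show "deg_Hs (sigma (step (Plain i))) = Zs #>\<^bsub>H\<^esub> xbar i" if "i \<le> l" for i
    proof -
      have st: "step (Plain i) = tau (e i)" using that tau_label[of "Plain i"] by simp
      have "deg_Hs (sigma (tau (e i))) = deg_Hs (e i)"
        by (rule deg_Hs_tau_cong) (use that in \<open>simp_all add: tau_sigma\<close>)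
      then show ?thesis by (simp only: st deg_Hs_def xbar_def)
    qed
    show "deg_Hs (sigma (step (Primed j))) = Zs #>\<^bsub>H\<^esub> xbar' j" if "j \<le> l'" for j
    proof -
      have st: "step (Primed j) = tau (e' j)" using that tau_label[of "Primed j"] by simp
      have "deg_Hs (sigma (tau (e' j))) = deg_Hs (e' j)"
        by (rule deg_Hs_tau_cong) (use that in \<open>simp_all add: tau_sigma\<close>)
      then show ?thesis by (simp only: st deg_Hs_def xbar'_def)
    qed
  qed
  then have Psi: "?spec Psi" unfolding Psi_def by (rule someI[of ?spec])
  have Psi_add: "Psi (tau b + tau c) = Psi (tau b) \<otimes>\<^bsub>H_mod_s\<^esub> Psi (tau c)" for b c
    using Psi hom_mult[of Psi LL H_mod_s "tau b" "tau c"] by (simp add: mult_LL)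
  have Psi_closed: "Psi (tau b) \<in> carrier H_mod_s" for b
    using Psi hom_in_carrier[of Psi LL H_mod_s] by simp
  show ?thesis
  proof (rule free_Abelian_group_induct[of a vertices "\<lambda>a. Psi (tau a) = deg_Hs a"])
    show "Poly_Mapping.keys a \<subseteq> vertices" using assms by (simp add: F_def)
  next
    have "Psi 0 \<otimes>\<^bsub>H_mod_s\<^esub> Psi 0 = Psi 0"
      using Psi_add[of 0 0] by (simp add: tau_zero)
    then have "Psi 0 = \<one>\<^bsub>H_mod_s\<^esub>"
      using Psi_closed[of 0] group.l_cancel_one[OF grp] by (simp add: tau_zero)
    then show "Psi (tau 0) = deg_Hs 0" by (simp add: tau_zero one_H_mod_s)
  next
    fix x y
    assume keys: "Poly_Mapping.keys x \<subseteq> vertices" "Poly_Mapping.keys y \<subseteq> vertices"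
      and IH: "Psi (tau x) = deg_Hs x" "Psi (tau y) = deg_Hs y"
    then have xy: "x \<in> carrier F" "y \<in> carrier F" by (simp_all add: F_def)
    have "Psi (tau (x - y)) \<otimes>\<^bsub>H_mod_s\<^esub> deg_Hs y = deg_Hs (x - y) \<otimes>\<^bsub>H_mod_s\<^esub> deg_Hs y"
      using Psi_add[of "x - y" y] IH xy by (simp add: deg_Hs_mult flip: tau_add)
    then show "Psi (tau (x - y)) = deg_Hs (x - y)"
      using group.right_cancel[OF grp, of "deg_Hs y" "Psi (tau (x - y))" "deg_Hs (x - y)"]
        Psi_closed[of "x - y"] xy by (simp add: carrier_H_mod_s)
  next
    fix w assume "w \<in> vertices"
    then consider i where "i \<le> l" "w = v i" | j where "j \<le> l'" "w = v' j"
      by (auto simp flip: labelling(4))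
    then show "Psi (tau (frag_of w)) = deg_Hs (frag_of w)"
    proof cases
      case 1
      then show ?thesis
        using Psi tau_label[of "Plain i"] by (auto simp: deg_Hs_def xbar_def e_def)
    next
      case 2
      then show ?thesis
        using Psi tau_label[of "Primed j"] by (auto simp: deg_Hs_def xbar'_def e'_def)
    qed
  qed
qed

lemma tau_in_B_iff:
  assumes "a \<in> carrier F"
  shows "tau a \<in> B \<longleftrightarrow> (\<exists>n. deg_H a = deg_H (frag_cmul n pos_p))"
  using assms deg_Hs_eq_iff[of a 0] by (simp add: B_def kernel_def Psi_tau one_H_mod_s)

lemma B_subset_LL: "b \<in> B \<Longrightarrow> b \<in> carrier LL"
  by (simp add: B_def kernel_def)

end

section \<open>The vertices of the quiver\<close>

lemma lookup_bounded:
  obtains M :: int where "M \<ge> 0" "\<And>w. \<bar>Poly_Mapping.lookup a w\<bar> \<le> M"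
proof
  let ?M = "\<Sum>w\<in>Poly_Mapping.keys a. \<bar>Poly_Mapping.lookup a w\<bar>"
  show M: "?M \<ge> 0" by (simp add: sum_nonneg)
  show "\<bar>Poly_Mapping.lookup a w\<bar> \<le> ?M" for w
  proof (cases "w \<in> Poly_Mapping.keys a")
    case True
    then show ?thesis
      by (intro member_le_sum[of w _ "\<lambda>w. \<bar>Poly_Mapping.lookup a w\<bar>"]) auto
  next
    case False
    then show ?thesis using M by (simp add: in_keys_iff)
  qed
qed

text \<open>Serves two kinds of lines: translates by multiples of \<open>s\<close> against
  \<open>I\<close> in \<open>H\<close>, and translates by multiples of \<open>p\<close> against an
  upper set in \<open>G u\<close>.\<close>

lemma int_threshold:
  fixes P :: "int \<Rightarrow> bool"
  assumes mono: "\<And>n m. P n \<Longrightarrow> n \<le> m \<Longrightarrow> P m" and "P N" "\<not> P N'"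
  shows "\<exists>n. P n \<and> \<not> P (n - 1)"
proof (rule ccontr)
  assume neg: "\<nexists>n. P n \<and> \<not> P (n - 1)"
  have "\<not> P k" if "k \<ge> N'" for k
    using that
  proof (induction k rule: int_ge_induct)
    case (step k)
    have "P (k + 1) \<longrightarrow> P k" using neg by (metis add_diff_cancel_right')
    with step show ?case by blast
  qed (use assms in blast)
  then show False using assms by (metis linorder_le_cases)
qed

lemma int_threshold_unique:
  fixes P :: "int \<Rightarrow> bool"
  assumes mono: "\<And>n m. P n \<Longrightarrow> n \<le> m \<Longrightarrow> P m"
    and "P n" "\<not> P (n - 1)" "P m" "\<not> P (m - 1)"
  shows "n = m"
proof (rule ccontr)
  assume "n \<noteq> m"
  then have "n \<le> m - 1 \<or> m \<le> n - 1" by linarith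
  then show False using assms by blast
qed

section \<open>The order on \<open>H\<close> and the set \<open>J\<close> of thresholds\<close>

context simplicial_setting
begin

lemma F_decomp:
  assumes "c \<in> carrier F"
  shows "c = (\<Sum>i\<le>l. frag_cmul (Poly_Mapping.lookup c (v i)) (e i)) +
             (\<Sum>j\<le>l'. frag_cmul (Poly_Mapping.lookup c (v' j)) (e' j))" (is "c = ?r")
proof (rule F_eqI)
  fix i assume i: "i \<le> l"
  have "Poly_Mapping.lookup ?r (v i) =
      (\<Sum>k\<le>l. if k = i then Poly_Mapping.lookup c (v k) else 0) + (\<Sum>k\<le>l'. 0)"
    using i unfolding lookup_add lookup_sum lookup_frag_cmul
    by (intro arg_cong2[of _ _ _ _ "(+)"] sum.cong) auto
  then show "Poly_Mapping.lookup c (v i) = Poly_Mapping.lookup ?r (v i)"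
    using i by simp
next
  fix j assume j: "j \<le> l'"
  have "Poly_Mapping.lookup ?r (v' j) =
      (\<Sum>k\<le>l. 0) + (\<Sum>k\<le>l'. if k = j then Poly_Mapping.lookup c (v' k) else 0)"
    using j unfolding lookup_add lookup_sum lookup_frag_cmul
    by (intro arg_cong2[of _ _ _ _ "(+)"] sum.cong) auto
  then show "Poly_Mapping.lookup c (v' j) = Poly_Mapping.lookup ?r (v' j)"
    using j by simp
next
  show "?r \<in> carrier F" by (intro F_add F_sum F_cmul) auto
qed fact

text \<open>The cone in \<open>F\<close> whose images are the nonnegative elements of
  \<open>H\<close>. In contrast to \<open>F_nonneg\<close> the sign is reversed on the primed
  vertices.\<close>

definition H_nonneg :: "((int ^ 'n) \<Rightarrow>\<^sub>0 int) \<Rightarrow> bool" where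
  "H_nonneg c \<longleftrightarrow> c \<in> carrier F \<and> (\<forall>i\<le>l. Poly_Mapping.lookup c (v i) \<ge> 0) \<and>
     (\<forall>j\<le>l'. Poly_Mapping.lookup c (v' j) \<le> 0)"

lemma ge_H_add:
  assumes a: "a \<in> carrier F" and c: "H_nonneg c"
  shows "ge_H (deg_H (a + c)) (deg_H a)"
proof -
  have cF: "c \<in> carrier F" using c by (simp add: H_nonneg_def)
  define A where "A i = nat (Poly_Mapping.lookup c (v i))" for i
  define B where "B j = nat (- Poly_Mapping.lookup c (v' j))" for j
  have int_A: "int (A i) = Poly_Mapping.lookup c (v i)" if "i \<le> l" for i
    using c that by (simp add: A_def H_nonneg_def)
  have int_B: "int (B j) = - Poly_Mapping.lookup c (v' j)" if "j \<le> l'" for j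
    using c that by (simp add: B_def H_nonneg_def)
  have fin: "finprod H f {..n} = deg_H (\<Sum>i\<le>n. g i)"
    if "\<And>i. i \<le> n \<Longrightarrow> g i \<in> carrier F" "\<And>i. i \<le> n \<Longrightarrow> f i = deg_H (g i)" for f g and n :: nat
  proof -
    have "finprod H f {..n} = finprod H (\<lambda>i. deg_H (g i)) {..n}"
      using that
      by (intro comm_monoid.finprod_cong'[OF comm_group.axioms(1)[OF comm_group_H]])
         (auto simp: carrier_H)
    also have "\<dots> = deg_H (\<Sum>i\<le>n. g i)"
      using that(1) by (intro deg_H_finprod) auto
    finally show ?thesis .
  qed
  have prod_A: "finprod H (\<lambda>i. xbar i [^]\<^bsub>H\<^esub> A i) {..l} =
      deg_H (\<Sum>i\<le>l. frag_cmul (Poly_Mapping.lookup c (v i)) (e i))"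
    by (intro fin) (auto simp: xbar_def deg_H_nat_pow int_A)
  have prod_B: "finprod H (\<lambda>j. (inv\<^bsub>H\<^esub> xbar' j) [^]\<^bsub>H\<^esub> B j) {..l'} =
      deg_H (\<Sum>j\<le>l'. frag_cmul (Poly_Mapping.lookup c (v' j)) (e' j))"
  proof (intro fin)
    fix j assume j: "j \<le> l'"
    have "frag_cmul (int (B j)) (- e' j) = frag_cmul (Poly_Mapping.lookup c (v' j)) (e' j)"
      using j by (intro poly_mapping_eqI) (simp add: int_B)
    then show "(inv\<^bsub>H\<^esub> xbar' j) [^]\<^bsub>H\<^esub> B j =
        deg_H (frag_cmul (Poly_Mapping.lookup c (v' j)) (e' j))"
      using j by (simp add: xbar'_def deg_H_inv deg_H_nat_pow)
  qed auto
  have "deg_H (a + c) \<otimes>\<^bsub>H\<^esub> inv\<^bsub>H\<^esub> deg_H a = deg_H c"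
    using a cF by (simp add: deg_H_inv deg_H_mult)
  also have "\<dots> = finprod H (\<lambda>i. xbar i [^]\<^bsub>H\<^esub> A i) {..l} \<otimes>\<^bsub>H\<^esub>
       finprod H (\<lambda>j. (inv\<^bsub>H\<^esub> xbar' j) [^]\<^bsub>H\<^esub> B j) {..l'}"
    unfolding prod_A prod_B
    by (subst deg_H_mult) (auto intro!: F_sum simp flip: F_decomp[OF cF])
  finally show ?thesis unfolding ge_H_def by blast
qed

lemma I_add:
  assumes "a \<in> carrier F" "deg_H a \<in> I" "H_nonneg c"
  shows "deg_H (a + c) \<in> I"
proof -
  have "deg_H (a + c) \<in> carrier H"
    using assms by (simp add: carrier_H H_nonneg_def)
  then show ?thesis
    using upper_I ge_H_add[OF assms(1,3)] assms(2) unfolding nontrivial_upper_set_def by blast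
qed

lemma I_add_pos_p:
  "a \<in> carrier F \<Longrightarrow> deg_H a \<in> I \<Longrightarrow> n \<ge> 0 \<Longrightarrow> deg_H (a + frag_cmul n pos_p) \<in> I"
  by (rule I_add) (auto simp: H_nonneg_def)

lemma J_iff:
  assumes "a \<in> carrier F"
  shows "deg_H a \<in> J \<longleftrightarrow> deg_H a \<in> I \<and> deg_H (a - pos_p) \<notin> I"
proof -
  have "deg_H a \<in> (carrier H - I) #>\<^bsub>H\<^esub> s \<longleftrightarrow> deg_H (a - pos_p) \<notin> I"
  proof
    assume "deg_H a \<in> (carrier H - I) #>\<^bsub>H\<^esub> s"
    then obtain b where b: "b \<in> carrier F" "deg_H b \<notin> I" "deg_H a = deg_H (b + pos_p)"
      by (auto simp: r_coset_def s_eq carrier_H deg_H_mult)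
    then have "deg_H (a - pos_p) = deg_H b"
      using deg_H_add_cong[OF b(3), of "- pos_p"] by simp
    then show "deg_H (a - pos_p) \<notin> I" using b by simp
  next
    assume "deg_H (a - pos_p) \<notin> I"
    moreover have "deg_H a = deg_H (a - pos_p) \<otimes>\<^bsub>H\<^esub> s"
      using assms by (simp add: s_eq deg_H_mult)
    ultimately show "deg_H a \<in> (carrier H - I) #>\<^bsub>H\<^esub> s"
      using assms by (auto simp: r_coset_def carrier_H)
  qed
  then show ?thesis by (simp add: J_def)
qed

text \<open>If \<open>M\<close> bounds the coordinates of \<open>a - b\<close>, then adding
  \<open>M pos_p\<close> and subtracting \<open>M neg_p\<close> moves this difference into the cone.
  In \<open>H\<close> both corrections equal \<open>M\<close> times \<open>s\<close>, whence the
  shift \<open>2 * M\<close>.\<close>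

lemma H_directed:
  assumes "a \<in> carrier F" "b \<in> carrier F"
  shows "\<exists>n c. H_nonneg c \<and> deg_H (a + frag_cmul n pos_p) = deg_H (b + c)"
proof -
  obtain M where M: "M \<ge> 0" "\<And>w. \<bar>Poly_Mapping.lookup (a - b) w\<bar> \<le> M"
    using lookup_bounded by blast
  define c where "c = (a - b) + frag_cmul M pos_p + frag_cmul (- M) neg_p"
  have "H_nonneg c"
    unfolding H_nonneg_def
  proof (intro conjI allI impI)
    show "c \<in> carrier F" using assms by (simp add: c_def del: minus_frag_cmul)
    show "Poly_Mapping.lookup c (v i) \<ge> 0" if "i \<le> l" for i
      using that M(2)[of "v i"] by (simp add: c_def lookup_add)
    show "Poly_Mapping.lookup c (v' j) \<le> 0" if "j \<le> l'" for j
      using that M(2)[of "v' j"] by (simp add: c_def lookup_add)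
  qed
  moreover have "deg_H (a + frag_cmul (2 * M) pos_p) = deg_H (b + c)"
  proof -
    have "b + c = (a + frag_cmul M pos_p) + frag_cmul (- M) neg_p"
      by (simp add: c_def)
    also have "deg_H \<dots> = deg_H ((a + frag_cmul M pos_p) + frag_cmul (- (- M)) pos_p)"
      by (rule deg_H_neg_p)
    also have "(a + frag_cmul M pos_p) + frag_cmul (- (- M)) pos_p = a + frag_cmul (2 * M) pos_p"
      by (simp only: minus_minus add.assoc mult_2 flip: frag_cmul_distrib)
    finally show ?thesis ..
  qed
  ultimately show ?thesis by blast
qed

lemma I_mono_pos_p:
  assumes "a \<in> carrier F" "deg_H (a + frag_cmul n pos_p) \<in> I" "n \<le> m"
  shows "deg_H (a + frag_cmul m pos_p) \<in> I"
proof -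
  have eq: "a + frag_cmul m pos_p = (a + frag_cmul n pos_p) + frag_cmul (m - n) pos_p"
    by (simp add: frag_cmul_diff_distrib)
  show ?thesis
    unfolding eq by (rule I_add_pos_p) (use assms in auto)
qed

lemma J_shift_iff:
  assumes "a \<in> carrier F"
  shows "deg_H (a + frag_cmul n pos_p) \<in> J \<longleftrightarrow>
    deg_H (a + frag_cmul n pos_p) \<in> I \<and> deg_H (a + frag_cmul (n - 1) pos_p) \<notin> I"
  using J_iff[of "a + frag_cmul n pos_p"] assms by (simp add: frag_cmul_diff_distrib add_diff_eq)

text \<open>By directedness the line through \<open>a\<close> rises above a member of
  \<open>I\<close> and falls below a non-member, so it meets both \<open>I\<close> and its
  complement and has a threshold.\<close>

lemma J_shift_exists:
  assumes a: "a \<in> carrier F"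
  shows "\<exists>n. deg_H (a + frag_cmul n pos_p) \<in> J"
proof -
  have "I \<subseteq> deg_H ` carrier F" "I \<noteq> {}" "I \<noteq> deg_H ` carrier F"
    using upper_I by (auto simp: nontrivial_upper_set_def simp flip: carrier_H)
  then obtain b c where b: "b \<in> carrier F" "deg_H b \<in> I" and c: "c \<in> carrier F" "deg_H c \<notin> I"
    by blast
  obtain n where n: "deg_H (a + frag_cmul n pos_p) \<in> I"
    using H_directed[OF a b(1)] I_add[OF b] by metis
  obtain m d where d: "H_nonneg d" "deg_H (c + frag_cmul m pos_p) = deg_H (a + d)"
    using H_directed[OF c(1) a] by blast
  have "deg_H c = deg_H (a + frag_cmul (- m) pos_p + d)"
    using deg_H_add_cong[OF d(2), of "frag_cmul (- m) pos_p"]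
    by (simp add: add_ac flip: frag_cmul_distrib)
  then have "deg_H (a + frag_cmul (- m) pos_p) \<notin> I"
    using I_add[OF _ _ d(1), of "a + frag_cmul (- m) pos_p"] a c(2) by auto
  with n show ?thesis
    unfolding J_shift_iff[OF a]
    by (rule int_threshold[of "\<lambda>n. deg_H (a + frag_cmul n pos_p) \<in> I", rotated])
       (rule I_mono_pos_p[OF a])
qed

lemma J_shift_unique:
  assumes "a \<in> carrier F" "deg_H a \<in> J" "deg_H (a + frag_cmul n pos_p) \<in> J"
  shows "n = 0"
proof -
  have "deg_H (a + frag_cmul 0 pos_p) \<in> J" using assms(2) by simp
  with assms(3) show ?thesis
    unfolding J_shift_iff[OF assms(1)]
    using int_threshold_unique[of "\<lambda>n. deg_H (a + frag_cmul n pos_p) \<in> I" n 0]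
      I_mono_pos_p[OF assms(1)] by blast
qed

text \<open>The working set for all that follows. It is stable under multiples of \<open>p\<close>,
  and membership depends only on the degree in \<open>H\<close>.\<close>

definition FJ :: "((int ^ 'n) \<Rightarrow>\<^sub>0 int) set" where
  "FJ = {a \<in> carrier F. deg_H a \<in> J}"

lemma FJ_I: "a \<in> carrier F \<Longrightarrow> deg_H a \<in> J \<Longrightarrow> a \<in> FJ"
  by (simp add: FJ_def)

lemma FJ_D: "a \<in> FJ \<Longrightarrow> a \<in> carrier F" "a \<in> FJ \<Longrightarrow> deg_H a \<in> J"
  by (simp_all add: FJ_def)

lemmas FJ_in_F [simp] = FJ_D(1)

lemma FJ_iff: "a \<in> carrier F \<Longrightarrow> a \<in> FJ \<longleftrightarrow> deg_H a \<in> I \<and> deg_H (a - pos_p) \<notin> I"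
  using J_iff[of a] FJ_D(2) FJ_I by blast

lemma FJ_cong: "a \<in> FJ \<Longrightarrow> b \<in> carrier F \<Longrightarrow> deg_H b = deg_H a \<Longrightarrow> b \<in> FJ"
  using FJ_D(2)[of a] by (intro FJ_I) simp_all

lemma FJ_nonempty: "FJ \<noteq> {}"
  using J_shift_exists[of 0] FJ_I F_cmul[OF pos_p_in_F] by fastforce

text \<open>Infinite order of \<open>s\<close> comes from \<open>I\<close>:
  \<open>J_shift_unique\<close> counts shifts and not elements, so two shifts giving the same
  element of \<open>J\<close> coincide.\<close>

lemma deg_H_pos_p_torsion_free:
  assumes "deg_H (a + frag_cmul n pos_p) = deg_H a"
  shows "n = 0"
proof -
  obtain b where b: "b \<in> FJ" using FJ_nonempty by blast
  have "deg_H (b + frag_cmul n pos_p) = deg_H b"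
    using assms by (simp add: deg_H_eq_iff)
  then show ?thesis using b J_shift_unique[of b n] FJ_D[OF b] by simp
qed

lemma rep_tau:
  assumes "a \<in> FJ"
  shows "rep (tau a) = deg_H a"
  unfolding rep_def
proof (rule the_equality)
  have a: "a \<in> carrier F" "deg_H a \<in> J" using FJ_D[OF assms] by auto
  show "deg_H a \<in> J \<and> deg_H a \<in> Psi (tau a)"
    using a by (auto simp: Psi_tau mem_deg_Hs_iff intro!: exI[of _ 0])
  fix h assume h: "h \<in> J \<and> h \<in> Psi (tau a)"
  then obtain n where n: "h = deg_H (a + frag_cmul n pos_p)"
    using a by (auto simp: Psi_tau mem_deg_Hs_iff)
  then have "n = 0" using J_shift_unique[OF a] h by simp
  then show "h = deg_H a" using n by simp
qed

lemma tau_pos_p: "tau (a + frag_cmul n pos_p) = tau a"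
proof -
  have "tau (frag_cmul n pos_p) = 0"
    by (subst tau_eq_0_iff) (simp, rule exI[of _ n], rule exI[of _ 0], simp)
  then show ?thesis by (simp add: tau_add)
qed

text \<open>Multiples of \<open>pos_p\<close> are invisible to \<open>tau\<close>, so the preimage
  \<open>sigma x\<close> of \<open>x\<close> can be pushed into \<open>FJ\<close>.\<close>

lemma LL_eq: "carrier LL = tau ` FJ"
proof
  show "tau ` FJ \<subseteq> carrier LL" by auto
  show "carrier LL \<subseteq> tau ` FJ"
  proof
    fix x assume x: "x \<in> carrier LL"
    obtain n where "deg_H (sigma x + frag_cmul n pos_p) \<in> J"
      using J_shift_exists[of "sigma x"] by auto
    then have "sigma x + frag_cmul n pos_p \<in> FJ" by (intro FJ_I) auto
    moreover have "x = tau (sigma x + frag_cmul n pos_p)"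
      using x by (simp add: tau_pos_p tau_sigma)
    ultimately show "x \<in> tau ` FJ" by blast
  qed
qed

lemma orbit_tau:
  assumes a: "a \<in> FJ"
  shows "orbit (tau a) = {tau c | c. c \<in> FJ \<and> deg_H c = deg_H a}"
proof (intro equalityI subsetI)
  fix y assume "y \<in> orbit (tau a)"
  then obtain b where b: "b \<in> B" "y = tau a + b" by (auto simp: orbit_def)
  obtain c where c: "c \<in> carrier F" "b = tau c"
    using B_subset_LL[OF b(1)] tau_sigma[of b] by (metis sigma_in_F)
  then obtain n where n: "deg_H c = deg_H (frag_cmul n pos_p)"
    using tau_in_B_iff b(1) by blast
  \<comment> \<open>A period has a preimage whose degree is only known to be a multiple of
    \<open>s\<close>. Subtracting that multiple of \<open>pos_p\<close> restores the degree of
    \<open>a\<close> and leaves \<open>tau\<close> unchanged.\<close>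
  let ?d = "(a + c) + frag_cmul (- n) pos_p"
  have "deg_H ?d = deg_H a"
    using n by (simp add: deg_H_eq_iff flip: minus_frag_cmul)
  moreover have "?d \<in> carrier F" using a c by (intro F_add F_cmul) auto
  moreover have "y = tau ?d" unfolding tau_pos_p b c(2) by (simp add: tau_add)
  ultimately show "y \<in> {tau c | c. c \<in> FJ \<and> deg_H c = deg_H a}"
    using FJ_cong[OF a, of ?d] by blast
next
  fix y assume "y \<in> {tau c | c. c \<in> FJ \<and> deg_H c = deg_H a}"
  then obtain c where c: "c \<in> FJ" "deg_H c = deg_H a" "y = tau c" by blast
  have "deg_H (c - a) = deg_H (frag_cmul 0 pos_p)"
    using c(2) by (simp add: deg_H_eq_iff)
  moreover have "c - a \<in> carrier F" using a c(1) by simp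
  ultimately have "tau (c - a) \<in> B" using tau_in_B_iff by blast
  moreover have "y = tau a + tau (c - a)" by (simp add: c(3) flip: tau_add)
  ultimately show "y \<in> orbit (tau a)" unfolding orbit_def by blast
qed

lemma tau_in_orbit: "a \<in> FJ \<Longrightarrow> tau a \<in> orbit (tau a)"
  by (auto simp: orbit_tau)

lemma orbit_tau_eq_iff:
  assumes "a \<in> FJ" "b \<in> FJ"
  shows "orbit (tau a) = orbit (tau b) \<longleftrightarrow> deg_H a = deg_H b"
proof
  assume "orbit (tau a) = orbit (tau b)"
  moreover have "tau a \<in> orbit (tau a)" using assms(1) by (rule tau_in_orbit)
  ultimately obtain c where "c \<in> FJ" "deg_H c = deg_H b" "tau a = tau c"
    using assms by (auto simp: orbit_tau)
  then show "deg_H a = deg_H b" using rep_tau assms by metis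
next
  assume "deg_H a = deg_H b"
  then show "orbit (tau a) = orbit (tau b)" using assms by (simp add: orbit_tau)
qed

lemma vertex_J_orbit:
  assumes "a \<in> FJ"
  shows "vertex_J (orbit (tau a)) = deg_H a"
proof -
  have "rep x = deg_H a" if "x \<in> orbit (tau a)" for x
    using that rep_tau unfolding orbit_tau[OF assms] by auto
  with tau_in_orbit[OF assms] have "rep ` orbit (tau a) = {deg_H a}" by blast
  then show ?thesis by (simp add: vertex_J_def)
qed

end

section \<open>Arrows and walks\<close>

context simplicial_setting
begin

text \<open>The arrows leaving \<open>tau a\<close>, read off in \<open>F\<close>. For a composite
  arrow nothing is demanded of its head: that the head lies in \<open>FJ\<close> is
  \<open>arrow_at_head\<close>.\<close>

fun arrow_at :: "((int ^ 'n) \<Rightarrow>\<^sub>0 int) \<Rightarrow> arrow_kind \<Rightarrow> bool" where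
  "arrow_at a (Plain i) \<longleftrightarrow> i \<le> l \<and> a + e i \<in> FJ"
| "arrow_at a (Primed j) \<longleftrightarrow> j \<le> l' \<and> a + e' j \<in> FJ"
| "arrow_at a (Composite i j) \<longleftrightarrow> i \<le> l \<and> j \<le> l' \<and> a + e i \<notin> FJ \<and> a + e' j \<notin> FJ"

lemma arrow_at_kind_ok: "arrow_at a k \<Longrightarrow> kind_ok k"
  by (cases k) auto

lemma FJ_add_cong:
  assumes "a \<in> FJ" "b \<in> FJ" "deg_H a = deg_H b" "c \<in> carrier F"
  shows "a + c \<in> FJ \<longleftrightarrow> b + c \<in> FJ"
  using FJ_cong[of "a + c" "b + c"] FJ_cong[of "b + c" "a + c"] assms
    deg_H_add_cong[OF assms(3), of c] by auto

lemma arrow_at_cong: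
  assumes "a \<in> FJ" "b \<in> FJ" "deg_H a = deg_H b"
  shows "arrow_at a k \<longleftrightarrow> arrow_at b k"
  using FJ_add_cong[OF assms] by (cases k) auto

text \<open>Adding \<open>e i\<close> moves up in \<open>H\<close> and cannot leave
  \<open>I\<close>, so \<open>J\<close> is left through the top.\<close>

lemma step_out_pos:
  assumes a: "a \<in> FJ" and i: "i \<le> l" and out: "a + e i \<notin> FJ"
  shows "deg_H (a + e i - pos_p) \<in> I"
proof -
  have F: "a + e i \<in> carrier F" using a i by simp
  have "deg_H (a + e i) \<in> I"
    using a i FJ_iff[of a] by (intro I_add) (auto simp: H_nonneg_def)
  then show ?thesis using out FJ_iff[OF F] by blast
qed

text \<open>Adding \<open>e' j\<close> moves down in \<open>H\<close> and cannot enter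
  \<open>I - s\<close> from outside, so \<open>J\<close> is left through the bottom.\<close>

lemma step_out_neg:
  assumes a: "a \<in> FJ" and j: "j \<le> l'" and out: "a + e' j \<notin> FJ"
  shows "deg_H (a + e' j) \<notin> I"
proof
  assume I: "deg_H (a + e' j) \<in> I"
  have F: "a + e' j \<in> carrier F" using a j by simp
  have "deg_H (a + e' j - pos_p) \<notin> I"
  proof
    assume "deg_H (a + e' j - pos_p) \<in> I"
    then have "deg_H (a + e' j - pos_p + - e' j) \<in> I"
      using a j by (intro I_add) (auto simp: H_nonneg_def)
    moreover have "a + e' j - pos_p + - e' j = a - pos_p" by simp
    ultimately show False using FJ_iff[of a] a by (metis FJ_in_F)
  qed
  with I show False using out FJ_iff[OF F] by blast
qed

text \<open>Only composite arrows need an argument: one step overshoots \<open>J\<close> and the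
  other undershoots it, and since neither moves by more than \<open>s\<close>, the two
  compensate.\<close>

lemma arrow_at_head:
  assumes a: "a \<in> FJ" and k: "arrow_at a k"
  shows "a + label k \<in> FJ"
proof (cases k)
  case (Composite i j)
  with k have i: "i \<le> l" and j: "j \<le> l'" and out: "a + e i \<notin> FJ" "a + e' j \<notin> FJ" by auto
  have F: "a + (e i + e' j) \<in> carrier F" using a i j by simp
  have "deg_H (a + (e i + e' j)) \<in> I"
  proof -
    \<comment> \<open>The overshoot supplies a point of \<open>I\<close>, and
      \<open>e' j - neg_p\<close> lies in the cone. The sum differs from the head by
      \<open>p\<close>, which vanishes in \<open>H\<close>.\<close>
    have "deg_H ((a + e i - pos_p) + (e' j - neg_p)) \<in> I"
      using a i j step_out_pos[OF a i out(1)]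
      by (intro I_add) (auto simp: H_nonneg_def lookup_minus)
    moreover have "(a + e i - pos_p) + (e' j - neg_p) =
        (a + (e i + e' j)) + frag_cmul (- 1) bold_p"
      by (simp add: bold_p_eq)
    ultimately show ?thesis by (simp only: deg_H_bold_p)
  qed
  moreover have "deg_H (a + (e i + e' j) - pos_p) \<notin> I"
  proof
    assume "deg_H (a + (e i + e' j) - pos_p) \<in> I"
    then have "deg_H ((a + (e i + e' j) - pos_p) + (pos_p - e i)) \<in> I"
      using a i j by (intro I_add) (auto simp: H_nonneg_def lookup_minus)
    moreover have "(a + (e i + e' j) - pos_p) + (pos_p - e i) = a + e' j"
      by simp
    ultimately show False using step_out_neg[OF a j out(2)] by simp
  qed
  ultimately show ?thesis using FJ_iff[OF F] Composite by simp
qed (use k in auto)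

lemma C_hat_iff:
  assumes "a \<in> FJ"
  shows "(tau a, Plain i) \<in> C_hat \<longleftrightarrow> i \<le> l \<and> a + e i \<notin> FJ"
    and "(tau a, Primed j) \<in> C_hat \<longleftrightarrow> j \<le> l' \<and> a + e' j \<notin> FJ"
proof -
  have mem: "(x, Plain i) \<in> C_hat \<longleftrightarrow> x \<in> carrier LL \<and> i \<le> l \<and> rep x \<otimes>\<^bsub>H\<^esub> xbar i \<notin> J"
    "(x, Primed j) \<in> C_hat \<longleftrightarrow> x \<in> carrier LL \<and> j \<le> l' \<and> rep x \<otimes>\<^bsub>H\<^esub> xbar' j \<notin> J" for x
    unfolding C_hat_def by blast+
  have "deg_H (a + c) \<in> J \<longleftrightarrow> a + c \<in> FJ" if "c \<in> carrier F" for c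
    using FJ_I FJ_D(2) F_add[OF FJ_in_F[OF assms] that] by blast
  then show "(tau a, Plain i) \<in> C_hat \<longleftrightarrow> i \<le> l \<and> a + e i \<notin> FJ"
    "(tau a, Primed j) \<in> C_hat \<longleftrightarrow> j \<le> l' \<and> a + e' j \<notin> FJ"
    unfolding mem using assms by (auto simp: rep_tau xbar_def xbar'_def deg_H_mult)
qed

lemma arcs_Q_hat_C_iff:
  assumes "a \<in> FJ"
  shows "(tau a, k) \<in> arcs Q_hat_C \<longleftrightarrow> arrow_at a k"
proof -
  have mem: "(x, Plain i) \<in> arcs Q_hat_C \<longleftrightarrow> x \<in> carrier LL \<and> i \<le> l \<and> (x, Plain i) \<notin> C_hat"
    "(x, Primed j) \<in> arcs Q_hat_C \<longleftrightarrow> x \<in> carrier LL \<and> j \<le> l' \<and> (x, Primed j) \<notin> C_hat"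
    "(x, Composite i j) \<in> arcs Q_hat_C \<longleftrightarrow> (x, Plain i) \<in> C_hat \<and> (x, Primed j) \<in> C_hat"
    for x i j
    unfolding Q_hat_C_def Q_hat_def by (simp_all del: split_paired_Ex)
  show ?thesis
    using assms C_hat_iff[OF assms] by (cases k) (auto simp: mem)
qed

lemma arcs_Q_hat_C_E:
  assumes "(x, k) \<in> arcs Q_hat_C"
  obtains a where "a \<in> FJ" "x = tau a" "arrow_at a k"
proof -
  have "x \<in> carrier LL" using assms by (auto simp: Q_hat_C_def Q_hat_def C_hat_def)
  then obtain a where "a \<in> FJ" "x = tau a" unfolding LL_eq by blast
  then show thesis using that assms arcs_Q_hat_C_iff by blast
qed

lemma Q_C_simps:
  "verts Q_C = orbit ` carrier LL" "arcs Q_C = orbit_arrow ` arcs Q_hat_C" "tail Q_C = fst"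
  "head Q_C (X, k) = (\<lambda>x. x + step k) ` X"
  "verts Q_hat_C = carrier LL" "tail Q_hat_C = fst" "head Q_hat_C (x, k) = x + step k"
  by (simp_all add: Q_C_def Q_hat_C_def)

lemma arcs_Q_C_iff:
  assumes "a \<in> FJ"
  shows "(orbit (tau a), k) \<in> arcs Q_C \<longleftrightarrow> arrow_at a k"
proof
  assume "(orbit (tau a), k) \<in> arcs Q_C"
  then obtain x where x: "orbit (tau a) = orbit x" "(x, k) \<in> arcs Q_hat_C"
    unfolding Q_C_simps orbit_arrow_def by force
  from x(2) obtain b where b: "b \<in> FJ" "x = tau b" "arrow_at b k"
    by (rule arcs_Q_hat_C_E)
  then show "arrow_at a k"
    using x orbit_tau_eq_iff[OF assms b(1)]
      arrow_at_cong[OF assms b(1)] by simp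
next
  assume "arrow_at a k"
  then have "(tau a, k) \<in> arcs Q_hat_C" using assms by (simp add: arcs_Q_hat_C_iff)
  then show "(orbit (tau a), k) \<in> arcs Q_C"
    unfolding Q_C_simps by (rule rev_image_eqI) (simp add: orbit_arrow_def)
qed

lemma verts_Q_C: "verts Q_C = (\<lambda>a. orbit (tau a)) ` FJ"
  by (simp add: Q_C_simps LL_eq image_image)

lemma arcs_Q_C_E:
  assumes "\<alpha> \<in> arcs Q_C"
  obtains a k where "a \<in> FJ" "arrow_at a k" "\<alpha> = (orbit (tau a), k)"
proof -
  obtain x k where x: "(x, k) \<in> arcs Q_hat_C" "\<alpha> = (orbit x, k)"
    using assms unfolding Q_C_simps orbit_arrow_def by force
  from x(1) show thesis by (rule arcs_Q_hat_C_E) (use that x in blast)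
qed

lemma step_eq: "arrow_at a k \<Longrightarrow> step k = tau (label k)"
  by (simp add: tau_label arrow_at_kind_ok)

text \<open>The head in the quotient is a translated set, so it has to be recognised as an orbit.
  Each point of the target orbit is reached by subtracting the label from a representative, which
  stays in \<open>FJ\<close> because its degree is that of \<open>a\<close>.\<close>

lemma head_Q_C:
  assumes a: "a \<in> FJ" and k: "arrow_at a k"
  shows "head Q_C (orbit (tau a), k) = orbit (tau (a + label k))"
proof -
  have lab: "label k \<in> carrier F" using arrow_at_kind_ok[OF k] by simp
  note b = arrow_at_head[OF a k]
  show ?thesis
    unfolding Q_C_simps orbit_tau[OF a] orbit_tau[OF b] step_eq[OF k]
  proof (intro equalityI subsetI)
    fix y assume "y \<in> (\<lambda>x. x + tau (label k)) ` {tau c |c. c \<in> FJ \<and> deg_H c = deg_H a}"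
    then obtain c where c: "c \<in> FJ" "deg_H c = deg_H a" "y = tau (c + label k)"
      by (auto simp: tau_add)
    then have "c + label k \<in> FJ" using FJ_add_cong[OF c(1) a c(2) lab] b by simp
    then show "y \<in> {tau c |c. c \<in> FJ \<and> deg_H c = deg_H (a + label k)}"
      using c deg_H_add_cong[OF c(2)] by blast
  next
    fix y assume "y \<in> {tau c |c. c \<in> FJ \<and> deg_H c = deg_H (a + label k)}"
    then obtain c where c: "c \<in> FJ" "deg_H c = deg_H (a + label k)" "y = tau c" by blast
    have d: "deg_H (c - label k) = deg_H a"
      using deg_H_add_cong[OF c(2), of "- label k"] by simp
    have "c - label k \<in> FJ" using FJ_cong[OF a _ d] c(1) lab by simp
    moreover have "y = tau (c - label k) + tau (label k)" using c(3) by (simp flip: tau_add)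
    ultimately show "y \<in> (\<lambda>x. x + tau (label k)) ` {tau c |c. c \<in> FJ \<and> deg_H c = deg_H a}"
      using d by blast
  qed
qed

text \<open>
  A walk is encoded by a representative of its source together with the list of the
  kinds of its arrows.
\<close>

definition kinds_label :: "arrow_kind list \<Rightarrow> ((int ^ 'n) \<Rightarrow>\<^sub>0 int)" where
  "kinds_label ks = sum_list (map label ks)"

lemma kinds_label_simps [simp]:
  "kinds_label [] = 0" "kinds_label (k # ks) = label k + kinds_label ks"
  "kinds_label (ks @ ks') = kinds_label ks + kinds_label ks'"
  by (simp_all add: kinds_label_def)

fun walk_at :: "((int ^ 'n) \<Rightarrow>\<^sub>0 int) \<Rightarrow> arrow_kind list \<Rightarrow> bool" where
  "walk_at a [] \<longleftrightarrow> True"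
| "walk_at a (k # ks) \<longleftrightarrow> arrow_at a k \<and> walk_at (a + label k) ks"

fun walk_hat :: "((int ^ 'n) \<Rightarrow>\<^sub>0 int) \<Rightarrow> arrow_kind list \<Rightarrow> latt_arrow list" where
  "walk_hat a [] = []"
| "walk_hat a (k # ks) = (tau a, k) # walk_hat (a + label k) ks"

definition walk :: "((int ^ 'n) \<Rightarrow>\<^sub>0 int) \<Rightarrow> arrow_kind list \<Rightarrow> quot_arrow list" where
  "walk a ks = map orbit_arrow (walk_hat a ks)"

lemma walk_simps [simp]:
  "walk a [] = []" "walk a (k # ks) = (orbit (tau a), k) # walk (a + label k) ks"
  by (simp_all add: walk_def orbit_arrow_def)

lemma path_label_walk [simp]: "path_label (walk a ks) = kinds_label ks"
  by (induction ks arbitrary: a) (simp_all add: path_label_def)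

lemma path_label_walk_hat [simp]: "path_label (walk_hat a ks) = kinds_label ks"
  by (induction ks arbitrary: a) (simp_all add: path_label_def)

lemma walk_at_end: "a \<in> FJ \<Longrightarrow> walk_at a ks \<Longrightarrow> a + kinds_label ks \<in> FJ"
  by (induction ks arbitrary: a) (auto simp: arrow_at_head simp flip: add.assoc)

lemma walk_at_label: "walk_at a ks \<Longrightarrow> kinds_label ks \<in> carrier F"
  by (induction ks arbitrary: a) (auto dest: arrow_at_kind_ok)

lemma walk_at_append:
  "walk_at a (ks @ ks') \<longleftrightarrow> walk_at a ks \<and> walk_at (a + kinds_label ks) ks'"
  by (induction ks arbitrary: a) (auto simp: add.assoc)

lemma walk_append: "walk a (ks @ ks') = walk a ks @ walk (a + kinds_label ks) ks'"
  by (induction ks arbitrary: a) (auto simp: add.assoc)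

text \<open>Allows a walk to be restarted at any other representative of its source, which is how
  walks are transported between lifts and concatenated below.\<close>

lemma walk_at_cong:
  assumes "a \<in> FJ" "b \<in> FJ" "deg_H a = deg_H b" "walk_at a ks"
  shows "walk_at b ks \<and> walk b ks = walk a ks"
  using assms
proof (induction ks arbitrary: a b)
  case (Cons k ks)
  have k: "arrow_at a k" "arrow_at b k" using Cons.prems(4) arrow_at_cong[OF Cons.prems(1-3), of k] by simp_all
  have eq: "deg_H (a + label k) = deg_H (b + label k)"
    using Cons.prems(3) by (rule deg_H_add_cong)
  have "walk_at (b + label k) ks \<and> walk (b + label k) ks = walk (a + label k) ks"
    using Cons.prems k by (intro Cons.IH[OF _ _ eq] arrow_at_head) auto
  then show ?case using Cons.prems k orbit_tau_eq_iff[of a b] by simp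
qed simp

text \<open>Heads of arrows stay in \<open>FJ\<close>, so the induction can pass to the
  representative \<open>a + label k\<close> of the next vertex.\<close>

lemma awalk_Q_hat_C_iff:
  assumes "a \<in> FJ"
  shows "pre_digraph.awalk Q_hat_C (tau a) \<gamma> y \<longleftrightarrow>
    (\<exists>ks. walk_at a ks \<and> \<gamma> = walk_hat a ks \<and> y = tau (a + kinds_label ks))"
  using assms
proof (induction \<gamma> arbitrary: a)
  case Nil
  have eq: "[] = walk_hat a ks \<longleftrightarrow> ks = []" for ks by (cases ks) auto
  have "pre_digraph.awalk Q_hat_C (tau a) [] y \<longleftrightarrow> y = tau a"
    by (auto simp: pre_digraph.awalk_def pre_digraph.cas.simps Q_C_simps)
  then show ?case unfolding eq by simp
next
  case (Cons \<alpha> \<gamma>)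
  obtain x k where \<alpha>: "\<alpha> = (x, k)" by (cases \<alpha>)
  have "pre_digraph.awalk Q_hat_C (tau a) (\<alpha> # \<gamma>) y \<longleftrightarrow>
      x = tau a \<and> arrow_at a k \<and> pre_digraph.awalk Q_hat_C (tau (a + label k)) \<gamma> y"
    using Cons.prems arcs_Q_hat_C_iff[OF Cons.prems, of k] step_eq[of a k]
      tau_in_LL[of "a + label k", unfolded tau_add]
    by (auto simp: pre_digraph.awalk_def pre_digraph.cas.simps Q_C_simps \<alpha> tau_add)
  also have "\<dots> \<longleftrightarrow> (\<exists>ks. walk_at a ks \<and> \<alpha> # \<gamma> = walk_hat a ks \<and> y = tau (a + kinds_label ks))"
    (is "_ \<longleftrightarrow> (\<exists>ks. ?R ks)")
  proof
    assume h: "x = tau a \<and> arrow_at a k \<and>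
      pre_digraph.awalk Q_hat_C (tau (a + label k)) \<gamma> y"
    then have "arrow_at a k" and "pre_digraph.awalk Q_hat_C (tau (a + label k)) \<gamma> y" by blast+
    then obtain ks where "walk_at (a + label k) ks" "\<gamma> = walk_hat (a + label k) ks"
        "y = tau (a + label k + kinds_label ks)"
      using Cons.IH[OF arrow_at_head[OF Cons.prems], of k] by blast
    with h have "?R (k # ks)" by (simp add: \<alpha> add.assoc)
    then show "\<exists>ks. ?R ks" by blast
  next
    assume "\<exists>ks. ?R ks"
    then obtain ks where ks: "?R ks" by blast
    then obtain ks' where "ks = k # ks'" by (cases ks) (auto simp: \<alpha>)
    with ks show "x = tau a \<and> arrow_at a k \<and> pre_digraph.awalk Q_hat_C (tau (a + label k)) \<gamma> y"
      using Cons.IH[of "a + label k"] arrow_at_head[OF Cons.prems, of k]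
      by (auto simp: \<alpha> add.assoc)
  qed
  finally show ?case .
qed

lemma awalk_Q_C_iff:
  assumes "a \<in> FJ"
  shows "pre_digraph.awalk Q_C (orbit (tau a)) \<gamma> Y \<longleftrightarrow>
    (\<exists>ks. walk_at a ks \<and> \<gamma> = walk a ks \<and> Y = orbit (tau (a + kinds_label ks)))"
  using assms
proof (induction \<gamma> arbitrary: a)
  case Nil
  have eq: "[] = walk a ks \<longleftrightarrow> ks = []" for ks by (cases ks) auto
  have "pre_digraph.awalk Q_C (orbit (tau a)) [] Y \<longleftrightarrow> Y = orbit (tau a)"
    using Nil by (auto simp: pre_digraph.awalk_def pre_digraph.cas.simps verts_Q_C)
  then show ?case unfolding eq by simp
next
  case (Cons \<alpha> \<gamma>)
  obtain X k where \<alpha>: "\<alpha> = (X, k)" by (cases \<alpha>)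
  have vert: "orbit (tau b) \<in> verts Q_C" if "b \<in> FJ" for b
    using that by (auto simp: verts_Q_C)
  have "pre_digraph.awalk Q_C (orbit (tau a)) (\<alpha> # \<gamma>) Y \<longleftrightarrow>
      X = orbit (tau a) \<and> arrow_at a k \<and>
      pre_digraph.awalk Q_C (orbit (tau (a + label k))) \<gamma> Y"
    using Cons.prems arcs_Q_C_iff[OF Cons.prems, of k] head_Q_C[OF Cons.prems, of k]
      vert[OF Cons.prems] vert[OF arrow_at_head[OF Cons.prems, of k]]
    by (auto simp: pre_digraph.awalk_def pre_digraph.cas.simps Q_C_simps(3) \<alpha>)
  also have "\<dots> \<longleftrightarrow>
      (\<exists>ks. walk_at a ks \<and> \<alpha> # \<gamma> = walk a ks \<and> Y = orbit (tau (a + kinds_label ks)))"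
    (is "_ \<longleftrightarrow> (\<exists>ks. ?R ks)")
  proof
    assume h: "X = orbit (tau a) \<and> arrow_at a k \<and>
      pre_digraph.awalk Q_C (orbit (tau (a + label k))) \<gamma> Y"
    then have "arrow_at a k" and "pre_digraph.awalk Q_C (orbit (tau (a + label k))) \<gamma> Y" by blast+
    then obtain ks where "walk_at (a + label k) ks" "\<gamma> = walk (a + label k) ks"
        "Y = orbit (tau (a + label k + kinds_label ks))"
      using Cons.IH[OF arrow_at_head[OF Cons.prems], of k] by blast
    with h have "?R (k # ks)" by (simp add: \<alpha> add.assoc)
    then show "\<exists>ks. ?R ks" by blast
  next
    assume "\<exists>ks. ?R ks"
    then obtain ks where ks: "?R ks" by blast
    then obtain ks' where "ks = k # ks'" by (cases ks) (auto simp: \<alpha>)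
    with ks show "X = orbit (tau a) \<and> arrow_at a k \<and>
        pre_digraph.awalk Q_C (orbit (tau (a + label k))) \<gamma> Y"
      using Cons.IH[of "a + label k"] arrow_at_head[OF Cons.prems, of k]
      by (auto simp: \<alpha> add.assoc)
  qed
  finally show ?case .
qed

end

section \<open>Existence of walks and values of cuts\<close>

context simplicial_setting
begin

lemma lookup_bold_p: "Poly_Mapping.lookup bold_p w = (if w \<in> vertices then 1 else 0)"
  using finite_vertices by (simp add: bold_p_def lookup_sum)

lemma lookup_outside: "a \<in> carrier F \<Longrightarrow> w \<notin> vertices \<Longrightarrow> Poly_Mapping.lookup a w = 0"
  by (auto simp: F_def in_keys_iff subset_iff)

text \<open>All coordinates of \<open>p\<close> at vertices are 1, so a bound on the coordinates of
  \<open>a\<close> suffices as \<open>M\<close>. As \<open>p\<close> vanishes in \<open>H\<close>,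
  the shift does not affect the degree.\<close>

lemma F_nonneg_shift:
  assumes "a \<in> carrier F"
  obtains M where "M \<ge> 0" "a + frag_cmul M bold_p \<in> F_nonneg"
proof -
  obtain M where M: "M \<ge> 0" "\<And>w. \<bar>Poly_Mapping.lookup a w\<bar> \<le> M"
    using lookup_bounded by blast
  have "Poly_Mapping.lookup (a + frag_cmul M bold_p) w \<ge> 0" for w
    using M(2)[of w] lookup_outside[OF assms, of w]
    by (cases "w \<in> vertices") (auto simp: lookup_add lookup_bold_p)
  then have "a + frag_cmul M bold_p \<in> F_nonneg"
    using assms by (simp add: F_nonneg_def)
  with M(1) show thesis by (rule that)
qed

text \<open>The measure that decreases while a walk is built: on \<open>F_nonneg\<close> it is
  nonnegative, and every label has positive weight.\<close>

definition weight :: "((int ^ 'n) \<Rightarrow>\<^sub>0 int) \<Rightarrow> int" where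
  "weight c = (\<Sum>w\<in>vertices. Poly_Mapping.lookup c w)"

lemma weight_add: "weight (a + b) = weight a + weight b"
  by (simp add: weight_def lookup_add sum.distrib)

lemma weight_diff: "weight (a - b) = weight a - weight b"
  by (simp add: weight_def lookup_minus sum_subtractf)

lemma weight_label: "kind_ok k \<Longrightarrow> weight (label k) > 0"
proof -
  have "weight (e i) = 1" if "i \<le> l" for i
    using finite_vertices v_in_vertices(1)[OF that] by (simp add: weight_def e_def)
  moreover have "weight (e' j) = 1" if "j \<le> l'" for j
    using finite_vertices v_in_vertices(2)[OF that] by (simp add: weight_def e'_def)
  ultimately show "kind_ok k \<Longrightarrow> weight (label k) > 0"
    by (cases k) (simp_all add: weight_add)
qed

lemma weight_nonneg: "c \<in> F_nonneg \<Longrightarrow> weight c \<ge> 0"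
  by (simp add: weight_def F_nonneg_def sum_nonneg)

lemma F_nonneg_diff_label:
  assumes c: "c \<in> F_nonneg" and k: "kind_ok k"
    and le: "case k of Plain i \<Rightarrow> Poly_Mapping.lookup c (v i) > 0
      | Primed j \<Rightarrow> Poly_Mapping.lookup c (v' j) > 0
      | Composite i j \<Rightarrow> Poly_Mapping.lookup c (v i) > 0 \<and> Poly_Mapping.lookup c (v' j) > 0"
  shows "c - label k \<in> F_nonneg"
proof -
  have "Poly_Mapping.lookup (label k) w \<le> Poly_Mapping.lookup c w" for w
  proof -
    have "Poly_Mapping.lookup c w \<ge> 0" using c by (simp add: F_nonneg_def)
    then show ?thesis
      using k le v_eq_iff(4) by (cases k) (auto simp: e_def e'_def lookup_add)
  qed
  then show ?thesis
    using c k by (simp add: F_nonneg_def lookup_minus)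
qed

lemma cmul_p_nonneg: "n \<ge> 0 \<Longrightarrow> frag_cmul n bold_p \<in> F_nonneg"
  by (simp add: F_nonneg_def lookup_bold_p)

lemma label_nonneg: "kind_ok k \<Longrightarrow> label k \<in> F_nonneg"
proof -
  assume k: "kind_ok k"
  have "Poly_Mapping.lookup (label k) w \<ge> 0" for w
    by (cases k) (auto simp: e_def e'_def lookup_add)
  then show ?thesis using k by (simp add: F_nonneg_def)
qed

lemma label_le_p: "kind_ok k \<Longrightarrow> bold_p - label k \<in> F_nonneg"
proof -
  assume k: "kind_ok k"
  have "Poly_Mapping.lookup (label k) w \<le> (if w \<in> vertices then 1 else 0)" for w
    using k v_eq_iff(4) by (cases k) (auto simp: e_def e'_def lookup_add)
  then show ?thesis using k by (simp add: F_nonneg_def lookup_minus lookup_bold_p)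
qed

text \<open>
  The walk is chosen greedily. If no arrow fits, then all coordinates of \<open>c\<close> with one of the two
  signs vanish, and leaving \<^term>\<open>J\<close> along a single arrow forces \<open>a + c\<close> out of \<^term>\<open>J\<close> as well.
\<close>
lemma first_arrow_exists:
  assumes a: "a \<in> FJ" and c: "c \<in> F_nonneg" and ac: "a + c \<in> FJ" and "c \<noteq> 0"
  shows "\<exists>k. arrow_at a k \<and> c - label k \<in> F_nonneg"
proof -
  let ?c = "Poly_Mapping.lookup c"
  have cF: "c \<in> carrier F" and c0: "\<And>w. ?c w \<ge> 0" using c by (auto simp: F_nonneg_def)
  \<comment> \<open>If all usable plain arrows leave \<open>J\<close> through the top and no primed
    coordinate is positive, the rest of \<open>c\<close> only moves further up, and
    \<open>a + c\<close> ends above \<open>J\<close>.\<close>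
  have end_pos: "i > l \<or> ?c (v i) \<le> 0"
    if none: "\<And>i. i \<le> l \<Longrightarrow> ?c (v i) > 0 \<Longrightarrow> a + e i \<notin> FJ"
      and zero: "\<And>j. j \<le> l' \<Longrightarrow> ?c (v' j) \<le> 0" for i
  proof (rule ccontr)
    assume "\<not> (i > l \<or> ?c (v i) \<le> 0)"
    then have i: "i \<le> l" and pos: "?c (v i) > 0" by auto
    have "H_nonneg (c - e i)"
      using i cF c0 zero pos by (auto simp: H_nonneg_def lookup_minus)
    then have "deg_H ((a + e i - pos_p) + (c - e i)) \<in> I"
      using a i step_out_pos[OF a i none[OF i pos]] by (intro I_add) auto
    moreover have "(a + e i - pos_p) + (c - e i) = a + c - pos_p" by simp
    ultimately show False using ac FJ_iff[of "a + c"] FJ_in_F[OF ac] by metis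
  qed
  \<comment> \<open>Dually, without positive plain coordinates \<open>a + c\<close> lies below
    \<open>a + e' j\<close>, which has already fallen out of \<open>I\<close>.\<close>
  have end_neg: "j > l' \<or> ?c (v' j) \<le> 0"
    if none: "\<And>j. j \<le> l' \<Longrightarrow> ?c (v' j) > 0 \<Longrightarrow> a + e' j \<notin> FJ"
      and zero: "\<And>i. i \<le> l \<Longrightarrow> ?c (v i) \<le> 0" for j
  proof (rule ccontr)
    assume "\<not> (j > l' \<or> ?c (v' j) \<le> 0)"
    then have j: "j \<le> l'" and pos: "?c (v' j) > 0" by auto
    have "?c (v i) = 0" if "i \<le> l" for i
      using zero[OF that] c0[of "v i"] by simp
    then have "H_nonneg (e' j - c)"
      using j cF c0 pos by (auto simp: H_nonneg_def lookup_minus)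
    moreover have "deg_H (a + c) \<in> I" using ac FJ_iff[of "a + c"] FJ_in_F[OF ac] by metis
    ultimately have "deg_H ((a + c) + (e' j - c)) \<in> I"
      using FJ_in_F[OF ac] by (metis I_add)
    moreover have "(a + c) + (e' j - c) = a + e' j" by simp
    ultimately show False using step_out_neg[OF a j none[OF j pos]] by metis
  qed
  \<comment> \<open>Hence some coordinate is positive. By the two preceding facts, either some
    usable plain or primed arrow stays in \<open>J\<close>, or positive coordinates of both kinds
    occur and their arrows leave \<open>J\<close>, which is the condition for a composite
    arrow.\<close>
  have "c = 0" if "\<And>i. i \<le> l \<Longrightarrow> ?c (v i) \<le> 0" "\<And>j. j \<le> l' \<Longrightarrow> ?c (v' j) \<le> 0"
    using that c0 cF by (intro F_eqI) (auto simp: order_antisym_conv)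
  with \<open>c \<noteq> 0\<close> consider
    i where "i \<le> l" "?c (v i) > 0" "a + e i \<in> FJ" | j where "j \<le> l'" "?c (v' j) > 0" "a + e' j \<in> FJ"
    | i j where "i \<le> l" "?c (v i) > 0" "a + e i \<notin> FJ" "j \<le> l'" "?c (v' j) > 0" "a + e' j \<notin> FJ"
    using end_pos end_neg by (metis linorder_not_less)
  then show ?thesis
  proof cases
    case (1 i)
    then show ?thesis
      using F_nonneg_diff_label[OF c, of "Plain i"] by (intro exI[of _ "Plain i"]) auto
  next
    case (2 j)
    then show ?thesis
      using F_nonneg_diff_label[OF c, of "Primed j"] by (intro exI[of _ "Primed j"]) auto
  next
    case (3 i j)
    then show ?thesis
      using F_nonneg_diff_label[OF c, of "Composite i j"] by (intro exI[of _ "Composite i j"]) auto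
  qed
qed

lemma walk_exists:
  assumes "a \<in> FJ" "c \<in> F_nonneg" "a + c \<in> FJ"
  shows "\<exists>ks. walk_at a ks \<and> kinds_label ks = c"
  using assms
proof (induction "nat (weight c)" arbitrary: a c rule: less_induct)
  case less
  show ?case
  proof (cases "c = 0")
    case True
    then show ?thesis by (intro exI[of _ "[]"]) simp
  next
    case False
    then obtain k where k: "arrow_at a k" "c - label k \<in> F_nonneg"
      using first_arrow_exists less.prems by blast
    have "weight (label k) > 0" using weight_label arrow_at_kind_ok[OF k(1)] by blast
    then have "nat (weight (c - label k)) < nat (weight c)"
      using weight_nonneg[OF k(2)] by (simp add: weight_diff)
    then obtain ks where "walk_at (a + label k) ks" "kinds_label ks = c - label k"
      using less.hyps[of "c - label k" "a + label k"] arrow_at_head[OF less.prems(1) k(1)] k(2)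
        less.prems(3) by auto
    then show ?thesis using k(1) by (intro exI[of _ "k # ks"]) simp
  qed
qed

text \<open>The label \<open>b - a\<close> becomes nonnegative after adding a multiple of
  \<open>p\<close>, which does not change the vertex reached.\<close>

lemma walk_connects:
  assumes "a \<in> FJ" "b \<in> FJ"
  shows "\<exists>ks. walk_at a ks \<and> deg_H (a + kinds_label ks) = deg_H b"
proof -
  obtain M where M: "(b - a) + frag_cmul M bold_p \<in> F_nonneg"
    using F_nonneg_shift[of "b - a"] assms by auto
  have eq: "a + ((b - a) + frag_cmul M bold_p) = b + frag_cmul M bold_p" by simp
  have "a + ((b - a) + frag_cmul M bold_p) \<in> FJ"
    unfolding eq using FJ_cong[OF assms(2)] assms(2) by (simp add: deg_H_bold_p)
  then obtain ks where "walk_at a ks" "kinds_label ks = (b - a) + frag_cmul M bold_p"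
    using walk_exists[OF assms(1) M] by blast
  then show ?thesis using eq by (intro exI[of _ ks]) (simp add: deg_H_bold_p)
qed

section \<open>Values of walks and the cut axioms\<close>

lemma eps_append: "eps C (\<gamma> @ \<gamma>') = eps C \<gamma> + eps C \<gamma>'"
  by (simp add: eps_def)

text \<open>The expression defining \<open>kappa\<close>, extended from periods to arbitrary walks,
  so that it becomes additive under concatenation.\<close>

definition val :: "quot_arrow set \<Rightarrow> ((int ^ 'n) \<Rightarrow>\<^sub>0 int) \<Rightarrow> arrow_kind list \<Rightarrow>
    ((int ^ 'n) \<Rightarrow>\<^sub>0 int)" where
  "val C a ks = kinds_label ks - frag_cmul (int (eps C (walk a ks))) bold_p"

lemma val_append: "val C a (ks @ ks') = val C a ks + val C (a + kinds_label ks) ks'"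
  by (simp add: val_def walk_append eps_append frag_cmul_distrib)

lemma val_cong: "a \<in> FJ \<Longrightarrow> b \<in> FJ \<Longrightarrow> deg_H a = deg_H b \<Longrightarrow> walk_at a ks \<Longrightarrow> val C b ks = val C a ks"
  using walk_at_cong[of a b ks] by (simp add: val_def)

lemma val_in_F: "walk_at a ks \<Longrightarrow> val C a ks \<in> carrier F"
  using walk_at_label by (simp add: val_def)

lemma deg_H_val: "deg_H (a + val C b ks) = deg_H (a + kinds_label ks)"
proof -
  have "a + val C b ks = a + kinds_label ks + frag_cmul (- int (eps C (walk b ks))) bold_p"
    by (simp add: val_def flip: minus_frag_cmul)
  then show ?thesis by (simp only: deg_H_bold_p)
qed

lemma cut_iff:
  "cut C \<longleftrightarrow> C \<subseteq> arcs Q_C \<and>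
    (\<forall>a\<in>FJ. \<forall>ks. walk_at a ks \<and> kinds_label ks = bold_p \<longrightarrow> eps C (walk a ks) = 1) \<and>
    (\<forall>a\<in>FJ. \<forall>ks ks'. walk_at a ks \<and> walk_at a ks' \<and> kinds_label ks = kinds_label ks' \<longrightarrow>
      eps C (walk a ks) = eps C (walk a ks'))"
proof -
  have from_vertex: "(\<exists>a. a \<in> FJ \<and> X = orbit (tau a))" if "pre_digraph.awalk Q_C X \<gamma> Y" for X \<gamma> Y
    using that verts_Q_C by (auto simp: pre_digraph.awalk_def)
  have cycle: "elementary_cycle \<gamma> \<longleftrightarrow>
      (\<exists>a\<in>FJ. \<exists>ks. walk_at a ks \<and> \<gamma> = walk a ks \<and> kinds_label ks = bold_p)" for \<gamma>
  proof
    assume "elementary_cycle \<gamma>"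
    then obtain X where X: "pre_digraph.awalk Q_C X \<gamma> X" "path_label \<gamma> = bold_p"
      by (auto simp: elementary_cycle_def)
    then obtain a where a: "a \<in> FJ" "X = orbit (tau a)" using from_vertex by blast
    then obtain ks where "walk_at a ks" "\<gamma> = walk a ks"
      using X(1) awalk_Q_C_iff by blast
    then show "\<exists>a\<in>FJ. \<exists>ks. walk_at a ks \<and> \<gamma> = walk a ks \<and> kinds_label ks = bold_p"
      using a X(2) by auto
  next
    assume "\<exists>a\<in>FJ. \<exists>ks. walk_at a ks \<and> \<gamma> = walk a ks \<and> kinds_label ks = bold_p"
    then obtain a ks where a: "a \<in> FJ" "walk_at a ks" "\<gamma> = walk a ks" "kinds_label ks = bold_p"
      by blast
    \<comment> \<open>A walk with label \<open>p\<close> closes up in the quotient automatically,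
      since \<open>p\<close> has degree zero.\<close>
    have "deg_H (a + bold_p) = deg_H a" using deg_H_bold_p[of a 1] by simp
    then have "orbit (tau (a + kinds_label ks)) = orbit (tau a)"
      using a walk_at_end[OF a(1,2)] orbit_tau_eq_iff by simp
    then have "pre_digraph.awalk Q_C (orbit (tau a)) \<gamma> (orbit (tau a))"
      unfolding awalk_Q_C_iff[OF a(1)] using a by metis
    then show "elementary_cycle \<gamma>"
      unfolding elementary_cycle_def using a by auto
  qed
  have same: "(\<forall>X Y \<gamma> \<gamma>'. pre_digraph.awalk Q_C X \<gamma> Y \<and> pre_digraph.awalk Q_C X \<gamma>' Y \<and>
        path_label \<gamma> = path_label \<gamma>' \<longrightarrow> eps C \<gamma> = eps C \<gamma>') \<longleftrightarrow>
      (\<forall>a\<in>FJ. \<forall>ks ks'. walk_at a ks \<and> walk_at a ks' \<and> kinds_label ks = kinds_label ks' \<longrightarrow>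
        eps C (walk a ks) = eps C (walk a ks'))" (is "?L \<longleftrightarrow> ?R")
  proof
    assume L: ?L
    show ?R
    proof (intro ballI allI impI)
      fix a ks ks'
      assume a: "a \<in> FJ" and w: "walk_at a ks \<and> walk_at a ks' \<and> kinds_label ks = kinds_label ks'"
      let ?Y = "orbit (tau (a + kinds_label ks))"
      have "pre_digraph.awalk Q_C (orbit (tau a)) (walk a ks) ?Y"
        "pre_digraph.awalk Q_C (orbit (tau a)) (walk a ks') ?Y"
        unfolding awalk_Q_C_iff[OF a] using w by metis+
      then show "eps C (walk a ks) = eps C (walk a ks')"
        using L w by (metis path_label_walk)
    qed
  next
    assume R: ?R
    show ?L
    proof (intro allI impI)
      fix X Y \<gamma> \<gamma>'
      assume w: "pre_digraph.awalk Q_C X \<gamma> Y \<and> pre_digraph.awalk Q_C X \<gamma>' Y \<and>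
        path_label \<gamma> = path_label \<gamma>'"
      then obtain a where a: "a \<in> FJ" "X = orbit (tau a)" using from_vertex by blast
      obtain ks where ks: "walk_at a ks" "\<gamma> = walk a ks"
        using w awalk_Q_C_iff[OF a(1)] a(2) by blast
      obtain ks' where ks': "walk_at a ks'" "\<gamma>' = walk a ks'"
        using w awalk_Q_C_iff[OF a(1)] a(2) by blast
      have "kinds_label ks = kinds_label ks'" using w unfolding ks(2) ks'(2) by simp
      then show "eps C \<gamma> = eps C \<gamma>'"
        unfolding ks(2) ks'(2) using R a(1) ks(1) ks'(1) by blast
    qed
  qed
  show ?thesis unfolding cut_def same cycle by blast
qed

lemma cut_D:
  assumes "cut C"
  shows "C \<subseteq> arcs Q_C"
    and "a \<in> FJ \<Longrightarrow> walk_at a ks \<Longrightarrow> kinds_label ks = bold_p \<Longrightarrow> eps C (walk a ks) = 1"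
    and "a \<in> FJ \<Longrightarrow> walk_at a ks \<Longrightarrow> walk_at a ks' \<Longrightarrow> kinds_label ks = kinds_label ks' \<Longrightarrow>
      eps C (walk a ks) = eps C (walk a ks')"
  using assms unfolding cut_iff by blast+

lemma B_E:
  assumes "b \<in> B"
  obtains c where "c \<in> carrier F" "tau c = b" "deg_H c = deg_H 0"
proof -
  have "tau (sigma b) = b" using assms B_subset_LL tau_sigma by blast
  then obtain n where n: "deg_H (sigma b) = deg_H (frag_cmul n pos_p)"
    using assms tau_in_B_iff[of "sigma b"] by auto
  let ?c = "sigma b + frag_cmul (- n) pos_p"
  have "deg_H ?c = deg_H 0"
    using deg_H_add_cong[OF n, of "frag_cmul (- n) pos_p"] by (simp flip: frag_cmul_distrib)
  moreover have "tau ?c = b" using \<open>tau (sigma b) = b\<close> by (simp only: tau_pos_p)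
  moreover have "?c \<in> carrier F" by (intro F_add F_cmul) auto
  ultimately show thesis using that by blast
qed

lemma tau_bold_p: "tau (a + frag_cmul n bold_p) = tau a"
proof -
  have "tau (frag_cmul n bold_p) = 0"
    by (subst tau_eq_0_iff) (simp, rule exI[of _ n], rule exI[of _ n],
        simp add: bold_p_eq frag_cmul_distrib2)
  then show ?thesis by (simp add: tau_add)
qed

text \<open>A kernel element of \<open>tau\<close> is \<open>c pos_p + d neg_p\<close> and has
  degree \<open>(c - d) s\<close>. As \<open>s\<close> has infinite order, degree zero forces
  \<open>c = d\<close>, which leaves a multiple of \<open>p\<close>.\<close>

lemma tau_deg_H_eq:
  assumes "x \<in> carrier F" "y \<in> carrier F" "tau x = tau y" "deg_H x = deg_H y"
  shows "\<exists>n. x = y + frag_cmul n bold_p"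
proof -
  have "tau (x - y) = 0" using assms(3) by (simp add: tau_diff)
  then obtain c d where cd: "x - y = frag_cmul c pos_p + frag_cmul d neg_p"
    using tau_eq_0_iff[of "x - y"] assms by auto
  have "deg_H (0 + frag_cmul (c - d) pos_p) = deg_H (frag_cmul c pos_p + frag_cmul (- d) pos_p)"
    by (simp add: frag_cmul_diff_distrib flip: minus_frag_cmul)
  also have "\<dots> = deg_H (x - y)" unfolding cd deg_H_neg_p ..
  also have "\<dots> = deg_H 0" using assms(4) by (simp add: deg_H_eq_iff)
  finally have "c - d = 0" by (rule deg_H_pos_p_torsion_free)
  then have "x - y = frag_cmul c bold_p" using cd by (simp add: bold_p_eq frag_cmul_distrib2)
  then show ?thesis by (metis add.commute diff_add_cancel)
qed

text \<open>Being a period only says that the degree is a multiple of \<open>s\<close>. Both ends of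
  the walk lie over \<open>J\<close>, which contains one shift from each line, so the multiple is
  zero.\<close>

lemma walk_at_period:
  assumes "a \<in> FJ" "walk_at a ks"
  shows "tau (kinds_label ks) \<in> B \<longleftrightarrow> deg_H (kinds_label ks) = deg_H 0"
proof
  have F: "kinds_label ks \<in> carrier F" using assms(2) by (rule walk_at_label)
  show "tau (kinds_label ks) \<in> B" if "deg_H (kinds_label ks) = deg_H 0"
    using that tau_in_B_iff[OF F] by (metis frag_cmul_zero)
  assume "tau (kinds_label ks) \<in> B"
  then obtain n where n: "deg_H (kinds_label ks) = deg_H (frag_cmul n pos_p)"
    using tau_in_B_iff[OF F] by blast
  have "deg_H (a + frag_cmul n pos_p) = deg_H (a + kinds_label ks)"
    using deg_H_add_cong[OF n, of a] by (simp add: add.commute)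
  then have "n = 0"
    using J_shift_unique[of a n] FJ_D[OF assms(1)] FJ_D(2)[OF walk_at_end[OF assms]] by simp
  then show "deg_H (kinds_label ks) = deg_H 0" using n by simp
qed

text \<open>Resolves the choice in \<open>kappa\<close>. A candidate exists because adding multiples
  of \<open>p\<close> to a representative of \<open>b\<close> makes it a nonnegative label without
  changing \<open>tau\<close> or the degree. The chosen walk may start anywhere, so its source is
  part of the conclusion.\<close>

lemma kappa_E:
  assumes "b \<in> B"
  obtains a ks where "a \<in> FJ" "walk_at a ks" "tau (kinds_label ks) = b" "kappa C b = val C a ks"
proof -
  let ?P = "\<lambda>z. \<exists>x \<gamma>. x \<in> carrier LL \<and> pre_digraph.awalk Q_hat_C x \<gamma> (x + b) \<and>
     z = path_label \<gamma> - frag_cmul (int (eps C (map orbit_arrow \<gamma>))) bold_p"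
  obtain a where a: "a \<in> FJ" using FJ_nonempty by blast
  obtain c where c: "c \<in> carrier F" "tau c = b" "deg_H c = deg_H 0" using B_E[OF assms] .
  obtain M where M: "c + frag_cmul M bold_p \<in> F_nonneg" using F_nonneg_shift[OF c(1)] by blast
  have "deg_H (a + (c + frag_cmul M bold_p)) = deg_H (a + c)"
    using deg_H_bold_p[of "a + c" M] by (simp add: add.assoc)
  also have "\<dots> = deg_H a" using c(3) by (simp add: deg_H_eq_iff)
  finally have "a + (c + frag_cmul M bold_p) \<in> FJ" using FJ_cong[OF a] a c(1) by simp
  then obtain ks where ks: "walk_at a ks" "kinds_label ks = c + frag_cmul M bold_p"
    using walk_exists[OF a M] by blast
  have "tau (a + kinds_label ks) = tau a + b" by (simp only: ks tau_add[of a] tau_bold_p c)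
  then have "pre_digraph.awalk Q_hat_C (tau a) (walk_hat a ks) (tau a + b)"
    unfolding awalk_Q_hat_C_iff[OF a] using ks(1) by metis
  then have "\<exists>z. ?P z" using tau_in_LL by blast
  then have "?P (kappa C b)" unfolding kappa_def by (rule someI_ex)
  then obtain x \<gamma> where x: "x \<in> carrier LL" "pre_digraph.awalk Q_hat_C x \<gamma> (x + b)"
     "kappa C b = path_label \<gamma> - frag_cmul (int (eps C (map orbit_arrow \<gamma>))) bold_p"
    by blast
  from x(1) obtain a' where a': "a' \<in> FJ" "x = tau a'" unfolding LL_eq by blast
  then obtain ks' where ks': "walk_at a' ks'" "\<gamma> = walk_hat a' ks'"
      "tau a' + b = tau (a' + kinds_label ks')"
    using x(2) awalk_Q_hat_C_iff[OF a'(1)] by blast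
  show thesis
  proof (rule that[OF a'(1) ks'(1)])
    show "tau (kinds_label ks') = b" using ks'(3) by (simp add: tau_add)
    show "kappa C b = val C a' ks'" using x(3) ks'(2) by (simp add: val_def walk_def)
  qed
qed

text \<open>Concatenating \<open>n\<close> elementary cycles gives one walk with this label and
  count \<open>n\<close>; condition (ii) transfers the count to every other walk with the same
  label.\<close>

lemma cut_eps_multiple:
  assumes C: "cut C" and a: "a \<in> FJ" and ks: "walk_at a ks" "kinds_label ks = frag_cmul (int n) bold_p"
  shows "eps C (walk a ks) = n"
proof -
  have "\<exists>ks'. walk_at a ks' \<and> kinds_label ks' = frag_cmul (int n) bold_p \<and> eps C (walk a ks') = n"
  proof (induction n)
    case 0
    show ?case by (intro exI[of _ "[]"]) (simp add: eps_def)
  next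
    case (Suc n)
    then obtain ks' where ks': "walk_at a ks'" "kinds_label ks' = frag_cmul (int n) bold_p"
      "eps C (walk a ks') = n" by blast
    let ?b = "a + kinds_label ks'"
    have b: "?b \<in> FJ" using a ks'(1) by (rule walk_at_end)
    have p: "bold_p \<in> F_nonneg" by (simp add: F_nonneg_def lookup_bold_p)
    have "deg_H (?b + bold_p) = deg_H ?b" using deg_H_bold_p[of ?b 1] by simp
    then have "?b + bold_p \<in> FJ" using FJ_cong[OF b] b by simp
    then obtain ks1 where ks1: "walk_at ?b ks1" "kinds_label ks1 = bold_p"
      using walk_exists[OF b p] by blast
    have "eps C (walk ?b ks1) = 1" by (rule cut_D(2)[OF C b ks1])
    moreover have "frag_cmul (int n) bold_p + bold_p = frag_cmul (int (Suc n)) bold_p"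
      by (simp add: frag_cmul_distrib add.commute)
    ultimately show ?case
      using ks' ks1
      by (intro exI[of _ "ks' @ ks1"]) (simp add: walk_at_append walk_append eps_append)
  qed
  then show ?thesis using cut_D(3)[OF C a ks(1)] ks(2) by metis
qed

text \<open>For \<open>n \<ge> 0\<close> a closed walk with label \<open>n p\<close> is appended to
  \<open>ks'\<close>; the labels then agree, condition (ii) applies, and the \<open>n\<close> extra
  cut arrows cancel the \<open>n p\<close>. Negative \<open>n\<close> exchanges the two
  walks.\<close>

lemma cut_val_eq:
  assumes C: "cut C" and a: "a \<in> FJ" and ks: "walk_at a ks" "walk_at a ks'"
    and diff: "kinds_label ks = kinds_label ks' + frag_cmul n bold_p"
  shows "val C a ks = val C a ks'"
proof -
  have main: "val C a ks = val C a ks'"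
    if ks: "walk_at a ks" "walk_at a ks'"
      and diff: "kinds_label ks = kinds_label ks' + frag_cmul (int n) bold_p" for n ks ks'
  proof -
    let ?b = "a + kinds_label ks'"
    have b: "?b \<in> FJ" using a ks(2) by (rule walk_at_end)
    have np: "frag_cmul (int n) bold_p \<in> F_nonneg" by (simp add: F_nonneg_def lookup_bold_p)
    have "?b + frag_cmul (int n) bold_p \<in> FJ"
      using FJ_cong[OF b] b by (simp add: deg_H_bold_p)
    then obtain ks1 where ks1: "walk_at ?b ks1" "kinds_label ks1 = frag_cmul (int n) bold_p"
      using walk_exists[OF b np] by blast
    have "eps C (walk a ks) = eps C (walk a (ks' @ ks1))"
      using ks ks1 diff by (intro cut_D(3)[OF C a]) (simp_all add: walk_at_append)
    also have "\<dots> = eps C (walk a ks') + n"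
      by (simp add: walk_append eps_append cut_eps_multiple[OF C b ks1])
    finally show ?thesis by (simp add: val_def diff frag_cmul_distrib)
  qed
  show ?thesis
  proof (cases "n \<ge> 0")
    case True
    then show ?thesis using main[OF ks, of "nat n"] diff by simp
  next
    case False
    have "kinds_label ks' = kinds_label ks + frag_cmul (int (nat (- n))) bold_p"
      using False diff by (simp flip: minus_frag_cmul)
    then show ?thesis by (rule main[OF ks(2,1), symmetric])
  qed
qed

text \<open>Well-definedness of \<^term>\<open>kappa\<close>: a walk between the two sources is attached to both walks.\<close>
lemma cut_val_period:
  assumes C: "cut C" and a: "a \<in> FJ" "walk_at a ks" "deg_H (kinds_label ks) = deg_H 0"
    and b: "b \<in> FJ" "walk_at b ks'" "deg_H (kinds_label ks') = deg_H 0"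
    and tau: "tau (kinds_label ks) = tau (kinds_label ks')"
  shows "val C a ks = val C b ks'"
proof -
  obtain n where n: "kinds_label ks = kinds_label ks' + frag_cmul n bold_p"
    using tau_deg_H_eq[OF _ _ tau] walk_at_label a b by metis
  obtain \<delta> where \<delta>: "walk_at a \<delta>" "deg_H (a + kinds_label \<delta>) = deg_H b"
    using walk_connects[OF a(1) b(1)] by blast
  have a': "a + kinds_label ks \<in> FJ" "a + kinds_label \<delta> \<in> FJ"
    using walk_at_end a \<delta> by blast+
  have eq: "deg_H a = deg_H (a + kinds_label ks)"
    using deg_H_add_cong[OF a(3), of a] by (simp add: add.commute)
  have \<delta>': "walk_at (a + kinds_label ks) \<delta>" "val C (a + kinds_label ks) \<delta> = val C a \<delta>"
    using walk_at_cong[OF a(1) a'(1) eq \<delta>(1)] val_cong[OF a(1) a'(1) eq \<delta>(1)] by auto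
  have ks': "walk_at (a + kinds_label \<delta>) ks'" "val C (a + kinds_label \<delta>) ks' = val C b ks'"
    using walk_at_cong[OF b(1) a'(2) \<delta>(2)[symmetric] b(2)]
      val_cong[OF b(1) a'(2) \<delta>(2)[symmetric] b(2)] by auto
  \<comment> \<open>Both composites start at \<open>a\<close> and their labels differ by
    \<open>n p\<close>; the value of \<open>\<delta>\<close> then cancels from both sides.\<close>
  have "val C a (ks @ \<delta>) = val C a (\<delta> @ ks')"
  proof (rule cut_val_eq[OF C a(1)])
    show "walk_at a (ks @ \<delta>)" "walk_at a (\<delta> @ ks')"
      using a \<delta> \<delta>' ks' by (simp_all add: walk_at_append)
    show "kinds_label (ks @ \<delta>) = kinds_label (\<delta> @ ks') + frag_cmul n bold_p"
      using n by (simp add: add_ac)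
  qed
  then show ?thesis by (simp add: val_append \<delta>' ks')
qed

end

section \<open>From upper sets to cuts\<close>

lemma additive_int: "Modules.additive g \<Longrightarrow> g k = k * g 1" for g :: "int \<Rightarrow> int"
proof (induction k rule: int_induct[where k = 0])
  case base
  then show ?case by (simp add: additive.zero)
next
  case (step1 i)
  then show ?case by (simp add: additive.add distrib_right)
next
  case (step2 i)
  then show ?case by (simp add: additive.diff left_diff_distrib)
qed

text \<open>Writes an additive function as an integral linear form, which can be extended to the
  real space containing \<open>P\<close>.\<close>

lemma dual_lattice_expand:
  assumes "m \<in> dual_lattice"
  shows "m w = (\<Sum>i\<in>UNIV. w $ i * m (axis i 1))"
proof -
  have m: "Modules.additive m" using assms by (simp add: dual_lattice_def)
  have "(\<Sum>i\<in>UNIV. axis i (w $ i)) = w"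
    by (simp add: vec_eq_iff axis_def)
  then have "m w = (\<Sum>i\<in>UNIV. m (axis i (w $ i)))"
    using additive.sum[OF m] by metis
  also have "\<dots> = (\<Sum>i\<in>UNIV. w $ i * m (axis i 1))"
  proof (intro sum.cong refl)
    fix i
    have "Modules.additive (\<lambda>k. m (axis i k))"
    proof
      fix x y :: int
      have "axis i (x + y) = axis i x + (axis i y :: int ^ 'a)"
        by (simp add: vec_eq_iff axis_def)
      then show "m (axis i (x + y)) = m (axis i x) + m (axis i y)"
        using additive.add[OF m] by metis
    qed
    then show "m (axis i (w $ i)) = w $ i * m (axis i 1)"
      by (rule additive_int)
  qed
  finally show ?thesis .
qed

context simplicial_setting
begin

text \<open>A level set of the real extension of \<open>m\<close> is convex. If it contains the
  extreme points of \<open>P\<close>, it contains their hull, which is \<open>P\<close>.\<close>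

lemma dual_lattice_const:
  assumes m: "m \<in> dual_lattice" and const: "\<And>w. w \<in> vertices \<Longrightarrow> m w = c"
    and u: "real_vec u \<in> P"
  shows "m u = c"
proof -
  define f where "f x = (\<Sum>i\<in>UNIV. x $ i * real_of_int (m (axis i 1)))" for x :: "real ^ 'n"
  have f: "f (real_vec w) = real_of_int (m w)" for w
    by (simp add: f_def real_vec_def dual_lattice_expand[OF m, of w])
  have add: "f (x + y) = f x + f y" and scale: "f (r *\<^sub>R x) = r * f x" for x y r
    by (simp_all add: f_def sum.distrib sum_distrib_left algebra_simps)
  have "{x. x extreme_point_of P} \<subseteq> {x. f x = real_of_int c}"
  proof
    fix x assume x: "x \<in> {x. x extreme_point_of P}"
    then obtain w where "x = real_vec w" using lattice_P by blast
    then show "x \<in> {x. f x = real_of_int c}"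
      using x const[of w] f[of w] by (simp add: vertices_def)
  qed
  moreover have "convex {x. f x = real_of_int c}"
  proof (rule convexI)
    fix x y and r t :: real
    assume "x \<in> {x. f x = real_of_int c}" "y \<in> {x. f x = real_of_int c}" "r + t = 1"
    then show "r *\<^sub>R x + t *\<^sub>R y \<in> {x. f x = real_of_int c}"
      by (simp add: add scale flip: distrib_right)
  qed
  ultimately have "convex hull {x. x extreme_point_of P} \<subseteq> {x. f x = real_of_int c}"
    by (rule hull_minimal)
  moreover have "P = convex hull {x. x extreme_point_of P}"
    using polytope_P by (intro Krein_Milman_Minkowski polytope_imp_compact polytope_imp_convex)
  ultimately have "f (real_vec u) = real_of_int c" using u by blast
  then show ?thesis by (simp add: f)
qed

end

section \<open>Lattice points of \<open>P\<close> and the group \<open>G u\<close>\<close>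

locale lattice_point_setting = simplicial_setting P l l' v v' I
  for P :: "(real ^ 'n) set" and l l' :: nat and v v' :: "nat \<Rightarrow> int ^ 'n"
    and I :: "((int ^ 'n) \<Rightarrow>\<^sub>0 int) set set" +
  fixes u :: "int ^ 'n"
  assumes u_in_P: "real_vec u \<in> P"
begin

text \<open>If \<open>n p\<close> equals \<open>A_u u m\<close>, then \<open>m\<close> takes the
  constant value \<open>n + m u\<close> on the vertices, hence also at the point \<open>u\<close> of
  \<open>P\<close>, so \<open>n = 0\<close>.\<close>

lemma deg_G_p_torsion_free:
  assumes "deg_G u (a + frag_cmul n bold_p) = deg_G u a"
  shows "n = 0"
proof -
  have "frag_cmul n bold_p \<in> A_u u ` dual_lattice"
    using assms by (simp add: deg_G_eq_iff)
  then obtain m where m: "m \<in> dual_lattice" "frag_cmul n bold_p = A_u u m" by blast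
  have "m w = n + m u" if w: "w \<in> vertices" for w
  proof -
    have "Poly_Mapping.lookup (A_P m) w = (\<Sum>x\<in>vertices. if x = w then m x else 0)"
      unfolding A_P_def lookup_sum by (intro sum.cong) auto
    also have "\<dots> = m w" using finite_vertices w by simp
    finally have "Poly_Mapping.lookup (A_u u m) w = m w - m u"
      using w by (simp add: A_u_def lookup_minus lookup_bold_p)
    moreover have "Poly_Mapping.lookup (A_u u m) w = n"
      using w by (simp add: lookup_bold_p flip: m(2))
    ultimately show ?thesis by simp
  qed
  then have "m u = n + m u" using dual_lattice_const[OF m(1) _ u_in_P] by blast
  then show ?thesis by simp
qed

lemma deg_G_shift_inj:
  assumes "deg_G u (a + frag_cmul n bold_p) = deg_G u (a + frag_cmul k bold_p)"
  shows "n = k"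
proof -
  have "deg_G u (0 + frag_cmul (n - k) bold_p) = deg_G u 0"
    using assms by (simp add: deg_G_eq_iff frag_cmul_diff_distrib)
  then have "n - k = 0" by (rule deg_G_p_torsion_free)
  then show ?thesis by simp
qed

lemma deg_G_F_cong:
  "deg_G u a = deg_G u b \<Longrightarrow> b \<in> carrier F \<Longrightarrow> a \<in> carrier F"
proof -
  assume eq: "deg_G u a = deg_G u b" and b: "b \<in> carrier F"
  then obtain m where "a - b = A_u u m" unfolding deg_G_eq_iff by blast
  then have "a = A_u u m + b" by (metis diff_add_cancel)
  then show "a \<in> carrier F" using b by simp
qed

lemma q_inv_J_eq: "q_inv_J u = deg_G u ` FJ"
  by (auto simp: q_inv_J_def carrier_G q_deg_G FJ_def simp del: FJ_in_F)

lemma deg_G_in_q_inv_J: "deg_G u a \<in> q_inv_J u \<longleftrightarrow> a \<in> FJ"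
proof
  assume "deg_G u a \<in> q_inv_J u"
  then obtain b where b: "b \<in> FJ" "deg_G u a = deg_G u b" unfolding q_inv_J_eq by blast
  then show "a \<in> FJ"
    using FJ_cong[OF b(1)] deg_G_F_cong[OF b(2)] deg_G_imp_deg_H[OF b(2)] by simp
qed (simp add: q_inv_J_eq)

lemma ge_G_iff:
  assumes "a \<in> carrier F" "b \<in> carrier F"
  shows "ge_G u (deg_G u a) (deg_G u b) \<longleftrightarrow> (\<exists>c\<in>F_nonneg. deg_G u a = deg_G u (b + c))"
proof -
  have "ge_G u (deg_G u a) (deg_G u b) \<longleftrightarrow> (\<exists>c\<in>F_nonneg. deg_G u (a - b) = deg_G u c)"
    using assms by (auto simp: ge_G_def deg_G_inv deg_G_mult)
  also have "\<dots> \<longleftrightarrow> (\<exists>c\<in>F_nonneg. deg_G u a = deg_G u (b + c))"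
    by (simp add: deg_G_eq_iff diff_diff_eq)
  finally show ?thesis .
qed

lemma FJ_shift: "a + frag_cmul n bold_p \<in> FJ \<longleftrightarrow> a \<in> FJ"
proof -
  have "b + frag_cmul k bold_p \<in> FJ" if "b \<in> FJ" for b k
    using FJ_cong[OF that] that by (simp add: deg_H_bold_p)
  from this[of "a + frag_cmul n bold_p" "- n"] this[of a n] show ?thesis
    by (auto simp flip: minus_frag_cmul)
qed

end

section \<open>Upper sets in the preimage of \<open>J\<close> and their lifts\<close>

locale upper_set_setting = lattice_point_setting P l l' v v' I u
  for P :: "(real ^ 'n) set" and l l' :: nat and v v' :: "nat \<Rightarrow> int ^ 'n"
    and I :: "((int ^ 'n) \<Rightarrow>\<^sub>0 int) set set" and u :: "int ^ 'n" +
  fixes U :: "((int ^ 'n) \<Rightarrow>\<^sub>0 int) set set"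
  assumes upper_U: "U \<in> upper_sets u"
begin

lemma U_in_FJ: "deg_G u a \<in> U \<Longrightarrow> a \<in> FJ"
  using upper_U deg_G_in_q_inv_J by (auto simp: upper_sets_def nontrivial_upper_set_def)

lemma U_repr: "U = deg_G u ` {a. deg_G u a \<in> U}"
  using upper_U by (auto simp: upper_sets_def nontrivial_upper_set_def q_inv_J_eq)

lemma U_add:
  assumes "deg_G u a \<in> U" "c \<in> F_nonneg" "a + c \<in> FJ"
  shows "deg_G u (a + c) \<in> U"
proof -
  have "a \<in> carrier F" using U_in_FJ[OF assms(1)] by simp
  then have "ge_G u (deg_G u (a + c)) (deg_G u a)"
    using assms(2,3) by (subst ge_G_iff) auto
  then show ?thesis
    using upper_U assms deg_G_in_q_inv_J[of "a + c"]
    unfolding upper_sets_def nontrivial_upper_set_def by blast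
qed

lemma U_mono:
  assumes "deg_G u (a + frag_cmul n bold_p) \<in> U" "n \<le> k"
  shows "deg_G u (a + frag_cmul k bold_p) \<in> U"
proof -
  have eq: "a + frag_cmul k bold_p = (a + frag_cmul n bold_p) + frag_cmul (k - n) bold_p"
    by (simp add: frag_cmul_diff_distrib)
  have a: "a \<in> FJ" using U_in_FJ[OF assms(1)] by (simp only: FJ_shift)
  have "(a + frag_cmul n bold_p) + frag_cmul (k - n) bold_p \<in> FJ"
    using a by (simp only: FJ_shift)
  then show ?thesis
    unfolding eq using U_add[OF assms(1) cmul_p_nonneg] assms(2) by simp
qed

abbreviation JU :: "((int ^ 'n) \<Rightarrow>\<^sub>0 int) set set" where
  "JU \<equiv> J_of u U"

lemma JU_iff: "deg_G u a \<in> JU \<longleftrightarrow> deg_G u a \<in> U \<and> deg_G u (a + frag_cmul (- 1) bold_p) \<notin> U"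
proof -
  have "deg_G u a \<in> (q_inv_J u - U) #>\<^bsub>G u\<^esub> p_vec u \<longleftrightarrow>
      deg_G u (a + frag_cmul (- 1) bold_p) \<notin> U" if "a \<in> FJ"
  proof
    assume "deg_G u a \<in> (q_inv_J u - U) #>\<^bsub>G u\<^esub> p_vec u"
    then obtain b where b: "b \<in> FJ" "deg_G u b \<notin> U" "deg_G u a = deg_G u (b + bold_p)"
      by (auto simp: r_coset_def p_vec_def q_inv_J_eq deg_G_mult)
    have "deg_G u (a + frag_cmul (- 1) bold_p) = deg_G u b"
      using deg_G_add_cong[OF b(3), of "frag_cmul (- 1) bold_p"] by simp
    then show "deg_G u (a + frag_cmul (- 1) bold_p) \<notin> U" using b by simp
  next
    let ?b = "a + frag_cmul (- 1) bold_p"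
    assume "deg_G u ?b \<notin> U"
    moreover have "?b \<in> FJ" using that by (simp only: FJ_shift)
    moreover have "deg_G u a = deg_G u ?b \<otimes>\<^bsub>G u\<^esub> p_vec u"
      using that by (simp add: p_vec_def deg_G_mult)
    ultimately show "deg_G u a \<in> (q_inv_J u - U) #>\<^bsub>G u\<^esub> p_vec u"
      unfolding r_coset_def q_inv_J_eq by blast
  qed
  then show ?thesis using U_in_FJ[of a] by (auto simp: J_of_def)
qed

lemma JU_shift_iff:
  "deg_G u (a + frag_cmul n bold_p) \<in> JU \<longleftrightarrow>
    deg_G u (a + frag_cmul n bold_p) \<in> U \<and> deg_G u (a + frag_cmul (n - 1) bold_p) \<notin> U"
  unfolding JU_iff by (simp add: frag_cmul_diff_distrib add_diff_eq)

lemma JU_in_FJ: "deg_G u a \<in> JU \<Longrightarrow> a \<in> FJ"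
  using JU_iff U_in_FJ by blast

lemma JU_repr: "g \<in> JU \<Longrightarrow> \<exists>a\<in>FJ. g = deg_G u a"
  using U_repr U_in_FJ unfolding J_of_def by blast

text \<open>Any two elements of \<open>FJ\<close> become comparable after a shift by a multiple of
  \<open>p\<close>, so each such line contains members and non-members of \<open>U\<close>.\<close>

lemma JU_shift_exists:
  assumes a: "a \<in> FJ"
  shows "\<exists>n. deg_G u (a + frag_cmul n bold_p) \<in> JU"
proof -
  have "U \<subseteq> deg_G u ` FJ" "U \<noteq> {}" "U \<noteq> deg_G u ` FJ"
    using upper_U by (auto simp: upper_sets_def nontrivial_upper_set_def q_inv_J_eq)
  then obtain b c where b: "b \<in> FJ" "deg_G u b \<in> U" and c: "c \<in> FJ" "deg_G u c \<notin> U"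
    by blast
  obtain n where n: "(a - b) + frag_cmul n bold_p \<in> F_nonneg"
    using F_nonneg_shift[of "a - b"] a b(1) by auto
  have eq: "b + ((a - b) + frag_cmul n bold_p) = a + frag_cmul n bold_p" by simp
  have "deg_G u (a + frag_cmul n bold_p) \<in> U"
    using U_add[OF b(2) n] a unfolding eq FJ_shift by simp
  moreover obtain m where m: "(c - a) + frag_cmul m bold_p \<in> F_nonneg"
    using F_nonneg_shift[of "c - a"] a c(1) by auto
  have eq': "(a + frag_cmul (- m) bold_p) + ((c - a) + frag_cmul m bold_p) = c"
    by (simp flip: minus_frag_cmul)
  have "deg_G u (a + frag_cmul (- m) bold_p) \<notin> U"
    using U_add[OF _ m, of "a + frag_cmul (- m) bold_p"] c unfolding eq' by blast
  ultimately show ?thesis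
    unfolding JU_shift_iff
    by (rule int_threshold[of "\<lambda>n. deg_G u (a + frag_cmul n bold_p) \<in> U", rotated])
       (rule U_mono)
qed

lemma JU_shift_unique:
  assumes "deg_G u (a + frag_cmul n bold_p) \<in> JU" "deg_G u (a + frag_cmul k bold_p) \<in> JU"
  shows "n = k"
  using assms unfolding JU_shift_iff
  using int_threshold_unique[of "\<lambda>n. deg_G u (a + frag_cmul n bold_p) \<in> U" n k] U_mono by blast

text \<open>The fibres of \<open>q\<close> are lines of shifts by \<open>p\<close>, and each line
  has one threshold.\<close>

lemma JU_deg_H_inj:
  assumes "deg_G u a \<in> JU" "deg_G u b \<in> JU" "deg_H a = deg_H b"
  shows "deg_G u a = deg_G u b"
proof -
  obtain n where n: "deg_G u a = deg_G u (b + frag_cmul n bold_p)"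
    using deg_H_eq_deg_G[OF assms(3)] by blast
  have "n = 0" using JU_shift_unique[of b n 0] assms n by simp
  then show ?thesis using n by simp
qed

lemma lift_deg_H:
  assumes "deg_G u a \<in> JU"
  shows "lift JU (deg_H a) = deg_G u a"
proof -
  have "inj_on q JU"
  proof (rule inj_onI)
    fix x y assume xy: "x \<in> JU" "y \<in> JU" "q x = q y"
    then obtain a b where "x = deg_G u a" "y = deg_G u b" using JU_repr by blast
    then show "x = y" using xy JU_deg_H_inj by (simp add: q_deg_G)
  qed
  then show ?thesis
    unfolding lift_def using assms inv_into_f_f[of q JU "deg_G u a"] by (simp add: q_deg_G)
qed

lemma arrow_lift:
  assumes a: "deg_G u a \<in> JU" and k: "arrow_at a k"
  shows "deg_G u (a + label k) \<in> JU \<or> deg_G u (a + label k + frag_cmul (- 1) bold_p) \<in> JU"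
proof -
  have aF: "a \<in> FJ" using a by (rule JU_in_FJ)
  have kk: "kind_ok k" using k by (rule arrow_at_kind_ok)
  have b: "a + label k \<in> FJ" using arrow_at_head[OF aF k] .
  have "deg_G u (a + label k) \<in> U"
    using U_add[OF _ label_nonneg[OF kk] b] a JU_iff by blast
  \<comment> \<open>The constant 2: adding the nonnegative element \<open>p - label k\<close> leads
    from here to \<open>a - p\<close>, just below the threshold of \<open>a\<close>. So the
    threshold at the head is at shift 0 or -1.\<close>
  moreover have "deg_G u (a + label k + frag_cmul (- 2) bold_p) \<notin> U"
  proof
    assume *: "deg_G u (a + label k + frag_cmul (- 2) bold_p) \<in> U"
    have eq: "a + label k + frag_cmul (- 2) bold_p + (bold_p - label k) = a + frag_cmul (- 1) bold_p"
      by (intro poly_mapping_eqI) (simp add: lookup_add lookup_minus)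
    have "deg_G u (a + frag_cmul (- 1) bold_p) \<in> U"
      using U_add[OF * label_le_p[OF kk]] aF unfolding eq FJ_shift by blast
    then show False using a JU_iff by blast
  qed
  ultimately show ?thesis
    using JU_shift_iff[of "a + label k" 0] JU_shift_iff[of "a + label k" "- 1"] by auto
qed

text \<open>The lift of the head is \<open>a + label k + n p\<close> for one \<open>n\<close>. The
  defining equation of \<open>C_of\<close> says \<open>n = -1\<close>, since \<open>p\<close> has
  infinite order in \<open>G u\<close>.\<close>

lemma C_of_iff:
  assumes a: "deg_G u a \<in> JU" and k: "arrow_at a k"
  shows "(orbit (tau a), k) \<in> C_of u JU \<longleftrightarrow> deg_G u (a + label k + frag_cmul (- 1) bold_p) \<in> JU"
proof -
  have aF: "a \<in> FJ" using a by (rule JU_in_FJ)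
  have kF: "label k \<in> carrier F" using arrow_at_kind_ok[OF k] by simp
  have b: "a + label k \<in> FJ" using arrow_at_head[OF aF k] .
  obtain n where n: "deg_G u (a + label k + frag_cmul n bold_p) \<in> JU"
    using JU_shift_exists[OF b] by blast
  have lift_head: "lift JU (deg_H (a + label k)) = deg_G u (a + label k + frag_cmul n bold_p)"
    using lift_deg_H[OF n] by (simp only: deg_H_bold_p)
  have "(orbit (tau a), k) \<in> C_of u JU \<longleftrightarrow>
      lift JU (deg_H a) \<otimes>\<^bsub>G u\<^esub> deg_G u (label k) =
      lift JU (deg_H (a + label k)) \<otimes>\<^bsub>G u\<^esub> p_vec u"
    using k arcs_Q_C_iff[OF aF] head_Q_C[OF aF k] vertex_J_orbit[OF aF] vertex_J_orbit[OF b]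
    by (simp add: C_of_def Q_C_simps(3))
  also have "\<dots> \<longleftrightarrow> deg_G u (a + label k) = deg_G u (a + label k + frag_cmul n bold_p + bold_p)"
    unfolding lift_head lift_deg_H[OF a] p_vec_def
    using aF kF by (subst (1 2) deg_G_mult) auto
  also have "\<dots> \<longleftrightarrow> n = - 1"
  proof
    assume "deg_G u (a + label k) = deg_G u (a + label k + frag_cmul n bold_p + bold_p)"
    then have "deg_G u (a + label k + frag_cmul (n + 1) bold_p) = deg_G u (a + label k)"
      by (simp add: frag_cmul_distrib add.assoc)
    then have "n + 1 = 0" by (rule deg_G_p_torsion_free)
    then show "n = - 1" by simp
  next
    assume "n = - 1"
    then show "deg_G u (a + label k) = deg_G u (a + label k + frag_cmul n bold_p + bold_p)"
      by simp
  qed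
  also have "\<dots> \<longleftrightarrow> deg_G u (a + label k + frag_cmul (- 1) bold_p) \<in> JU"
    using n JU_shift_unique[OF n, of "- 1"] by metis
  finally show ?thesis .
qed

text \<open>The induction restarts at the corrected head \<open>a + val ?C a [k]\<close>, because
  \<open>a + label k\<close> need not represent an element of \<open>JU\<close>. Both have the same
  degree, so the remaining walk and its value carry over.\<close>

lemma walk_lift:
  assumes "deg_G u a \<in> JU" "walk_at a ks"
  shows "deg_G u (a + val (C_of u JU) a ks) \<in> JU"
  using assms
proof (induction ks arbitrary: a)
  case Nil
  then show ?case by (simp add: val_def eps_def)
next
  case (Cons k ks)
  let ?C = "C_of u JU"
  have aF: "a \<in> FJ" using Cons.prems(1) by (rule JU_in_FJ)
  have k: "arrow_at a k" and ks: "walk_at (a + label k) ks" using Cons.prems by auto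
  have k1: "a + val ?C a [k] =
      (if (orbit (tau a), k) \<in> ?C then a + label k + frag_cmul (- 1) bold_p else a + label k)"
    by (simp add: val_def eps_def)
  have b: "deg_G u (a + val ?C a [k]) \<in> JU"
    unfolding k1 using arrow_lift[OF Cons.prems(1) k] C_of_iff[OF Cons.prems(1) k] by auto
  have bF: "a + val ?C a [k] \<in> FJ" using b by (rule JU_in_FJ)
  have head: "a + label k \<in> FJ" using arrow_at_head[OF aF k] .
  have "deg_H (a + label k) = deg_H (a + val ?C a [k])"
    using deg_H_val[of a ?C a "[k]"] by simp
  then have ks': "walk_at (a + val ?C a [k]) ks"
      "val ?C (a + val ?C a [k]) ks = val ?C (a + label k) ks"
    using walk_at_cong[OF head bF _ ks] val_cong[OF head bF _ ks] by blast+
  have "val ?C a (k # ks) = val ?C a [k] + val ?C (a + label k) ks"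
    using val_append[of ?C a "[k]" ks] by simp
  then show ?case using Cons.IH[OF b ks'(1)] ks'(2) by (simp add: add.assoc)
qed

lemma JU_nonempty: "\<exists>a\<in>FJ. deg_G u a \<in> JU"
  using JU_shift_exists FJ_nonempty JU_in_FJ by blast

lemma JU_representative:
  assumes "a \<in> FJ"
  obtains b where "deg_G u b \<in> JU" "b \<in> FJ" "deg_H b = deg_H a"
  using JU_shift_exists[OF assms] JU_in_FJ deg_H_bold_p by metis

lemma walk_eps:
  assumes "deg_G u a \<in> JU" "walk_at a ks"
  shows "deg_G u (a + kinds_label ks + frag_cmul (- int (eps (C_of u JU) (walk a ks))) bold_p) \<in> JU"
  using walk_lift[OF assms] by (simp add: val_def add_diff_eq flip: minus_frag_cmul)

text \<open>By \<open>walk_eps\<close> the number of cut arrows is minus the shift that returns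
  \<open>a + kinds_label ks\<close> to \<open>JU\<close>. Uniqueness of that shift gives both
  conditions: for label \<open>p\<close> it is -1, and it depends on the label alone.\<close>

lemma C_of_is_cut: "cut (C_of u JU)"
  unfolding cut_iff
proof (intro conjI ballI allI impI)
  show "C_of u JU \<subseteq> arcs Q_C" by (auto simp: C_of_def)
next
  fix a ks assume a: "a \<in> FJ" and ks: "walk_at a ks \<and> kinds_label ks = bold_p"
  obtain b where b: "deg_G u b \<in> JU" "b \<in> FJ" "deg_H b = deg_H a"
    using JU_representative[OF a] .
  have ks': "walk_at b ks" "walk b ks = walk a ks"
    using walk_at_cong[OF a b(2) b(3)[symmetric]] ks by auto
  have "deg_G u (b + frag_cmul (1 - int (eps (C_of u JU) (walk b ks))) bold_p) \<in> JU"
    using walk_eps[OF b(1) ks'(1)] ks by (simp add: frag_cmul_diff_distrib add_diff_eq flip: minus_frag_cmul)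
  then have "1 - int (eps (C_of u JU) (walk b ks)) = 0"
    using b(1) by (intro JU_shift_unique[of b]) simp_all
  then show "eps (C_of u JU) (walk a ks) = 1" using ks'(2) by simp
next
  fix a ks ks' assume a: "a \<in> FJ"
    and w: "walk_at a ks \<and> walk_at a ks' \<and> kinds_label ks = kinds_label ks'"
  obtain b where b: "deg_G u b \<in> JU" "b \<in> FJ" "deg_H b = deg_H a"
    using JU_representative[OF a] .
  have ks1: "walk_at b ks" "walk b ks = walk a ks"
    using walk_at_cong[OF a b(2) b(3)[symmetric]] w by auto
  have ks2: "walk_at b ks'" "walk b ks' = walk a ks'"
    using walk_at_cong[OF a b(2) b(3)[symmetric]] w by auto
  have "- int (eps (C_of u JU) (walk b ks)) = - int (eps (C_of u JU) (walk b ks'))"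
    using walk_eps[OF b(1) ks1(1)] walk_eps[OF b(1) ks2(1)] w
    by (intro JU_shift_unique[of "b + kinds_label ks"]) simp_all
  then show "eps (C_of u JU) (walk a ks) = eps (C_of u JU) (walk a ks')"
    using ks1(2) ks2(2) by simp
qed

text \<open>The walk leads from one lift to another of the same degree, and these coincide.\<close>

lemma val_closed:
  assumes a: "a \<in> FJ" "walk_at a ks" "deg_H (kinds_label ks) = deg_H 0"
  shows "deg_G u (val (C_of u JU) a ks) = deg_G u 0"
proof -
  let ?C = "C_of u JU"
  obtain b where b: "deg_G u b \<in> JU" "b \<in> FJ" "deg_H b = deg_H a"
    using JU_representative[OF a(1)] .
  have ks: "walk_at b ks" "val ?C b ks = val ?C a ks"
    using walk_at_cong[OF a(1) b(2) b(3)[symmetric] a(2)]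
      val_cong[OF a(1) b(2) b(3)[symmetric] a(2)] by auto
  have "deg_H (b + val ?C b ks) = deg_H b"
    using deg_H_add_cong[OF a(3), of b] by (simp add: deg_H_val add.commute)
  then have "deg_G u (b + val ?C b ks) = deg_G u b"
    using JU_deg_H_inj walk_lift[OF b(1) ks(1)] b(1) by blast
  then show ?thesis by (simp add: deg_G_eq_iff ks(2))
qed

lemma C_of_has_type: "has_type (C_of u JU) u"
proof -
  let ?C = "C_of u JU"
  have val_K: "val ?C a ks \<in> A_u u ` dual_lattice"
    if "a \<in> FJ" "walk_at a ks" "tau (kinds_label ks) \<in> B" for a ks
    using val_closed[OF that(1,2)] walk_at_period[OF that(1,2)] that(3)
    by (simp add: deg_G_eq_iff)
  have "kappa ?C ` B = A_u u ` dual_lattice"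
  proof (intro equalityI subsetI)
    fix z assume "z \<in> kappa ?C ` B"
    then obtain b where b: "b \<in> B" "z = kappa ?C b" by blast
    obtain a ks where "a \<in> FJ" "walk_at a ks" "tau (kinds_label ks) = b" "kappa ?C b = val ?C a ks"
      using kappa_E[OF b(1)] .
    then show "z \<in> A_u u ` dual_lattice" using val_K b by simp
  next
    fix z assume "z \<in> A_u u ` dual_lattice"
    then obtain m where m: "m \<in> dual_lattice" "z = A_u u m" by blast
    have "A_P m = A_P m + frag_cmul 0 bold_p" by simp
    then have "A_P m \<in> ker_H" unfolding ker_H_def using m(1) by blast
    then have deg: "deg_H (A_P m) = deg_H 0" by (simp add: deg_H_eq_iff)
    then have B: "tau (A_P m) \<in> B" using tau_in_B_iff[OF A_P_in_F] by (metis frag_cmul_zero)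
    obtain a ks where ks: "a \<in> FJ" "walk_at a ks" "tau (kinds_label ks) = tau (A_P m)"
        "kappa ?C (tau (A_P m)) = val ?C a ks"
      using kappa_E[OF B] .
    have deg': "deg_H (kinds_label ks) = deg_H 0"
      using walk_at_period[OF ks(1,2)] ks(3) B by simp
    then obtain n where n: "kinds_label ks = A_P m + frag_cmul n bold_p"
      using tau_deg_H_eq[OF walk_at_label[OF ks(2)] A_P_in_F ks(3)] deg by auto
    \<comment> \<open>The summand \<open>m u\<close> comes from
      \<open>A_P m = A_u u m + (m u) p\<close>. Both the value of the walk and \<open>z\<close>
      vanish in \<open>G u\<close>, so infinite order of \<open>p\<close> will force this integer to
      be zero.\<close>
    let ?n = "n - int (eps ?C (walk a ks)) + m u"
    have val: "val ?C a ks = z + frag_cmul ?n bold_p"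
      by (simp add: val_def n m(2) A_u_def frag_cmul_distrib frag_cmul_diff_distrib)
    have "deg_G u z = deg_G u 0" unfolding deg_G_eq_iff using m by simp
    then have "deg_G u (z + frag_cmul ?n bold_p) = deg_G u z"
      using val_closed[OF ks(1,2) deg'] val by simp
    then have "?n = 0" by (rule deg_G_p_torsion_free)
    then have "z = kappa ?C (tau (A_P m))" using val ks(4) by simp
    then show "z \<in> kappa ?C ` B" using B by blast
  qed
  then show ?thesis unfolding has_type_def A_u_def by blast
qed

text \<open>Recovers \<open>U\<close> from its thresholds, so that comparing upper sets reduces to
  comparing lifts.\<close>

lemma U_iff_JU: "deg_G u a \<in> U \<longleftrightarrow> (\<exists>n\<ge>0. deg_G u (a + frag_cmul (- n) bold_p) \<in> JU)"
proof
  assume U: "deg_G u a \<in> U"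
  obtain n where n: "deg_G u (a + frag_cmul n bold_p) \<in> JU"
    using JU_shift_exists[OF U_in_FJ[OF U]] by blast
  have "\<not> n > 0"
  proof
    assume "n > 0"
    then have "deg_G u (a + frag_cmul (n - 1) bold_p) \<in> U"
      using U_mono[of a 0 "n - 1"] U by simp
    then show False using n JU_shift_iff by blast
  qed
  then show "\<exists>n\<ge>0. deg_G u (a + frag_cmul (- n) bold_p) \<in> JU"
    using n by (intro exI[of _ "- n"]) simp
next
  assume "\<exists>n\<ge>0. deg_G u (a + frag_cmul (- n) bold_p) \<in> JU"
  then obtain n where "n \<ge> 0" "deg_G u (a + frag_cmul (- n) bold_p) \<in> U"
    using JU_iff by blast
  then show "deg_G u a \<in> U" using U_mono[of a "- n" 0] by simp
qed

end

section \<open>From cuts to upper sets\<close>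

context lattice_point_setting
begin

lemma mem_shift_iff:
  assumes "U \<in> upper_sets u"
  shows "deg_G u b \<in> U #>\<^bsub>G u\<^esub> (p_vec u [^]\<^bsub>G u\<^esub> (n::int)) \<longleftrightarrow>
    deg_G u (b + frag_cmul (- n) bold_p) \<in> U"
proof -
  interpret upper_set_setting P l l' v v' I u U by unfold_locales (rule assms)
  have pow: "p_vec u [^]\<^bsub>G u\<^esub> n = deg_G u (frag_cmul n bold_p)"
    by (simp add: p_vec_def deg_G_int_pow)
  show ?thesis
  proof
    assume "deg_G u b \<in> U #>\<^bsub>G u\<^esub> (p_vec u [^]\<^bsub>G u\<^esub> n)"
    then obtain g where g: "g \<in> U" "deg_G u b = g \<otimes>\<^bsub>G u\<^esub> deg_G u (frag_cmul n bold_p)"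
      unfolding r_coset_def pow by blast
    obtain a where a: "g = deg_G u a" using g(1) U_repr by blast
    then have "a \<in> carrier F" using g(1) U_in_FJ FJ_in_F by blast
    then have "deg_G u b = deg_G u (a + frag_cmul n bold_p)"
      using g(2) a by (simp add: deg_G_mult)
    from deg_G_add_cong[OF this, of "frag_cmul (- n) bold_p"]
    have "deg_G u (b + frag_cmul (- n) bold_p) = deg_G u a"
      by (simp flip: minus_frag_cmul)
    then show "deg_G u (b + frag_cmul (- n) bold_p) \<in> U" using g(1) a by simp
  next
    assume U: "deg_G u (b + frag_cmul (- n) bold_p) \<in> U"
    have "b + frag_cmul (- n) bold_p \<in> carrier F" using U_in_FJ[OF U] by (rule FJ_in_F)
    then have "deg_G u b = deg_G u (b + frag_cmul (- n) bold_p) \<otimes>\<^bsub>G u\<^esub> deg_G u (frag_cmul n bold_p)"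
      by (simp only: deg_G_mult F_cmul bold_p_in_F) (simp flip: minus_frag_cmul)
    then show "deg_G u b \<in> U #>\<^bsub>G u\<^esub> (p_vec u [^]\<^bsub>G u\<^esub> n)"
      unfolding r_coset_def pow using U by blast
  qed
qed

lemma upper_set_eq_shift_iff:
  assumes "U \<in> upper_sets u" "V \<in> upper_sets u"
  shows "V = U #>\<^bsub>G u\<^esub> (p_vec u [^]\<^bsub>G u\<^esub> (n::int)) \<longleftrightarrow>
    (\<forall>a. deg_G u (a + frag_cmul n bold_p) \<in> V \<longleftrightarrow> deg_G u a \<in> U)" (is "?L \<longleftrightarrow> ?R")
proof
  assume ?L
  then show ?R
    using mem_shift_iff[OF assms(1), of _ n] by (simp flip: minus_frag_cmul)
next
  assume R: ?R
  have eq: "deg_G u b \<in> V \<longleftrightarrow> deg_G u b \<in> U #>\<^bsub>G u\<^esub> (p_vec u [^]\<^bsub>G u\<^esub> n)" for b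
    using R[rule_format, of "b + frag_cmul (- n) bold_p"] mem_shift_iff[OF assms(1), of b n]
    by (simp flip: minus_frag_cmul)
  have "V \<subseteq> range (deg_G u)"
    using assms(2) by (auto simp: upper_sets_def nontrivial_upper_set_def q_inv_J_eq)
  moreover have "U #>\<^bsub>G u\<^esub> (p_vec u [^]\<^bsub>G u\<^esub> n) \<subseteq> range (deg_G u)"
  proof -
    have "U \<subseteq> deg_G u ` carrier F"
      using assms(1) FJ_in_F
      by (auto simp: upper_sets_def nontrivial_upper_set_def q_inv_J_eq)
    then show ?thesis
      by (auto simp: r_coset_def p_vec_def deg_G_int_pow deg_G_mult)
  qed
  ultimately show ?L using eq by blast
qed

text \<open>Each of an upper set and its threshold set is expressed through the other by shifts
  along \<open>p\<close> only, and these commute with the shift by \<open>n p\<close>.\<close>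

lemma J_of_shift_iff:
  assumes "U \<in> upper_sets u" "V \<in> upper_sets u"
  shows "(\<forall>a. deg_G u (a + frag_cmul n bold_p) \<in> V \<longleftrightarrow> deg_G u a \<in> U) \<longleftrightarrow>
    (\<forall>a. deg_G u (a + frag_cmul n bold_p) \<in> J_of u V \<longleftrightarrow> deg_G u a \<in> J_of u U)" (is "?L \<longleftrightarrow> ?R")
proof -
  interpret U: upper_set_setting P l l' v v' I u U by unfold_locales (rule assms)
  interpret V: upper_set_setting P l l' v v' I u V by unfold_locales (rule assms)
  have swap: "a + frag_cmul n bold_p + frag_cmul k bold_p =
      a + frag_cmul k bold_p + frag_cmul n bold_p" for a k
    by (simp add: add_ac)
  show ?thesis
  proof
    assume L: ?L
    show ?R unfolding V.JU_iff U.JU_iff swap using L by blast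
  next
    assume R: ?R
    show ?L unfolding V.U_iff_JU U.U_iff_JU swap using R by blast
  qed
qed

text \<open>Whether an arrow is cut depends on the difference of the lifts at its ends, which a
  common shift by \<open>n p\<close> preserves.\<close>

lemma C_of_eq_if_shift:
  assumes "U \<in> upper_sets u" "V \<in> upper_sets u"
    and shift: "\<And>a. deg_G u (a + frag_cmul n bold_p) \<in> J_of u V \<longleftrightarrow> deg_G u a \<in> J_of u U"
  shows "C_of u (J_of u U) = C_of u (J_of u V)"
proof -
  interpret U: upper_set_setting P l l' v v' I u U by unfold_locales (rule assms)
  interpret V: upper_set_setting P l l' v v' I u V by unfold_locales (rule assms)
  have "\<alpha> \<in> C_of u (J_of u U) \<longleftrightarrow> \<alpha> \<in> C_of u (J_of u V)" if arc: "\<alpha> \<in> arcs Q_C" for \<alpha>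
  proof -
    obtain a0 k where a0: "a0 \<in> FJ" "arrow_at a0 k" "\<alpha> = (orbit (tau a0), k)"
      using arcs_Q_C_E[OF arc] .
    obtain a where a: "deg_G u a \<in> J_of u U" "a \<in> FJ" "deg_H a = deg_H a0"
      using U.JU_representative[OF a0(1)] .
    have k: "arrow_at a k" using a0 a arrow_at_cong[OF a(2) a0(1)] by simp
    have \<alpha>: "\<alpha> = (orbit (tau a), k)" using a0 a orbit_tau_eq_iff[OF a(2) a0(1)] by simp
    let ?b = "a + frag_cmul n bold_p"
    have b: "deg_G u ?b \<in> J_of u V" using shift a(1) by blast
    have kb: "arrow_at ?b k"
      using k arrow_at_cong[OF a(2) V.JU_in_FJ[OF b], of k] deg_H_bold_p by simp
    have "\<alpha> \<in> C_of u (J_of u V) \<longleftrightarrow> deg_G u (?b + label k + frag_cmul (- 1) bold_p) \<in> J_of u V"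
      using V.C_of_iff[OF b kb] unfolding tau_bold_p \<alpha> .
    also have "?b + label k + frag_cmul (- 1) bold_p =
        a + label k + frag_cmul (- 1) bold_p + frag_cmul n bold_p"
      by (simp add: algebra_simps)
    also have "deg_G u \<dots> \<in> J_of u V \<longleftrightarrow> \<alpha> \<in> C_of u (J_of u U)"
      unfolding shift \<alpha> U.C_of_iff[OF a(1) k] ..
    finally show ?thesis ..
  qed
  moreover have "C_of u X \<subseteq> arcs Q_C" for X by (auto simp: C_of_def)
  ultimately show ?thesis by blast
qed

text \<open>The integer \<open>n\<close> is read off at one vertex. Every other vertex is reached by
  a walk, whose value depends only on the common cut and hence carries the same shift along.\<close>

lemma shift_if_C_of_eq:
  assumes "U \<in> upper_sets u" "V \<in> upper_sets u"
    and eq: "C_of u (J_of u U) = C_of u (J_of u V)"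
  shows "\<exists>n. \<forall>a. deg_G u (a + frag_cmul n bold_p) \<in> J_of u V \<longleftrightarrow> deg_G u a \<in> J_of u U"
proof -
  interpret U: upper_set_setting P l l' v v' I u U by unfold_locales (rule assms)
  interpret V: upper_set_setting P l l' v v' I u V by unfold_locales (rule assms)
  let ?C = "C_of u (J_of u U)"
  obtain a0 where a0: "a0 \<in> FJ" "deg_G u a0 \<in> J_of u U" using U.JU_nonempty by blast
  obtain n where n: "deg_G u (a0 + frag_cmul n bold_p) \<in> J_of u V"
    using V.JU_shift_exists[OF a0(1)] by blast
  have n': "a0 + frag_cmul n bold_p \<in> FJ" using n by (rule V.JU_in_FJ)
  have imp: "deg_G u (a + frag_cmul n bold_p) \<in> J_of u V" if a: "deg_G u a \<in> J_of u U" for a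
  proof -
    have "a \<in> FJ" using a by (rule U.JU_in_FJ)
    then obtain ks where ks: "walk_at a0 ks" "deg_H (a0 + kinds_label ks) = deg_H a"
      using walk_connects[OF a0(1)] by blast
    have "deg_H (a0 + val ?C a0 ks) = deg_H a" using ks(2) by (simp add: deg_H_val)
    then have "deg_G u (a0 + val ?C a0 ks) = deg_G u a"
      using U.JU_deg_H_inj U.walk_lift[OF a0(2) ks(1)] a by blast
    from deg_G_add_cong[OF this, of "frag_cmul n bold_p"]
    have "deg_G u (a + frag_cmul n bold_p) =
        deg_G u (a0 + frag_cmul n bold_p + val ?C a0 ks)"
      by (simp add: add_ac)
    moreover have "walk_at (a0 + frag_cmul n bold_p) ks"
      "val ?C (a0 + frag_cmul n bold_p) ks = val ?C a0 ks"
      using walk_at_cong[OF a0(1) n' _ ks(1)] val_cong[OF a0(1) n' _ ks(1)] deg_H_bold_p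
      by simp_all
    ultimately show ?thesis using V.walk_lift[OF n, of ks] eq by simp
  qed
  \<comment> \<open>The converse follows from uniqueness of thresholds: the lift over
    \<open>a\<close> for \<open>U\<close> is sent by the first implication to the only lift for
    \<open>V\<close>.\<close>
  have "deg_G u a \<in> J_of u U" if a: "deg_G u (a + frag_cmul n bold_p) \<in> J_of u V" for a
  proof -
    have "a \<in> FJ" using V.JU_in_FJ[OF a] by (simp only: FJ_shift)
    then obtain k where k: "deg_G u (a + frag_cmul k bold_p) \<in> J_of u U"
      using U.JU_shift_exists by blast
    have "deg_G u (a + frag_cmul (k + n) bold_p) \<in> J_of u V"
      using imp[OF k] by (simp add: frag_cmul_distrib add.assoc)
    then have "k + n = n" using a V.JU_shift_unique by blast
    then show ?thesis using k by simp
  qed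
  with imp show ?thesis by blast
qed

lemma C_of_eq_iff:
  assumes "U \<in> upper_sets u" "V \<in> upper_sets u"
  shows "C_of u (J_of u U) = C_of u (J_of u V) \<longleftrightarrow>
    (\<exists>n::int. V = U #>\<^bsub>G u\<^esub> (p_vec u [^]\<^bsub>G u\<^esub> n))"
  unfolding upper_set_eq_shift_iff[OF assms] J_of_shift_iff[OF assms]
  using C_of_eq_if_shift[OF assms] shift_if_C_of_eq[OF assms] by blast

end

section \<open>The upper set of a cut of type \<open>u\<close>\<close>

locale cut_of_type_setting = lattice_point_setting P l l' v v' I u
  for P :: "(real ^ 'n) set" and l l' :: nat and v v' :: "nat \<Rightarrow> int ^ 'n"
    and I :: "((int ^ 'n) \<Rightarrow>\<^sub>0 int) set set" and u :: "int ^ 'n" +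
  fixes C :: "quot_arrow set"
  assumes cut_C: "cut C" and type_C: "has_type C u"
begin

text \<open>This is where the type enters: \<open>kappa\<close> takes values in the relations of
  \<open>G u\<close>, and by \<open>cut_val_period\<close> the value of any closed walk is a value
  of \<open>kappa\<close>, whichever path the choice picked.\<close>

lemma val_closed_C:
  assumes a: "a \<in> FJ" "walk_at a ks" "deg_H (kinds_label ks) = deg_H 0"
  shows "deg_G u (val C a ks) = deg_G u 0"
proof -
  have B: "tau (kinds_label ks) \<in> B" using walk_at_period[OF a(1,2)] a(3) by simp
  obtain b ks' where b: "b \<in> FJ" "walk_at b ks'" "tau (kinds_label ks') = tau (kinds_label ks)"
      "kappa C (tau (kinds_label ks)) = val C b ks'"
    using kappa_E[OF B] .
  have "deg_H (kinds_label ks') = deg_H 0"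
    using walk_at_period[OF b(1,2)] b(3) B by simp
  then have "val C a ks = kappa C (tau (kinds_label ks))"
    unfolding b(4) using cut_val_period[OF cut_C a b(1,2)] b(3) by simp
  also have "\<dots> \<in> A_u u ` dual_lattice"
    using type_C B unfolding has_type_def A_u_def by blast
  finally show ?thesis by (simp add: deg_G_eq_iff)
qed

text \<open>Both walks are closed by the same return walk, whose value cancels.\<close>

lemma val_endpoints:
  assumes a: "a \<in> FJ" and ks: "walk_at a ks" "walk_at a ks'"
    and ends: "deg_H (a + kinds_label ks) = deg_H (a + kinds_label ks')"
  shows "deg_G u (val C a ks) = deg_G u (val C a ks')"
proof -
  have b: "a + kinds_label ks \<in> FJ" "a + kinds_label ks' \<in> FJ"
    using walk_at_end a ks by blast+
  obtain \<delta> where \<delta>: "walk_at (a + kinds_label ks) \<delta>"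
      "deg_H (a + kinds_label ks + kinds_label \<delta>) = deg_H a"
    using walk_connects[OF b(1) a] by blast
  have \<delta>': "walk_at (a + kinds_label ks') \<delta>"
      "val C (a + kinds_label ks') \<delta> = val C (a + kinds_label ks) \<delta>"
    using walk_at_cong[OF b ends \<delta>(1)] val_cong[OF b ends \<delta>(1)] by auto
  have "deg_H (a + kinds_label ks' + kinds_label \<delta>) = deg_H a"
    using deg_H_add_cong[OF ends] \<delta>(2) by simp
  then have closed: "deg_H (kinds_label (ks @ \<delta>)) = deg_H 0" "deg_H (kinds_label (ks' @ \<delta>)) = deg_H 0"
    using \<delta>(2) by (simp_all add: deg_H_eq_iff)
  have "deg_G u (val C a (ks @ \<delta>)) = deg_G u (val C a (ks' @ \<delta>))"
    using val_closed_C[OF a _ closed(1)] val_closed_C[OF a _ closed(2)] ks \<delta>(1) \<delta>'(1)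
    by (simp add: walk_at_append)
  then show ?thesis by (simp add: val_append \<delta>'(2) deg_G_eq_iff)
qed

definition base :: "(int ^ 'n) \<Rightarrow>\<^sub>0 int" where
  "base = (SOME a. a \<in> FJ)"

lemma base_in_FJ: "base \<in> FJ"
  unfolding base_def using FJ_nonempty by (simp add: some_in_eq)

text \<open>The choice refers only to \<open>deg_H a\<close>, so equal degrees give literally equal
  lifts. In \<open>G u\<close> the chosen walk is irrelevant by
  \<open>val_endpoints\<close>.\<close>

definition cut_lift :: "((int ^ 'n) \<Rightarrow>\<^sub>0 int) \<Rightarrow> ((int ^ 'n) \<Rightarrow>\<^sub>0 int)" where
  "cut_lift a = base +
     val C base (SOME ks. walk_at base ks \<and> deg_H (base + kinds_label ks) = deg_H a)"

lemma cut_lift_E: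
  assumes "a \<in> FJ"
  obtains ks where "walk_at base ks" "deg_H (base + kinds_label ks) = deg_H a"
    "cut_lift a = base + val C base ks"
  using someI_ex[OF walk_connects[OF base_in_FJ assms]] that unfolding cut_lift_def by blast

lemma cut_lift_cong: "deg_H a = deg_H b \<Longrightarrow> cut_lift a = cut_lift b"
  by (simp add: cut_lift_def)

lemma deg_H_cut_lift: "a \<in> FJ \<Longrightarrow> deg_H (cut_lift a) = deg_H a"
  using cut_lift_E[of a] deg_H_val by metis

lemma cut_lift_in_FJ: "a \<in> FJ \<Longrightarrow> cut_lift a \<in> FJ"
  using cut_lift_E[of a] val_in_F base_in_FJ FJ_cong deg_H_cut_lift F_add FJ_in_F by metis

text \<open>The chosen walk to the source followed by \<open>ks\<close> ends at the same vertex as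
  the chosen walk to the target.\<close>

lemma cut_lift_walk:
  assumes a: "a \<in> FJ" and ks: "walk_at a ks"
  shows "deg_G u (cut_lift (a + kinds_label ks)) = deg_G u (cut_lift a + val C a ks)"
proof -
  obtain \<gamma> where \<gamma>: "walk_at base \<gamma>" "deg_H (base + kinds_label \<gamma>) = deg_H a"
      "cut_lift a = base + val C base \<gamma>"
    using cut_lift_E[OF a] .
  obtain \<gamma>' where \<gamma>': "walk_at base \<gamma>'"
      "deg_H (base + kinds_label \<gamma>') = deg_H (a + kinds_label ks)"
      "cut_lift (a + kinds_label ks) = base + val C base \<gamma>'"
    using cut_lift_E[OF walk_at_end[OF a ks]] .
  have b: "base + kinds_label \<gamma> \<in> FJ" using walk_at_end[OF base_in_FJ \<gamma>(1)] .
  have ks': "walk_at (base + kinds_label \<gamma>) ks" "val C (base + kinds_label \<gamma>) ks = val C a ks"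
    using walk_at_cong[OF a b \<gamma>(2)[symmetric] ks] val_cong[OF a b \<gamma>(2)[symmetric] ks] by auto
  have "deg_G u (val C base \<gamma>') = deg_G u (val C base (\<gamma> @ ks))"
  proof (rule val_endpoints[OF base_in_FJ \<gamma>'(1)])
    show "walk_at base (\<gamma> @ ks)" using \<gamma>(1) ks'(1) by (simp add: walk_at_append)
    show "deg_H (base + kinds_label \<gamma>') = deg_H (base + kinds_label (\<gamma> @ ks))"
      using \<gamma>'(2) deg_H_add_cong[OF \<gamma>(2), of "kinds_label ks"] by (simp add: add.assoc)
  qed
  then show ?thesis
    unfolding \<gamma>(3) \<gamma>'(3) by (simp add: val_append ks'(2) deg_G_eq_iff add.assoc)
qed

definition cut_upper_set :: "((int ^ 'n) \<Rightarrow>\<^sub>0 int) set set" where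
  "cut_upper_set = {deg_G u (cut_lift a + frag_cmul n bold_p) | a n. a \<in> FJ \<and> n \<ge> 0}"

text \<open>The level \<open>n\<close> above the lift is well defined: the lift depends only on the
  degree, and \<open>p\<close> has infinite order in \<open>G u\<close>.\<close>

lemma mem_cut_upper_set_iff:
  assumes "a \<in> FJ" "deg_G u a = deg_G u (cut_lift a + frag_cmul n bold_p)"
  shows "deg_G u a \<in> cut_upper_set \<longleftrightarrow> n \<ge> 0"
proof
  assume "deg_G u a \<in> cut_upper_set"
  then obtain b k where b: "b \<in> FJ" "k \<ge> 0"
      "deg_G u a = deg_G u (cut_lift b + frag_cmul k bold_p)"
    by (auto simp: cut_upper_set_def)
  have "deg_H a = deg_H b"
    using deg_G_imp_deg_H[OF b(3)] b(1) by (simp add: deg_H_bold_p deg_H_cut_lift)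
  then have "cut_lift b = cut_lift a" by (intro cut_lift_cong) simp
  then have "n = k" using assms(2) b(3) deg_G_shift_inj by metis
  then show "n \<ge> 0" using b(2) by simp
next
  assume "n \<ge> 0"
  then show "deg_G u a \<in> cut_upper_set"
    unfolding cut_upper_set_def
    by (intro CollectI exI[of _ a] exI[of _ n] conjI assms)
qed

lemma cut_lift_shift_exists:
  assumes "a \<in> FJ"
  shows "\<exists>n. deg_G u a = deg_G u (cut_lift a + frag_cmul n bold_p)"
  using deg_H_eq_deg_G[of a "cut_lift a"] deg_H_cut_lift[OF assms] by simp

lemma cut_upper_set_upper: "cut_upper_set \<in> upper_sets u"
  unfolding upper_sets_def nontrivial_upper_set_def
proof (intro CollectI conjI ballI impI)
  show "cut_upper_set \<subseteq> q_inv_J u"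
    using cut_lift_in_FJ FJ_shift by (auto simp: cut_upper_set_def q_inv_J_eq)
  have lift: "deg_G u (cut_lift base + frag_cmul n bold_p) \<in> cut_upper_set \<longleftrightarrow> n \<ge> 0" for n
  proof -
    have "cut_lift (cut_lift base + frag_cmul n bold_p) = cut_lift base"
      using deg_H_cut_lift[OF base_in_FJ] by (intro cut_lift_cong) (simp add: deg_H_bold_p)
    then show ?thesis
      using cut_lift_in_FJ[OF base_in_FJ] FJ_shift
      by (intro mem_cut_upper_set_iff) simp_all
  qed
  show "cut_upper_set \<noteq> {}" using lift[of 0] by auto
  have "deg_G u (cut_lift base + frag_cmul (- 1) bold_p) \<in> q_inv_J u"
    using cut_lift_in_FJ[OF base_in_FJ] by (simp only: deg_G_in_q_inv_J FJ_shift)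
  then show "cut_upper_set \<noteq> q_inv_J u" using lift[of "- 1"] by auto
next
  fix g h assume g: "g \<in> cut_upper_set" and h: "h \<in> q_inv_J u" and ge: "ge_G u h g"
  obtain a0 n0 where "a0 \<in> FJ" "g = deg_G u (cut_lift a0 + frag_cmul n0 bold_p)"
    using g by (auto simp: cut_upper_set_def)
  then obtain a where a: "a \<in> FJ" "g = deg_G u a"
    using cut_lift_in_FJ FJ_shift by blast
  obtain b where b: "b \<in> FJ" "h = deg_G u b" using h unfolding q_inv_J_eq by blast
  obtain c where c: "c \<in> F_nonneg" "deg_G u b = deg_G u (a + c)"
    using ge a b by (auto simp: ge_G_iff)
  have ac: "a + c \<in> FJ"
    using c(2) b(1) deg_G_in_q_inv_J by metis
  obtain ks where ks: "walk_at a ks" "kinds_label ks = c"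
    using walk_exists[OF a(1) c(1) ac] by blast
  obtain n where n: "deg_G u a = deg_G u (cut_lift a + frag_cmul n bold_p)"
    using cut_lift_shift_exists[OF a(1)] by blast
  then have "n \<ge> 0" using mem_cut_upper_set_iff[OF a(1) n] g a(2) by simp
  \<comment> \<open>Realising \<open>c\<close> by a walk raises the level above the lift by the
    number of cut arrows passed. That number is never negative, so upward closure follows.\<close>
  let ?k = "n + int (eps C (walk a ks))"
  have "deg_G u (a + c) = deg_G u (cut_lift a + frag_cmul n bold_p + c)"
    using n by (rule deg_G_add_cong)
  also have "cut_lift a + frag_cmul n bold_p + c = (cut_lift a + val C a ks) + frag_cmul ?k bold_p"
    by (simp add: val_def ks(2) frag_cmul_distrib)
  also have "deg_G u \<dots> = deg_G u (cut_lift (a + c) + frag_cmul ?k bold_p)"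
    using cut_lift_walk[OF a(1) ks(1)] by (intro deg_G_add_cong) (simp add: ks(2))
  finally have "deg_G u (a + c) \<in> cut_upper_set"
    using mem_cut_upper_set_iff[OF ac, of ?k] \<open>n \<ge> 0\<close> by simp
  then show "h \<in> cut_upper_set" using b(2) c(2) by simp
qed

sublocale upper_set_setting P l l' v v' I u cut_upper_set
  by unfold_locales (rule cut_upper_set_upper)

text \<open>Membership means level at least 0 with the next lower level negative, so the thresholds
  are exactly the lifts built from the cut.\<close>

lemma JU_cut_iff:
  assumes a: "a \<in> FJ"
  shows "deg_G u a \<in> JU \<longleftrightarrow> deg_G u a = deg_G u (cut_lift a)"
proof -
  obtain n where n: "deg_G u a = deg_G u (cut_lift a + frag_cmul n bold_p)"
    using cut_lift_shift_exists[OF a] by blast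
  let ?b = "a + frag_cmul (- 1) bold_p"
  have b: "?b \<in> FJ" using a by (simp only: FJ_shift)
  have "cut_lift ?b = cut_lift a" by (intro cut_lift_cong deg_H_bold_p)
  then have "deg_G u ?b = deg_G u (cut_lift ?b + frag_cmul (n - 1) bold_p)"
    using deg_G_add_cong[OF n, of "frag_cmul (- 1) bold_p"]
    by (simp add: frag_cmul_diff_distrib add_diff_eq)
  then have "deg_G u a \<in> JU \<longleftrightarrow> n = 0"
    unfolding JU_iff using mem_cut_upper_set_iff[OF a n] mem_cut_upper_set_iff[OF b] by auto
  also have "\<dots> \<longleftrightarrow> deg_G u a = deg_G u (cut_lift a)"
    using n deg_G_p_torsion_free[of "cut_lift a" n] by auto
  finally show ?thesis .
qed

lemma C_of_cut_upper_set: "C_of u JU = C"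
proof -
  have "\<alpha> \<in> C_of u JU \<longleftrightarrow> \<alpha> \<in> C" if arc: "\<alpha> \<in> arcs Q_C" for \<alpha>
  proof -
    obtain a0 k where a0: "a0 \<in> FJ" "arrow_at a0 k" "\<alpha> = (orbit (tau a0), k)"
      using arcs_Q_C_E[OF arc] .
    define a where "a = cut_lift a0"
    have a: "a \<in> FJ" "deg_H a = deg_H a0"
      using a0(1) cut_lift_in_FJ deg_H_cut_lift by (simp_all add: a_def)
    have lift_a: "cut_lift a = a" using cut_lift_cong[OF a(2)] by (simp add: a_def)
    have aJ: "deg_G u a \<in> JU" using JU_cut_iff[OF a(1)] lift_a by simp
    have k: "arrow_at a k" using a0 a arrow_at_cong[OF a(1) a0(1)] by simp
    have \<alpha>: "\<alpha> = (orbit (tau a), k)" using a0 a orbit_tau_eq_iff[OF a(1) a0(1)] by simp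
    let ?b = "a + label k + frag_cmul (- 1) bold_p"
    have b: "?b \<in> FJ" using arrow_at_head[OF a(1) k] by (simp only: FJ_shift)
    have "cut_lift ?b = cut_lift (a + label k)" by (intro cut_lift_cong deg_H_bold_p)
    \<comment> \<open>The arrow is treated as a walk of length one from a lifted source: its value
      subtracts \<open>p\<close> from the label precisely when the arrow lies in \<open>C\<close>,
      which is the test of \<open>C_of_iff\<close>.\<close>
    then have "deg_G u (cut_lift ?b) = deg_G u (a + val C a [k])"
      using cut_lift_walk[OF a(1), of "[k]"] k lift_a by simp
    also have "a + val C a [k] = a + label k + frag_cmul (if \<alpha> \<in> C then - 1 else 0) bold_p"
      by (simp add: val_def eps_def \<alpha>)
    finally have "deg_G u ?b = deg_G u (cut_lift ?b) \<longleftrightarrow> \<alpha> \<in> C"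
      using deg_G_shift_inj[of "a + label k" "- 1" "if \<alpha> \<in> C then - 1 else 0"] by auto
    then show ?thesis
      unfolding \<alpha> using C_of_iff[OF aJ k] JU_cut_iff[OF b] by simp
  qed
  moreover have "C_of u JU \<subseteq> arcs Q_C" "C \<subseteq> arcs Q_C"
    using cut_D(1)[OF cut_C] by (auto simp: C_of_def)
  ultimately show ?thesis by blast
qed

end

theorem theorem4p19:
  fixes P :: "(real ^ 'n) set"
    and l l' :: nat
    and v v' :: "nat \<Rightarrow> int ^ 'n"
    and I :: "((int ^ 'n) \<Rightarrow>\<^sub>0 int) set set"
    and u :: "int ^ 'n"
  assumes "simplicial_setting P l l' v v' I"
    and "real_vec u \<in> interior P"
  shows "((\<lambda>I'. quiver_data.C_of P l l' v v' I u (quiver_data.J_of P l v I u I')) `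
           quiver_data.upper_sets P l v I u = quiver_data.cuts_of_type P l l' v v' I u) \<and>
         (\<forall>I\<^sub>1 \<in> quiver_data.upper_sets P l v I u. \<forall>I\<^sub>2 \<in> quiver_data.upper_sets P l v I u.
           quiver_data.C_of P l l' v v' I u (quiver_data.J_of P l v I u I\<^sub>1) =
           quiver_data.C_of P l l' v v' I u (quiver_data.J_of P l v I u I\<^sub>2) \<longleftrightarrow>
           (\<exists>n::int. I\<^sub>2 = I\<^sub>1 #>\<^bsub>polytope_data.G P u\<^esub>
              (polytope_data.p_vec P u [^]\<^bsub>polytope_data.G P u\<^esub> n)))"
proof -
  have "lattice_point_setting P l l' v v' I u"
    using assms interior_subset by (auto simp: lattice_point_setting_def lattice_point_setting_axioms_def)
  then interpret lattice_point_setting P l l' v v' I u .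
  have "(\<lambda>I'. C_of u (J_of u I')) ` upper_sets u = cuts_of_type u"
  proof (intro equalityI subsetI)
    fix C assume "C \<in> (\<lambda>I'. C_of u (J_of u I')) ` upper_sets u"
    then obtain U where U: "U \<in> upper_sets u" "C = C_of u (J_of u U)" by blast
    interpret upper_set_setting P l l' v v' I u U by unfold_locales (rule U)
    show "C \<in> cuts_of_type u"
      using C_of_is_cut C_of_has_type by (simp add: cuts_of_type_def U(2))
  next
    fix C assume "C \<in> cuts_of_type u"
    then interpret cut_of_type_setting P l l' v v' I u C
      by unfold_locales (auto simp: cuts_of_type_def)
    show "C \<in> (\<lambda>I'. C_of u (J_of u I')) ` upper_sets u"
      using C_of_cut_upper_set cut_upper_set_upper by blast
  qed
  then show ?thesis using C_of_eq_iff by blast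
qed

end
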